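(* Let $p \equiv 7 \pmod 8$ be a prime such that the multiplicative order of $2$ modulo $p$ is $\frac{p-1}{2}$. Then there is no generalized bent function from $\mathbb{Z}_2^n$ to $\mathbb{Z}_m$ of type $[n,m] = [t_p, 2p]$. If moreover $2^{p-1} \not\equiv 1 \pmod{p^2}$, then for every integer $e \ge 1$ there is no generalized bent function from $\mathbb{Z}_2^n$ to $\mathbb{Z}_m$ of type $[n,m] = [t_p, 2p^e]$.
   Context: For a positive integer $m$ let $\mathbb{Z}_m = \mathbb{Z}/m\mathbb{Z}$ and $\zeta_m = \exp(2\pi i/m)$. A function $f : \mathbb{Z}_2^n \to \mathbb{Z}_m$ is a generalized bent function of type $[n,m]$ if $\left|\sum_{x \in \mathbb{Z}_2^n} \zeta_m^{f(x)} (-1)^{x\cdot\lambda}\right| = 2^{n/2}$ for every $\lambda \in \mathbb{Z}_2^n$, where $x\cdot\lambda$ is the standard dot product. For a prime $p \equiv 7 \pmod 8$, the prime $2$ splits in $\mathbb{Q}(\sqrt{-p})$; $t_p$ denotes the smallest positive integer such that $\mathfrak{p}^{t_p}$ is principal, where $\mathfrak{p}$ is a prime ideal of the ring of integers of $\mathbb{Q}(\sqrt{-p})$ lying above $2$. *)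

theory Defs
  imports "HOL-Analysis.Analysis" "HOL-Algebra.Ideal_Product" "HOL-Computational_Algebra.Polynomial"
    "HOL-Number_Theory.Number_Theory"
begin

text \<open>Elements of Z_2^n are modelled as functions nat => bool vanishing from index n on.\<close>
definition cube :: "nat \<Rightarrow> (nat \<Rightarrow> bool) set" where
  "cube n = {x. \<forall>i\<ge>n. \<not> x i}"

definition dotp :: "nat \<Rightarrow> (nat \<Rightarrow> bool) \<Rightarrow> (nat \<Rightarrow> bool) \<Rightarrow> nat" where
  "dotp n x l = card {i. i < n \<and> x i \<and> l i}"

text \<open>Generalized bent function of type [n,m]; values in Z_m represented by 0..m-1.\<close>
definition gbent :: "nat \<Rightarrow> nat \<Rightarrow> ((nat \<Rightarrow> bool) \<Rightarrow> nat) \<Rightarrow> bool" where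
  "gbent n m f \<longleftrightarrow> (\<forall>x\<in>cube n. f x < m) \<and>
     (\<forall>l\<in>cube n. cmod (\<Sum>x\<in>cube n. cis (2 * pi / real m) ^ f x * (-1) ^ dotp n x l)
                   = 2 powr (real n / 2))"

definition quadfield :: "nat \<Rightarrow> complex set" where
  "quadfield p = {of_real (of_rat r) + of_real (of_rat s) * (\<i> * of_real (sqrt (real p))) | r s. True}"

definition OK :: "nat \<Rightarrow> complex ring" where
  "OK p = \<lparr> carrier = {z \<in> quadfield p. algebraic_int z}, monoid.mult = (*), one = 1,
            zero = 0, add = (+) \<rparr>"

definition ideal_power :: "nat \<Rightarrow> complex set \<Rightarrow> nat \<Rightarrow> complex set" where
  "ideal_power p P t = P [^]\<^bsub>ideals_set (OK p)\<^esub> t"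

definition tP :: "nat \<Rightarrow> complex set \<Rightarrow> nat" where
  "tP p P = (LEAST t. t > 0 \<and> principalideal (ideal_power p P t) (OK p))"

end

theory Submission
  imports Defs "HOL-Computational_Algebra.Nth_Powers"
    "HOL-Computational_Algebra.Fundamental_Theorem_Algebra"
begin

text \<open>
  Let \<open>q = p ^ e\<close>, \<open>\<zeta>\<close> a primitive \<open>q\<close>-th root of unity and \<open>n = t\<^sub>p\<close>. The number \<open>n\<close> is the least
  positive \<open>k\<close> for which the ring of integers of \<open>\<rat>(\<surd>-p)\<close> has an element of norm \<open>2 ^ k\<close> not
  divisible by 2, and it is odd: a primitive element of norm \<open>2 ^ (2 * s)\<close> yields one of norm \<open>2 ^ s\<close>.

  The values \<open>W l\<close> of the Walsh transform of a generalized bent function lie in \<open>\<int>[\<zeta>]\<close>, have absolute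
  square \<open>2 ^ n\<close> and are congruent modulo 2. The Galois group of \<open>\<rat>(\<zeta>)\<close> is generated
    by \<open>\<sigma> : \<zeta> \<mapsto> \<zeta>\<^sup>2\<close>
  and complex conjugation, and \<open>\<sigma>\<close> is the Frobenius modulo 2, so the two primes above 2 are fixed
  by \<open>\<sigma>\<close>. If \<open>V\<close> is the part of \<open>W l\<close> not divisible
    by 2, then \<open>\<sigma> V / V\<close> is a unit all of whose
  conjugates have absolute value 1, hence a root of unity up to sign; adjusting \<open>V\<close>
    by a root of
  unity makes it \<open>\<sigma>\<close>-invariant, so it lies in the quadratic field and minimality of \<open>n\<close> gives
  \<open>V = W l\<close>. All the \<open>W l\<close> are then divisible
    by the \<open>n\<close>-th power of the same prime above 2, so
  \<open>W l / W 0\<close> is a root of unity up to sign which is 1 modulo a prime above 2, that is \<open>W l = \<plusminus> W 0\<close>.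
  Summing over \<open>l\<close>, an integer multiple of \<open>W 0\<close> has absolute value \<open>2 ^ n\<close>, so \<open>2 ^ n\<close> is a square,
  which contradicts the oddness of \<open>n\<close>.
\<close>

section \<open>Elements of norm a power of two\<close>

text \<open>Ideals of the cyclotomic ring are never factored. Modulo 2 that ring is a product of two
  fields with \<open>2 ^ f\<close> elements, \<open>f\<close> being half the totient of
  \<open>q\<close>; so \<open>x ^ (2 ^ f - 1)\<close> is idempotent modulo 2, and for a primitive
  \<open>W\<close> it is \<open>\<theta>\<close> or \<open>cnj \<theta>\<close>, which tells the
  prime above 2 dividing \<open>W\<close>. Divisibility by the \<open>k\<close>-th power of that
  prime becomes the congruence of \<open>W\<close> and \<open>\<tau> ^ (2 ^ k) * W\<close> modulo
  \<open>2 ^ k\<close>. The ideals in the definition of t_p are traded for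
  \<open>qnorm c u v\<close>, the norm of \<open>u + v * \<theta>\<close> where
  \<open>4 * c = p + 1\<close>: for \<open>k > 0\<close>, the \<open>k\<close>-th power of the prime
  is principal iff the form represents \<open>2 ^ k\<close> with \<open>u\<close>, \<open>v\<close>
  not both even. As t_p is a least number, some such \<open>k\<close> must be exhibited, which is a
  finiteness statement about the class group. The condition on \<open>p\<close> modulo 8 acts twice:
  \<open>c\<close> is even, so 2 splits, and \<open>(p - 1) div 2\<close> is odd, so conjugation is
  not a power of \<sigma>.\<close>

definition qnorm :: "int \<Rightarrow> int \<Rightarrow> int \<Rightarrow> int" where
  "qnorm c u v = u\<^sup>2 + u * v + c * v\<^sup>2"

lemma four_qnorm: "4 * qnorm c u v = (2 * u + v)\<^sup>2 + (4 * c - 1) * v\<^sup>2"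
  by (simp add: qnorm_def power2_eq_square algebra_simps)

lemma qnorm_nonneg: "c > 0 \<Longrightarrow> qnorm c u v \<ge> 0"
  using four_qnorm[of c u v] by (smt (verit) mult_nonneg_nonneg zero_le_power2)

lemma qnorm_pos:
  assumes "c > 0" "u \<noteq> 0 \<or> v \<noteq> 0"
  shows "qnorm c u v > 0"
proof (cases "v = 0")
  case True
  then show ?thesis using assms by (simp add: qnorm_def)
next
  case False
  then have "(4 * c - 1) * v\<^sup>2 > 0" using assms by simp
  then show ?thesis using four_qnorm[of c u v] by (smt (verit) zero_le_power2)
qed

lemma qnorm_eq_1:
  assumes "c \<ge> 2" "qnorm c u v = 1"
  shows "v = 0" "u\<^sup>2 = 1"
proof -
  show v: "v = 0"
  proof (rule ccontr)
    assume "v \<noteq> 0"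
    then have "v\<^sup>2 \<ge> 1" by (simp add: int_one_le_iff_zero_less)
    then have "(4 * c - 1) * v\<^sup>2 \<ge> 7 * 1"
      using assms by (intro mult_mono) auto
    then show False using four_qnorm[of c u v] assms by (smt (verit) zero_le_power2)
  qed
  show "u\<^sup>2 = 1" using assms v by (simp add: qnorm_def)
qed

lemma qnorm_scale: "qnorm c (a * u) (a * v) = a\<^sup>2 * qnorm c u v"
  by (simp add: qnorm_def power2_eq_square algebra_simps)

text \<open>The arguments on the left are the coordinates of
  \<open>(x + y * \<theta>) * cnj (x' + y' * \<theta>)\<close>, so this is multiplicativity of the
  norm.\<close>

lemma qnorm_mult_cnj:
  "qnorm c (x * x' + c * y * y' + x * y') (x' * y - x * y') = qnorm c x y * qnorm c x' y'"
  by (simp add: qnorm_def power2_eq_square algebra_simps)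

lemma extract_power_of_two:
  fixes u v :: int
  assumes "u \<noteq> 0 \<or> v \<noteq> 0"
  obtains i u' v' where "u = 2 ^ i * u'" "v = 2 ^ i * v'" "odd u' \<or> odd v'"
proof -
  have "\<exists>i u' v'. u = 2 ^ i * u' \<and> v = 2 ^ i * v' \<and> (odd u' \<or> odd v')"
    using assms
  proof (induction "nat (\<bar>u\<bar> + \<bar>v\<bar>)" arbitrary: u v rule: less_induct)
    case less
    show ?case
    proof (cases "odd u \<or> odd v")
      case True
      then show ?thesis by (intro exI[of _ 0] exI[of _ u] exI[of _ v]) auto
    next
      case False
      then obtain a b where ab: "u = 2 * a" "v = 2 * b" by (auto elim!: evenE)
      then obtain i u' v' where "a = 2 ^ i * u'" "b = 2 ^ i * v'" "odd u' \<or> odd v'"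
        using less(1)[of a b] less(2) that by fastforce
      then show ?thesis using ab by (intro exI[of _ "Suc i"] exI[of _ u'] exI[of _ v']) auto
    qed
  qed
  then show ?thesis using that by blast
qed

text \<open>Hensel lifting from the root 0 modulo 2. Sending \<theta> to \<open>r\<close> describes
  the \<open>k\<close>-th power of one prime above 2 by the condition
  \<open>2 ^ k dvd x + y * r\<close>.\<close>

lemma power_of_two_root:
  fixes c :: int
  assumes "even c"
  shows "\<exists>r. 2 ^ k dvd r\<^sup>2 - r + c"
proof -
  have "\<exists>r. even r \<and> 2 ^ k dvd r\<^sup>2 - r + c"
  proof (induction k)
    case 0
    then show ?case by auto
  next
    case (Suc k)
    then obtain r s where r: "even r" "r\<^sup>2 - r + c = 2 ^ k * s"
      unfolding dvd_def[of "2 ^ k"] by blast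
    show ?case
    proof (cases "k = 0")
      case True
      then show ?thesis using assms by (intro exI[of _ 0]) auto
    next
      case False
      \<comment> \<open>Newton step: the derivative \<open>2 * r - 1\<close> is -1 modulo 2, so the
        correction is the value \<open>2 ^ k * s\<close> itself. Its square is divisible by
        \<open>2 ^ Suc k\<close> once \<open>k > 0\<close>.\<close>
      have "(r + 2 ^ k * s)\<^sup>2 - (r + 2 ^ k * s) + c = 2 ^ k * s + 2 * r * 2 ^ k * s + 2^k * 2 ^ k * s\<^sup>2 - 2 ^ k * s"
        using r(2) by (simp add: power2_eq_square algebra_simps)
      also have "\<dots> = 2 ^ Suc k * (r * s + 2 ^ (k - 1) * s\<^sup>2)"
        using False by (cases k) (auto simp: algebra_simps)
      finally have "2 ^ Suc k dvd (r + 2 ^ k * s)\<^sup>2 - (r + 2 ^ k * s) + c" by simp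
      moreover have "even (r + 2 ^ k * s)" using r False by simp
      ultimately show ?thesis by blast
    qed
  qed
  then show ?thesis by blast
qed

text \<open>Thue's pigeonhole argument: \<open>(2 ^ m + 1)\<^sup>2\<close> pairs against
  \<open>2 ^ (2 * m)\<close> residues. For a root \<open>r\<close> as above it yields an element of
  the \<open>2 * m\<close>-th power of a prime above 2 with norm at most
  \<open>(c + 2) * 2 ^ (2 * m)\<close>.\<close>

lemma Thue_power_of_four:
  fixes r :: int
  shows "\<exists>x y. (x \<noteq> 0 \<or> y \<noteq> 0) \<and> \<bar>x\<bar> \<le> 2 ^ m \<and> \<bar>y\<bar> \<le> 2 ^ m \<and> 2 ^ (2 * m) dvd x + y * r"
proof -
  define A where "A = {0..2 ^ m :: int} \<times> {0..2 ^ m :: int}"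
  define g where "g = (\<lambda>(x, y). (x + y * r) mod 2 ^ (2 * m))"
  have "card (g ` A) \<le> card {0..<2 ^ (2 * m) :: int}"
    by (intro card_mono) (auto simp: g_def)
  also have "\<dots> = 2 ^ (2 * m)" by (simp add: nat_power_eq)
  also have "\<dots> < card A"
  proof -
    have "card A = (2 ^ m + 1) * (2 ^ m + 1)"
      by (simp add: A_def card_cartesian_product nat_add_distrib nat_power_eq)
    moreover have "(2::nat) ^ (2 * m) = 2 ^ m * 2 ^ m" by (simp add: mult_2 power_add)
    ultimately show ?thesis by simp
  qed
  finally have "\<not> inj_on g A" by (rule pigeonhole)
  then obtain a b a' b' where ab: "(a, b) \<in> A" "(a', b') \<in> A" "(a, b) \<noteq> (a', b')" "g (a, b) = g (a', b')"
    by (auto simp: inj_on_def)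
  have "2 ^ (2 * m) dvd (a - a') + (b - b') * r"
    using ab(4) by (simp add: g_def mod_eq_dvd_iff algebra_simps)
  with ab show ?thesis
    by (intro exI[of _ "a - a'"] exI[of _ "b - b'"]) (auto simp: A_def abs_le_iff)
qed

text \<open>Two elements of large powers of a prime above 2 that have the same small cofactor norm
  and agree modulo it have a quotient supported above 2: this is finiteness of the class
  group, restricted to the class of that prime.\<close>

lemma exists_primitive_power_of_two_norm:
  fixes c :: int
  assumes "even c" "c > 0"
  shows "\<exists>k>0. \<exists>u v. qnorm c u v = 2 ^ k \<and> (odd u \<or> odd v)"
proof -
  \<comment> \<open>The factor 2 makes \<open>i * M\<close> even, as Thue's argument requires; the
    size makes a gap \<open>M\<close> between exponents exceed twice the exponent of 2 in any
    cofactor up to \<open>c + 2\<close>.\<close>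
  define M where "M = 2 * (nat c + 3)"
  define B where "B = {0..c + 2} \<times> {0..c + 2} \<times> {0..c + 2}"
  define T where "T = card B + 1"
  obtain r where r: "2 ^ (T * M) dvd r\<^sup>2 - r + c"
    using power_of_two_root[OF assms(1)] by blast
  have ex: "\<exists>x y \<kappa>. (x \<noteq> 0 \<or> y \<noteq> 0) \<and> 2 ^ (i * M) dvd x + y * r \<and> qnorm c x y = 2 ^ (i * M) * \<kappa> \<and> 0 < \<kappa> \<and> \<kappa> \<le> c + 2"
    if "i \<in> {1..T}" for i
  proof -
    define m where "m = i * (nat c + 3)"
    have m: "i * M = 2 * m" by (simp add: m_def M_def)
    have rm: "2 ^ (2 * m) dvd r\<^sup>2 - r + c"
      using r that by (intro dvd_trans[OF le_imp_power_dvd r]) (simp add: m[symmetric])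
    obtain x y where xy: "x \<noteq> 0 \<or> y \<noteq> 0" "\<bar>x\<bar> \<le> 2 ^ m" "\<bar>y\<bar> \<le> 2 ^ m" "2 ^ (2 * m) dvd x + y * r"
      using Thue_power_of_four by blast
    then obtain s where s: "x + y * r = 2 ^ (2 * m) * s" by (auto elim: dvdE)
    \<comment> \<open>With \<theta> replaced by \<open>r\<close> and its conjugate by
      \<open>1 - r\<close> the norm factors, up to a multiple of
      \<open>r\<^sup>2 - r + c\<close>.\<close>
    have "qnorm c x y = (x + y * r) * (x + y - y * r) + y\<^sup>2 * (r\<^sup>2 - r + c)"
      by (simp add: qnorm_def power2_eq_square algebra_simps)
    then have "2 ^ (2 * m) dvd qnorm c x y" using xy(4) rm by simp
    then obtain \<kappa> where \<kappa>: "qnorm c x y = 2 ^ (2 * m) * \<kappa>" by (auto elim: dvdE)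
    have "\<kappa> > 0"
      using qnorm_pos[OF assms(2) xy(1)] \<kappa> by (simp add: zero_less_mult_iff)
    have p2: "(2::int) ^ (2 * m) = 2 ^ m * 2 ^ m" by (simp add: mult_2 power_add)
    have "x\<^sup>2 \<le> 2 ^ (2 * m)" "y\<^sup>2 \<le> 2 ^ (2 * m)"
      using power_mono[OF xy(2), of 2] power_mono[OF xy(3), of 2]
        by (simp_all add: power_mult[symmetric] mult.commute)
    moreover have "x * y \<le> 2 ^ (2 * m)"
    proof -
      have "x * y \<le> \<bar>x\<bar> * \<bar>y\<bar>" by (metis abs_ge_self abs_mult)
      also have "\<dots> \<le> 2 ^ m * 2 ^ m" using xy by (intro mult_mono) auto
      finally show ?thesis using p2 by simp
    qed
    moreover have "c * y\<^sup>2 \<le> c * 2 ^ (2 * m)"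
      using \<open>y\<^sup>2 \<le> 2 ^ (2 * m)\<close> assms(2) by (intro mult_left_mono) auto
    ultimately have "qnorm c x y \<le> 2 ^ (2 * m) * (c + 2)"
      by (simp add: qnorm_def algebra_simps)
    then have "\<kappa> \<le> c + 2" using \<kappa> by simp
    then show ?thesis using xy \<kappa> \<open>\<kappa> > 0\<close> m by auto
  qed
  then obtain X Y K where XYK: "\<And>i. i \<in> {1..T} \<Longrightarrow> (X i \<noteq> 0 \<or> Y i \<noteq> 0) \<and> 2 ^ (i * M) dvd X i + Y i * r \<and>
      qnorm c (X i) (Y i) = 2 ^ (i * M) * K i \<and> 0 < K i \<and> K i \<le> c + 2"
    by metis
  define g where "g = (\<lambda>i. (K i, X i mod K i, Y i mod K i))"
  have "g ` {1..T} \<subseteq> B"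
  proof
    fix b assume "b \<in> g ` {1..T}"
    then obtain i where i: "i \<in> {1..T}" "b = g i" by blast
    have "x mod K i \<in> {0..c + 2}" for x
      using XYK[OF i(1)] by (smt (verit) atLeastAtMost_iff pos_mod_bound pos_mod_sign)
    then show "b \<in> B" using XYK[OF i(1)] unfolding i(2) g_def B_def by auto
  qed
  moreover have "finite B" by (simp add: B_def)
  ultimately have "card (g ` {1..T}) \<le> card B" by (rule card_mono[rotated])
  then have "\<not> inj_on g {1..T}" by (intro pigeonhole) (simp add: T_def)
  then obtain i j where ij: "i \<in> {1..T}" "j \<in> {1..T}" "i < j" "g i = g j"
    unfolding inj_on_def by (metis linorder_neqE_nat)
  define s where "s = i * M" define t where "t = j * M"
  have ts: "t \<ge> s + M"
    using mult_le_mono1[of "Suc i" j M] ij(3) by (simp add: s_def t_def)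
  define x' where "x' = X i" define y' where "y' = Y i"
  define x where "x = X j" define y where "y = Y j"
  define \<kappa> where "\<kappa> = K i"
  have w: "2 ^ s dvd x' + y' * r" "qnorm c x' y' = 2 ^ s * \<kappa>" "0 < \<kappa>" "\<kappa> \<le> c + 2"
    using XYK[OF ij(1)] by (auto simp: x'_def y'_def \<kappa>_def s_def)
  have z: "2 ^ t dvd x + y * r" "qnorm c x y = 2 ^ t * \<kappa>"
    using XYK[OF ij(2)] ij(4) by (auto simp: x_def y_def \<kappa>_def t_def g_def)
  have cong: "\<kappa> dvd x - x'" "\<kappa> dvd y - y'"
    using ij(4) by (auto simp: g_def x_def x'_def y_def y'_def \<kappa>_def mod_eq_dvd_iff dvd_diff_commute)
  have rt: "2 ^ t dvd r\<^sup>2 - r + c"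
    using ij(2) by (intro dvd_trans[OF le_imp_power_dvd r]) (simp add: t_def)
  \<comment> \<open>\<open>U + V * \<theta>\<close> is z times the conjugate of w, for z =
    \<open>x + y * \<theta>\<close> and w = \<open>x' + y' * \<theta>\<close>. It is divisible by
    \<open>2 ^ s\<close>, as z and the conjugate of w lie in \<open>s\<close>-th powers of conjugate
    primes, and by \<kappa>, as it is congruent to the norm of w modulo \<kappa>.\<close>
  define U where "U = x * x' + c * y * y' + x * y'"
  define V where "V = x' * y - x * y'"
  have NUV: "qnorm c U V = 2 ^ (s + t) * \<kappa>\<^sup>2"
    using qnorm_mult_cnj[of c x x' y y'] w z by (simp add: U_def V_def power_add power2_eq_square)
  have s_le: "s \<le> t" using ts by simp
  have zs: "2 ^ s dvd x + y * r" "2 ^ s dvd r\<^sup>2 - r + c"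
    using dvd_trans[OF le_imp_power_dvd[OF s_le]] z(1) rt by blast+
  have "V = (x' + y' * r) * y - (x + y * r) * y'" by (simp add: V_def algebra_simps)
  then have sV: "2 ^ s dvd V" using zs w by simp
  have "U = (x + y * r) * (x' + y') - y * r * (x' + y' * r) + y * y' * (r\<^sup>2 - r + c)"
    by (simp add: U_def algebra_simps power2_eq_square)
  then have sU: "2 ^ s dvd U" using zs w by simp
  have "V = x' * (y - y') - (x - x') * y'" by (simp add: V_def algebra_simps)
  then have kV: "\<kappa> dvd V" using cong by simp
  have "U = (x - x') * (x' + y') + c * y' * (y - y') + qnorm c x' y'"
    by (simp add: U_def qnorm_def power2_eq_square algebra_simps)
  then have kU: "\<kappa> dvd U" using cong w by simp
  \<comment> \<open>Only the odd part of \<kappa> is coprime to \<open>2 ^ s\<close> and can be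
    divided out together with it; the exponent \<open>j\<kappa>\<close> stays as an error
    term.\<close>
  obtain j\<kappa> \<kappa>' where k': "\<kappa> = 2 ^ j\<kappa> * \<kappa>'" "odd \<kappa>'"
    using extract_power_of_two[of \<kappa> 0] w(3)
    by (metis less_irrefl mult_eq_0_iff even_zero power_eq_0_iff zero_neq_numeral)
  have "\<kappa>' > 0" using k' w by (simp add: zero_less_mult_iff)
  have "coprime (2 ^ s) \<kappa>'" using k' by simp
  moreover have "\<kappa>' dvd U" "\<kappa>' dvd V" using kU kV k' by (auto dest: dvd_mult_right)
  ultimately have "2 ^ s * \<kappa>' dvd U" "2 ^ s * \<kappa>' dvd V"
    using sU sV by (simp_all add: divides_mult)
  then obtain U1 V1 where UV1: "U = 2 ^ s * \<kappa>' * U1" "V = 2 ^ s * \<kappa>' * V1"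
    by (auto elim!: dvdE)
  have "(2 ^ s * \<kappa>')\<^sup>2 * qnorm c U1 V1 = 2 ^ (s + t) * \<kappa>\<^sup>2"
    using NUV unfolding UV1 qnorm_scale .
  also have "\<dots> = (2 ^ s * \<kappa>')\<^sup>2 * 2 ^ (t - s + 2 * j\<kappa>)"
  proof -
    have "(2::int) ^ (s + t) * (2 ^ j\<kappa>)\<^sup>2 = (2 ^ s)\<^sup>2 * 2 ^ (t - s + 2 * j\<kappa>)"
      using s_le by (simp add: power_mult[symmetric] power_add[symmetric] flip: power_mult)
    then show ?thesis by (simp add: k'(1) power_mult_distrib)
  qed
  finally have N1: "qnorm c U1 V1 = 2 ^ (t - s + 2 * j\<kappa>)"
    using \<open>\<kappa>' > 0\<close> by simp
  have "U + V * r = (x + y * r) * (x' + y' - y' * r) + y * y' * (r\<^sup>2 - r + c)"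
    by (simp add: U_def V_def algebra_simps power2_eq_square)
  then have "2 ^ t dvd U + V * r" using z(1) rt by simp
  then have "2 ^ s * 2 ^ (t - s) dvd 2 ^ s * (\<kappa>' * (U1 + V1 * r))"
    using s_le by (simp add: UV1 algebra_simps flip: power_add)
  then have "2 ^ (t - s) dvd \<kappa>' * (U1 + V1 * r)" by simp
  then have L1: "2 ^ (t - s) dvd U1 + V1 * r"
    using k'(2) by (simp add: coprime_dvd_mult_right_iff)
  have "U1 \<noteq> 0 \<or> V1 \<noteq> 0" using N1 by (auto simp: qnorm_def)
  then obtain n U2 V2 where UV2: "U1 = 2 ^ n * U2" "V1 = 2 ^ n * V2" "odd U2 \<or> odd V2"
    using extract_power_of_two by blast
  have N2: "2 ^ (2 * n) * qnorm c U2 V2 = 2 ^ (t - s + 2 * j\<kappa>)"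
    using N1 unfolding UV2 qnorm_scale by (simp add: power_mult[symmetric] mult.commute)
  then have "qnorm c U2 V2 dvd 2 ^ (t - s + 2 * j\<kappa>)" by (metis dvd_triv_right)
  then obtain k where "normalize (qnorm c U2 V2) = normalize (2 ^ k)"
    using divides_primepow[of 2 "qnorm c U2 V2"] by auto
  then have k: "qnorm c U2 V2 = 2 ^ k" using qnorm_nonneg[OF assms(2), of U2 V2] by simp
  \<comment> \<open>A unit here would give \<open>t - s \<le> n\<close> by the divisibility
    \<open>L1\<close>, while comparing norms gives \<open>2 * n = t - s + 2 * j\<kappa>\<close>; so
    \<open>t - s\<close> would be at most \<open>2 * j\<kappa>\<close>, against the choice of
    \<open>M\<close>.\<close>
  have "k > 0"
  proof (rule ccontr)
    assume "\<not> k > 0"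
    then have one: "qnorm c U2 V2 = 1" using k by simp
    have "c \<ge> 2" using assms by (auto elim!: evenE)
    note u = qnorm_eq_1[OF this one]
    have "odd U2" using u(2) by (metis even_power odd_one zero_less_numeral pos2)
    have e: "2 * n = t - s + 2 * j\<kappa>" using N2 one by (simp add: power_inject_exp)
    have "(2::int) ^ (t - s) dvd 2 ^ n * U2" using L1 UV2 u(1) by simp
    then have "(2::int) ^ (t - s) dvd 2 ^ n"
      using \<open>odd U2\<close> by (simp add: coprime_dvd_mult_left_iff)
    then have "t - s \<le> n" by (simp add: dvd_power_iff)
    then have "t - s \<le> 2 * j\<kappa>" using e by simp
    moreover have "j\<kappa> < nat c + 3"
    proof -
      have "int j\<kappa> < 2 ^ j\<kappa>"
        using less_exp[of j\<kappa>] by (metis of_nat_less_iff of_nat_numeral of_nat_power)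
      also have "\<dots> \<le> 2 ^ j\<kappa> * \<kappa>'" using \<open>\<kappa>' > 0\<close> by simp
      also have "\<dots> \<le> c + 2" using k' w by simp
      finally show ?thesis by simp
    qed
    ultimately show False using ts by (simp add: M_def)
  qed
  then show ?thesis using k UV2(3) by blast
qed

text \<open>Elementary substitute for the oddness of the class number. In
  \<open>a\<^sup>2 + p * v\<^sup>2 = S\<^sup>2\<close> the factors \<open>S - a\<close> and
  \<open>S + a\<close> are coprime and positive, so primality of \<open>p\<close> leaves only
  \<open>p * x\<^sup>2\<close> and \<open>y\<^sup>2\<close> for them; their sum \<open>2 * S\<close>
  is four times the wanted norm.\<close>

lemma primitive_norm_sqrt:
  fixes c u v :: int
  assumes "prime (4 * c - 1)" "even c" "s > 0" "qnorm c u v = 2 ^ (2 * s)" "odd u \<or> odd v"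
  shows "\<exists>u v. qnorm c u v = 2 ^ s \<and> (odd u \<or> odd v)"
proof -
  define p where "p = 4 * c - 1"
  have p: "prime p" "p > 0" using assms(1) by (auto simp: p_def dest: prime_gt_0_int)
  have "even (qnorm c u v)" using assms(3,4) by simp
  then have "odd v" using assms(2,5) by (auto simp: qnorm_def)
  define a where "a = 2 * u + v"
  have "odd a" using \<open>odd v\<close> by (simp add: a_def)
  define S where "S = (2::int) ^ (s + 1)"
  have SS: "S\<^sup>2 = 4 * 2 ^ (2 * s)"
    by (simp add: S_def power_mult_distrib power_mult[symmetric] mult.commute)
  have eq: "a\<^sup>2 + p * v\<^sup>2 = S\<^sup>2"
    using four_qnorm[of c u v] assms(4) by (simp add: a_def p_def SS)
  have fac: "(S - a) * (S + a) = p * v\<^sup>2"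
    using eq by (simp add: algebra_simps power2_eq_square)
  have "v \<noteq> 0" using \<open>odd v\<close> by auto
  then have "p * v\<^sup>2 > 0" using p by simp
  then have "a\<^sup>2 < S\<^sup>2" using eq by simp
  then have "\<bar>a\<bar> < S"
    using power2_less_imp_less[of "\<bar>a\<bar>" S] by (simp add: S_def)
  then have pos: "S - a > 0" "S + a > 0" by auto
  have "coprime (S - a) (S + a)"
  proof (rule coprimeI)
    fix d assume d: "d dvd S - a" "d dvd S + a"
    then have "d dvd 2 ^ (s + 2)" using dvd_add[OF d] by (simp add: S_def)
    moreover have "odd d"
      using d(1) \<open>odd a\<close> by (metis S_def dvd_trans even_diff even_power even_numeral add_gr_0 zero_less_one odd_add)
    then have "coprime d (2 ^ (s + 2))"
      by (metis coprime_commute coprime_power_left_iff coprime_left_2_iff_odd)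
    ultimately show "is_unit d" using coprime_absorb_left by blast
  qed
  have key: "\<exists>x y. X = p * x\<^sup>2 \<and> Y = y\<^sup>2" if XY: "X * Y = p * v\<^sup>2" "coprime X Y" "X > 0" "Y > 0" "p dvd X" for X Y :: int
  proof -
    obtain X' where X': "X = p * X'" using XY(5) by (auto elim: dvdE)
    have "X' > 0" using X' XY(3) p by (simp add: zero_less_mult_iff)
    have "X' * Y = v\<^sup>2" using XY(1) X' p by simp
    then have "nat X' * nat Y = (nat \<bar>v\<bar>)\<^sup>2" using \<open>X' > 0\<close> XY(4)
      by (simp add: nat_mult_distrib[symmetric] nat_power_eq[symmetric])
    moreover have "coprime (nat X') (nat Y)"
      using XY(2,4) X' \<open>X' > 0\<close>
      by (metis coprime_int_iff coprime_mult_left_iff int_nat_eq less_imp_le)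
    ultimately have "is_nth_power 2 (nat X')" "is_nth_power 2 (nat Y)"
      using is_nth_power_mult_coprime_natD[of "nat X'" "nat Y" 2] \<open>X' > 0\<close> XY(4)
        by auto
    then obtain x y where "nat X' = x ^ 2" "nat Y = y ^ 2" by (auto elim!: is_nth_powerE)
    then have "X' = (int x)\<^sup>2" "Y = (int y)\<^sup>2" using \<open>X' > 0\<close> XY(4)
      by (metis int_nat_eq less_imp_le of_nat_power)+
    then show ?thesis using X' by blast
  qed
  have "p dvd (S - a) * (S + a)" using fac by simp
  then have "p dvd S - a \<or> p dvd S + a" using p(1) by (simp add: prime_dvd_mult_iff)
  then obtain x y where xy: "p * x\<^sup>2 + y\<^sup>2 = 2 * S" "odd x" "odd y"
  proof
    assume "p dvd S - a"
    then obtain x y where "S - a = p * x\<^sup>2" "S + a = y\<^sup>2"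
      using key[OF fac \<open>coprime (S - a) (S + a)\<close> pos] by blast
    moreover from this have "odd (p * x\<^sup>2)" "odd (y\<^sup>2)"
      using \<open>odd a\<close> by (metis S_def even_diff even_power even_numeral add_gr_0 zero_less_one odd_add)+
    ultimately show ?thesis using that[of x y] by auto
  next
    assume "p dvd S + a"
    then obtain x y where "S + a = p * x\<^sup>2" "S - a = y\<^sup>2"
      using key[of "S + a" "S - a"] fac \<open>coprime (S - a) (S + a)\<close> pos
        by (auto simp: mult.commute coprime_commute)
    moreover from this have "odd (p * x\<^sup>2)" "odd (y\<^sup>2)"
      using \<open>odd a\<close> by (metis S_def even_diff even_power even_numeral add_gr_0 zero_less_one odd_add)+
    ultimately show ?thesis using that[of x y] by auto
  qed
  obtain w where w: "y - x = 2 * w" using xy by (metis dvdE even_diff odd_add)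
  have "4 * qnorm c w x = y\<^sup>2 + p * x\<^sup>2"
    unfolding four_qnorm p_def using w by (simp add: algebra_simps)
  also have "\<dots> = 4 * 2 ^ s" using xy(1) by (simp add: S_def)
  finally show ?thesis using xy(2) by (intro exI[of _ w] exI[of _ x]) simp
qed

section \<open>The ring of integers of the quadratic field\<close>

definition ipoly :: "int poly \<Rightarrow> complex \<Rightarrow> complex" where
  "ipoly F z = poly (map_poly of_int F) z"

lemma ipoly_0 [simp]: "ipoly 0 z = 0"
  by (simp add: ipoly_def)

lemma ipoly_pCons [simp]: "ipoly (pCons a F) z = of_int a + z * ipoly F z"
  by (simp add: ipoly_def map_poly_pCons)

lemma ipoly_1 [simp]: "ipoly 1 z = 1"
  by (simp add: one_pCons)

lemma ipoly_add [simp]: "ipoly (F + G) z = ipoly F z + ipoly G z"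
proof -
  have "map_poly of_int (F + G) = (map_poly of_int F + map_poly of_int G :: complex poly)"
    by (rule poly_eqI) (simp add: coeff_map_poly)
  then show ?thesis by (simp add: ipoly_def)
qed

lemma ipoly_smult [simp]: "ipoly (Polynomial.smult a F) z = of_int a * ipoly F z"
  by (induction F) (auto simp: algebra_simps)

lemma ipoly_minus [simp]: "ipoly (- F) z = - ipoly F z"
  using ipoly_smult[of "-1" F z] by simp

lemma ipoly_diff [simp]: "ipoly (F - G) z = ipoly F z - ipoly G z"
  using ipoly_add[of F "- G" z] by simp

lemma ipoly_mult [simp]: "ipoly (F * G) z = ipoly F z * ipoly G z"
  by (induction F) (auto simp: algebra_simps)

lemma ipoly_power [simp]: "ipoly (F ^ n) z = ipoly F z ^ n"
  by (induction n) auto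

lemma ipoly_sum [simp]: "ipoly (sum f A) z = (\<Sum>x\<in>A. ipoly (f x) z)"
  by (induction A rule: infinite_finite_induct) auto

lemma ipoly_monom [simp]: "ipoly (Polynomial.monom a n) z = of_int a * z ^ n"
  by (simp add: ipoly_def map_poly_monom poly_monom)

lemma ipoly_altdef:
  assumes "degree F < n"
  shows "ipoly F z = (\<Sum>i<n. of_int (Polynomial.coeff F i) * z ^ i)"
proof -
  have "F = (\<Sum>i<n. Polynomial.monom (Polynomial.coeff F i) i)"
    using poly_as_sum_of_monoms'[of F "n - 1"] assms
    by (cases n) (auto simp: lessThan_Suc_atMost)
  then have "ipoly F z = ipoly (\<Sum>i<n. Polynomial.monom (Polynomial.coeff F i) i) z" by simp
  then show ?thesis by simp
qed

lemma ipoly_of_int: "ipoly F (of_int a) = of_int (poly F a)"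
  by (induction F) auto

lemma cnj_ipoly: "cnj (ipoly F z) = ipoly F (cnj z)"
  by (induction F) auto

text \<open>Pseudo-division yields \<open>a * F = T * Q\<close> with \<open>a\<close> a power of the
  leading coefficient; contents are multiplicative, so \<open>a\<close> divides the content of
  \<open>Q\<close> and cancels. Used both for integrality in the quadratic field and for the
  cyclotomic polynomial.\<close>

lemma primitive_minimal_dvd:
  assumes "content T = 1" "ipoly T z = 0"
    and min: "\<And>G. ipoly G z = 0 \<Longrightarrow> degree G < degree T \<Longrightarrow> G = 0"
    and "ipoly F z = 0"
  shows "T dvd F"
proof -
  have T0: "T \<noteq> 0" using assms(1) by auto
  obtain Q r where Qr: "pseudo_divmod F T = (Q, r)" by force
  define a where "a = lead_coeff T ^ (Suc (degree F) - degree T)"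
  have a0: "a \<noteq> 0" using T0 by (simp add: a_def)
  have eq: "Polynomial.smult a F = T * Q + r" and r: "r = 0 \<or> degree r < degree T"
    using pseudo_divmod[OF T0 Qr] by (simp_all add: a_def)
  have "ipoly r z = ipoly (Polynomial.smult a F - T * Q) z" using eq by simp
  then have "ipoly r z = 0" using assms by simp
  then have eq: "Polynomial.smult a F = T * Q" using r min eq by auto
  have "content (Polynomial.smult a F) = content Q" using assms(1) by (simp add: eq content_mult)
  then have "a dvd content Q" by (metis content_smult dvd_triv_left normalize_dvd_iff)
  then have "[:a:] dvd Q" by (simp add: const_poly_dvd_iff_dvd_content)
  then obtain Q' where "Q = Polynomial.smult a Q'" by (auto elim!: dvdE)
  then have "Polynomial.smult a F = Polynomial.smult a (T * Q')" using eq by simp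
  then have "F = T * Q'" using a0 by (simp only: smult_cancel)
  then show ?thesis by simp
qed

text \<open>\<theta> is either root of \<open>X^2 - X + c\<close>, the sign of its imaginary part
  being left open: the locale is instantiated with both roots to suit a given prime ideal, and with
  the negative of a Gaussian period.\<close>

locale quad =
  fixes p :: nat and c :: int and \<theta> :: complex
  assumes prime_p: "prime p" and p_mod_8: "p mod 8 = 7"
    and c: "4 * c = int p + 1"
    and theta_add: "\<theta> + cnj \<theta> = 1" and theta_mult: "\<theta> * cnj \<theta> = of_int c"
begin

lemma c_props: "even c" "c > 0" "4 * c - 1 = int p"
proof -
  have "int p mod 8 = 7" using p_mod_8 by presburger
  then show "even c" using c by presburger
  show "c > 0" using c by linarith
  show "4 * c - 1 = int p" using c by simp
qed

lemma p_pos: "p > 0" using prime_p by (rule prime_gt_0_nat)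

lemma Re_theta: "Re \<theta> = 1 / 2"
  using arg_cong[OF theta_add, of Re] by simp

lemma Im_theta_sq: "(Im \<theta>)\<^sup>2 = real p / 4"
proof -
  have "(Re \<theta>)\<^sup>2 + (Im \<theta>)\<^sup>2 = of_int c"
    using arg_cong[OF theta_mult, of Re] by (simp add: power2_eq_square)
  moreover have "4 * real_of_int c = real p + 1"
    using c by (metis of_int_1 of_int_add of_int_mult of_int_numeral of_int_of_nat_eq)
  ultimately show ?thesis by (simp add: Re_theta power2_eq_square)
qed

lemma Im_theta_neq_0: "Im \<theta> \<noteq> 0"
  using Im_theta_sq p_pos by auto

lemma Im_theta: "Im \<theta> = sqrt p / 2 \<or> Im \<theta> = - sqrt p / 2"
proof -
  have "(Im \<theta>)\<^sup>2 = (sqrt p / 2)\<^sup>2" by (simp add: Im_theta_sq power_divide)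
  then show ?thesis by (simp add: power2_eq_iff)
qed

lemma cnj_theta: "cnj \<theta> = 1 - \<theta>"
  using theta_add by (simp add: algebra_simps eq_diff_eq)

lemma theta_sq: "\<theta> * \<theta> = \<theta> - of_int c"
  using theta_mult by (simp add: cnj_theta algebra_simps)

definition qint :: "int \<Rightarrow> int \<Rightarrow> complex" where
  "qint u v = of_int u + of_int v * \<theta>"

lemma qint_add: "qint u v + qint u' v' = qint (u + u') (v + v')"
  by (simp add: qint_def algebra_simps)

lemma qint_diff: "qint u v - qint u' v' = qint (u - u') (v - v')"
  by (simp add: qint_def algebra_simps)

lemma qint_mult: "qint u v * qint u' v' = qint (u * u' - c * v * v') (u * v' + u' * v + v * v')"
proof -
  have "qint u v * qint u' v' = of_int (u * u') + of_int (u * v' + u' * v) * \<theta> + of_int (v * v') * (\<theta> * \<theta>)"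
    by (simp add: qint_def algebra_simps)
  also have "\<dots> = qint (u * u' - c * v * v') (u * v' + u' * v + v * v')"
    unfolding theta_sq by (simp add: qint_def algebra_simps)
  finally show ?thesis .
qed

lemma cnj_qint: "cnj (qint u v) = qint (u + v) (- v)"
  by (simp add: qint_def cnj_theta algebra_simps)

lemma qint_of_int: "of_int u = qint u 0"
  by (simp add: qint_def)

lemma qint_inject: "qint u v = qint u' v' \<longleftrightarrow> u = u' \<and> v = v'"
proof
  assume *: "qint u v = qint u' v'"
  have "v = v'" using arg_cong[OF *, of Im] Im_theta_neq_0 by (simp add: qint_def)
  then show "u = u' \<and> v = v'" using * by (simp add: qint_def)
qed simp

lemma qint_norm: "qint u v * cnj (qint u v) = of_int (qnorm c u v)"
  unfolding cnj_qint qint_mult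
    by (simp add: qint_of_int qint_inject qnorm_def power2_eq_square algebra_simps)

definition qints :: "complex set" where
  "qints = {qint u v | u v. True}"

lemma qintI [simp]: "qint u v \<in> qints" by (auto simp: qints_def)

lemma qintsE: assumes "z \<in> qints" obtains u v where "z = qint u v"
  using assms by (auto simp: qints_def)

lemma qints_of_int [simp]: "of_int u \<in> qints" by (simp add: qint_of_int)
lemma qints_0 [simp]: "0 \<in> qints" and qints_1 [simp]: "1 \<in> qints"
  using qints_of_int[of 0] qints_of_int[of 1] by simp_all
lemma theta_in_qints [simp]: "\<theta> \<in> qints" using qintI[of 0 1] by (simp add: qint_def)
lemma qints_add [simp]: "a \<in> qints \<Longrightarrow> b \<in> qints \<Longrightarrow> a + b \<in> qints"
  by (auto simp: qint_add elim!: qintsE)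
lemma qints_diff [simp]: "a \<in> qints \<Longrightarrow> b \<in> qints \<Longrightarrow> a - b \<in> qints"
  by (auto simp: qint_diff elim!: qintsE)
lemma qints_mult [simp]: "a \<in> qints \<Longrightarrow> b \<in> qints \<Longrightarrow> a * b \<in> qints"
  by (auto simp: qint_mult elim!: qintsE)
lemma qints_power [simp]: "a \<in> qints \<Longrightarrow> a ^ n \<in> qints"
  by (induction n) auto
lemma qints_sum [simp]: "(\<And>x. x \<in> A \<Longrightarrow> f x \<in> qints) \<Longrightarrow> sum f A \<in> qints"
  by (induction A rule: infinite_finite_induct) auto
lemma qints_cnj [simp]: "a \<in> qints \<Longrightarrow> cnj a \<in> qints"
  by (auto simp: cnj_qint elim!: qintsE)

text \<open>\<open>A\<^sup>2 + p * b\<^sup>2 = 4 * N\<close> with \<open>p\<close> odd forces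
  \<open>A\<close> and \<open>b\<close> to have the same parity, which is what integral coordinates
  with respect to 1 and \<theta> require.\<close>

lemma qintsI_half_trace:
  assumes "Re z = real_of_int A / 2" "Im z = real_of_int b * (sqrt p / 2)" "(cmod z)\<^sup>2 = real_of_int N"
  shows "z \<in> qints"
proof -
  have "(cmod z)\<^sup>2 = ((real_of_int A)\<^sup>2 + real p * (real_of_int b)\<^sup>2) / 4"
    by (simp add: cmod_power2 assms power_mult_distrib power_divide)
  then have "real_of_int (A\<^sup>2 + int p * b\<^sup>2) = real_of_int (4 * N)"
    using assms(3) by simp
  then have N: "A\<^sup>2 + int p * b\<^sup>2 = 4 * N" by (simp only: of_int_eq_iff)
  have "odd p" using p_mod_8 by presburger
  have "even (A\<^sup>2 + int p * b\<^sup>2)" by (simp add: N)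
  then have "even (A - b)" "even (A + b)" using \<open>odd p\<close> by auto
  then obtain d d' where d: "A - b = 2 * d" "A + b = 2 * d'" by (meson evenE)
  have A: "real_of_int A = 2 * real_of_int d + real_of_int b" "real_of_int A = 2 * real_of_int d' - real_of_int b"
    using d by linarith+
  from Im_theta show ?thesis
  proof
    assume "Im \<theta> = sqrt p / 2"
    then have "z = qint d b" by (simp add: complex_eq_iff qint_def assms Re_theta A(1))
    then show ?thesis by simp
  next
    assume "Im \<theta> = - sqrt p / 2"
    then have "z = qint d' (- b)" by (simp add: complex_eq_iff qint_def assms Re_theta A(2))
    then show ?thesis by simp
  qed
qed

lemma algebraic_int_quadfield_imp_qints:
  assumes "z \<in> quadfield p" "algebraic_int z"
  shows "z \<in> qints"
proof -
  obtain r s where rs: "z = of_real (of_rat r) + of_real (of_rat s) * (\<i> * of_real (sqrt (real p)))"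
    using assms(1) by (auto simp: quadfield_def)
  have Re: "Re z = of_rat r" and Im: "Im z = of_rat s * sqrt p" by (simp_all add: rs)
  show ?thesis
  proof (cases "s = 0")
    case True
    then have "z = complex_of_real (of_rat r)" by (simp add: rs)
    moreover from this have "(of_rat r :: real) \<in> \<int>"
      using assms(2) by (intro rational_algebraic_int_is_int) auto
    ultimately show ?thesis by (auto elim!: Ints_cases)
  next
    case False
    then have Im0: "Im z \<noteq> 0" using p_pos by (simp add: Im)
    obtain ra rb where r: "r = Fract ra rb" "rb > 0" by (metis Rat_cases)
    obtain sa sb where s: "s = Fract sa sb" "sb > 0" by (metis Rat_cases)
    define D where "D = rb * sb"
    define a where "a = ra * sb"
    define b where "b = sa * rb"
    have D: "D > 0" using r s by (simp add: D_def)
    have ra: "of_rat r * D = real_of_int a" and sb: "of_rat s * D = real_of_int b"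
      using r s by (simp_all add: D_def a_def b_def of_rat_rat)
    \<comment> \<open>The minimal polynomial of \<open>z\<close> multiplied by
      \<open>D\<^sup>2\<close>, where \<open>D\<close> is a common denominator of \<open>r\<close>
      and \<open>s\<close>. Its primitive part will divide the monic \<open>F\<close>, hence have
      leading coefficient 1 or -1 and provide an integral trace and norm.\<close>
    define T0 where "T0 = [:a\<^sup>2 + int p * b\<^sup>2, - 2 * a * D, D\<^sup>2:]"
    have ReD: "Re z * D = a" using ra by (simp add: Re)
    have ImD: "Im z * D = b * sqrt p" using sb by (simp add: Im algebra_simps)
    have "ipoly T0 z = (z * D - a)\<^sup>2 + p * b\<^sup>2"
      by (simp add: T0_def power2_eq_square algebra_simps)
    also have "z * D - a = \<i> * (b * sqrt p)"
      using ReD ImD by (simp add: complex_eq_iff)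
    also have "(\<i> * complex_of_real (b * sqrt p))\<^sup>2 = - (p * b\<^sup>2)"
    proof -
      have "(complex_of_real (sqrt p))\<^sup>2 = p" by (simp flip: of_real_power)
      then show ?thesis by (simp add: power_mult_distrib)
    qed
    finally have T0z: "ipoly T0 z = 0" by simp
    define T where "T = primitive_part T0"
    have "T0 \<noteq> 0" using D by (simp add: T0_def)
    then have cT: "content T = 1" by (simp add: T_def)
    have "degree T = 2" using D by (simp add: T_def T0_def)
    have "T0 = Polynomial.smult (content T0) T" by (simp add: T_def)
    then have "of_int (content T0) * ipoly T z = 0" using T0z by (metis ipoly_smult)
    then have Tz: "ipoly T z = 0" using \<open>T0 \<noteq> 0\<close> by simp
    obtain F where F: "ipoly F z = 0" "lead_coeff F = 1"
      using assms(2) by (auto simp: algebraic_int_altdef_ipoly ipoly_def)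
    have "T dvd F"
    proof (rule primitive_minimal_dvd[OF cT Tz _ F(1)])
      fix G assume G: "ipoly G z = 0" "degree G < degree T"
      then have "degree G \<le> 1" using \<open>degree T = 2\<close> by simp
      then have "G = [:Polynomial.coeff G 0, Polynomial.coeff G 1:]"
        by (intro poly_eqI) (auto simp: coeff_pCons coeff_eq_0 split: nat.splits)
      then obtain g0 g1 where g: "G = [:g0, g1:]" by blast
      have "of_int g0 + z * of_int g1 = 0" using G(1) g by simp
      then have "g1 = 0" "g0 = 0" using Im0 by (auto simp: complex_eq_iff)
      then show "G = 0" using g by simp
    qed
    then have "lead_coeff T dvd 1" using F(2) by (metis dvdE dvd_triv_left lead_coeff_mult)
    then have lT: "lead_coeff T = 1 \<or> lead_coeff T = -1" by auto
    obtain t0 t1 t2 where t: "T = [:t0, t1, t2:]"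
      using \<open>degree T = 2\<close> by (metis degree2_coeffs)
    have t2: "t2 = 1 \<or> t2 = -1"
      using lT \<open>degree T = 2\<close> by (simp add: t eval_nat_numeral split: if_splits)
    then obtain A N :: int where AN: "z\<^sup>2 - of_int A * z + of_int N = 0"
    proof
      assume "t2 = 1" then show ?thesis using that[of "- t1" t0] Tz
        by (simp add: t power2_eq_square algebra_simps)
    next
      assume "t2 = -1" then show ?thesis using that[of "t1" "- t0"] arg_cong[OF Tz, of uminus]
        by (simp add: t power2_eq_square algebra_simps)
    qed
    have "2 * Re z * Im z = A * Im z"
      using arg_cong[OF AN, of Im] by (simp add: power2_eq_square algebra_simps)
    then have A: "2 * Re z = A" using Im0 by simp
    have "(cmod z)\<^sup>2 = N"
      using arg_cong[OF AN, of Re] unfolding cmod_power2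
        by (simp add: A[symmetric] power2_eq_square algebra_simps)
    then have norm: "(of_int A / 2)\<^sup>2 + (of_rat s * sqrt p)\<^sup>2 = real_of_int N"
      by (simp add: cmod_power2 flip: Im A)
    \<comment> \<open>The norm equation makes \<open>4 * s\<^sup>2 * p\<close> an integer; one more
      factor \<open>p\<close> makes it the square of the rational \<open>B\<close>. So
      \<open>B\<close> is an integer divisible by \<open>p\<close>, and \<open>2 * s\<close> is an
      integer.\<close>
    define B where "B = (2 * s * rat_of_nat p)"
    have "B\<^sup>2 = of_int (int p * (4 * N - A\<^sup>2))"
    proof -
      have "(of_rat (B\<^sup>2) :: real) = 4 * p * (of_rat s * sqrt p)\<^sup>2"
        by (simp add: B_def of_rat_mult of_rat_power power_mult_distrib power2_eq_square)
      also have "(of_rat s * sqrt p)\<^sup>2 = real_of_int N - (of_int A / 2)\<^sup>2"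
        using norm by simp
      also have "4 * p * (real_of_int N - (of_int A / 2)\<^sup>2) = of_rat (of_int (int p * (4 * N - A\<^sup>2)))"
        by (simp add: power_divide algebra_simps of_rat_diff of_rat_mult of_rat_power)
      finally show ?thesis by (simp only: of_rat_eq_iff)
    qed
    then have "algebraic_int B"
      by (intro algebraic_int.intros[of "[:- of_int (int p * (4 * N - A\<^sup>2)), 0, 1:]"])
        (auto simp: power2_eq_square coeff_pCons split: nat.splits)
    moreover have "B \<in> \<rat>" by (metis Rats_of_rat of_rat_eq_id id_apply)
    ultimately obtain B' where B': "B = of_int B'"
      using rational_algebraic_int_is_int by (metis Ints_cases)
    then have "of_int (B'\<^sup>2) = (of_int (int p * (4 * N - A\<^sup>2)) :: rat)"
      using \<open>B\<^sup>2 = _\<close> by simp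
    then have "B'\<^sup>2 = int p * (4 * N - A\<^sup>2)" by (simp only: of_int_eq_iff)
    then have "int p dvd B'"
      using prime_p by (metis dvd_triv_left prime_dvd_power prime_nat_int_transfer)
    then obtain b' where b': "B' = int p * b'" by (auto elim: dvdE)
    have "2 * s * rat_of_nat p = rat_of_nat p * of_int b'" using B' b' by (simp add: B_def)
    then have "2 * s = of_int b'" using p_pos by simp
    then have s': "2 * of_rat s = real_of_int b'"
      by (metis of_rat_mult of_rat_numeral_eq of_rat_of_int_eq)
    show ?thesis
    proof (rule qintsI_half_trace)
      show "Re z = real_of_int A / 2" using A by simp
      show "Im z = real_of_int b' * (sqrt p / 2)" using s' by (simp add: Im flip: s')
      show "(cmod z)\<^sup>2 = real_of_int N" by fact
    qed
  qed
qed

lemma qints_imp_algebraic_int_quadfield: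
  assumes "z \<in> qints"
  shows "z \<in> quadfield p" "algebraic_int z"
proof -
  obtain u v where z: "z = qint u v" using assms by (rule qintsE)
  have "\<exists>s. Im \<theta> = of_rat s * sqrt p"
    using Im_theta
    by (elim disjE; intro exI[of _ "1/2"] exI[of _ "-1/2"]) (auto simp: of_rat_divide of_rat_minus)
  then obtain s where s: "Im \<theta> = of_rat s * sqrt p" by blast
  have "z = of_real (of_rat (of_int u + of_int v / 2)) + of_real (of_rat (of_int v * s)) * (\<i> * of_real (sqrt (real p)))"
    by (simp add: complex_eq_iff z qint_def Re_theta s of_rat_add of_rat_mult of_rat_divide)
  then show "z \<in> quadfield p" unfolding quadfield_def by blast
  have "z * z - (z + cnj z) * z + z * cnj z = 0" by (simp add: algebra_simps)
  then have "z * z - of_int (2 * u + v) * z + of_int (qnorm c u v) = 0"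
    unfolding z qint_norm by (simp add: cnj_qint qint_add flip: qint_of_int)
  then show "algebraic_int z"
    by (intro algebraic_int.intros[of "[:of_int (qnorm c u v), - of_int (2 * u + v), 1:]"])
        (auto simp: algebra_simps coeff_pCons split: nat.splits)
qed

lemma carrier_OK: "carrier (OK p) = qints"
  using algebraic_int_quadfield_imp_qints qints_imp_algebraic_int_quadfield by (auto simp: OK_def)

end

section \<open>Powers of a prime ideal above two\<close>

text \<open>A prime ideal containing 2 contains \<theta> or its conjugate, as their product
  \<open>c\<close> is even. Calling \<theta> the one that it contains makes membership in
  \<open>P\<close> the parity of the first coordinate.\<close>

locale quad_ideal = quad +
  fixes P :: "complex set"
  assumes P: "primeideal P (OK p)" and two_in_P: "2 \<in> P" and theta_in_P: "\<theta> \<in> P"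
begin

sublocale PI: primeideal P "OK p" by (rule P)

lemma OK_simps [simp]:
  "mult (OK p) = (*)" "add (OK p) = (+)" "one (OK p) = 1" "zero (OK p) = 0"
  by (simp_all add: OK_def)

lemma P_add: "a \<in> P \<Longrightarrow> b \<in> P \<Longrightarrow> a + b \<in> P"
  using additive_subgroup.a_closed[OF ideal.axioms(1)[OF PI.is_ideal], of a b] by simp

lemma P_of_int_mult: "a \<in> P \<Longrightarrow> of_int k * a \<in> P"
  using PI.I_l_closed[of a "of_int k"] by (simp add: carrier_OK)

lemma mem_P_iff: "qint u v \<in> P \<longleftrightarrow> even u"
proof
  assume "even u"
  then obtain k where "u = 2 * k" by (auto elim: evenE)
  then have "qint u v = of_int k * 2 + of_int v * \<theta>" by (simp add: qint_def)
  also have "\<dots> \<in> P"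
    by (intro P_add P_of_int_mult two_in_P theta_in_P)
  finally show "qint u v \<in> P" .
next
  assume uv: "qint u v \<in> P"
  show "even u"
  proof (rule ccontr)
    assume "odd u"
    then obtain k where "u = 2 * k + 1" by (auto elim: oddE)
    then have "1 = qint u v + (of_int (- k) * 2 + of_int (- v) * \<theta>)" by (simp add: qint_def)
    also have "\<dots> \<in> P"
      by (intro P_add P_of_int_mult two_in_P theta_in_P uv)
    finally have "P = carrier (OK p)" using PI.one_imp_carrier by simp
    then show False using PI.I_notcarr by simp
  qed
qed

lemma P_subset: "P \<subseteq> qints"
  using PI.a_subset by (simp add: carrier_OK)

definition Ppow :: "nat \<Rightarrow> complex set" where "Ppow = ideal_power p P"

lemma Ppow_0: "Ppow 0 = qints"
  by (simp add: Ppow_def ideal_power_def nat_pow_def ideals_set_def carrier_OK)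

lemma Ppow_Suc: "Ppow (Suc k) = ideal_prod (OK p) (Ppow k) P"
  by (simp add: Ppow_def ideal_power_def nat_pow_def ideals_set_def)

lemma ideal_Ppow: "ideal (Ppow k) (OK p)"
proof (induction k)
  case 0
  show ?case unfolding Ppow_0 carrier_OK[symmetric] by (rule PI.oneideal)
next
  case (Suc k)
  then show ?case unfolding Ppow_Suc by (intro PI.ideal_prod_is_ideal PI.is_ideal)
qed

lemma Ppow_add: "a \<in> Ppow k \<Longrightarrow> b \<in> Ppow k \<Longrightarrow> a + b \<in> Ppow k"
  using additive_subgroup.a_closed[OF ideal.axioms(1)[OF ideal_Ppow[of k]], of a b] by simp

lemma Ppow_mult: "a \<in> Ppow k \<Longrightarrow> b \<in> qints \<Longrightarrow> a * b \<in> Ppow k"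
  using ideal.I_r_closed[OF ideal_Ppow[of k], of a b] by (simp add: carrier_OK)

lemma power_in_Ppow: "a \<in> P \<Longrightarrow> a ^ k \<in> Ppow k"
proof (induction k)
  case 0
  then show ?case by (simp add: Ppow_0)
next
  case (Suc k)
  then show ?case using ideal_prod.prod[of "a ^ k" "Ppow k" a P "OK p"]
    by (simp add: Ppow_Suc mult.commute)
qed

lemma P_mult_cnj:
  assumes "a \<in> P" "b \<in> P"
  shows "\<exists>y\<in>qints. a * cnj b = 2 * y"
proof -
  obtain u v u' v' where uv: "a = qint u v" "b = qint u' v'"
    using assms P_subset by (meson qintsE subsetD)
  then have "even u" "even u'" using assms by (auto simp: mem_P_iff)
  moreover obtain d where "c = 2 * d" using c_props(1) by (auto elim: evenE)
  ultimately obtain e e' where e: "u = 2 * e" "u' = 2 * e'" by (auto elim!: evenE)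
  have "a * cnj b = 2 * qint (e * (2 * e' + v') + d * v * v') (- e * v' + e' * v)"
    unfolding uv cnj_qint qint_mult e \<open>c = 2 * d\<close> by (simp add: qint_def algebra_simps)
  then show ?thesis
    by (intro bexI[of _ "qint (e * (2 * e' + v') + d * v * v') (- e * v' + e' * v)"]) simp_all
qed

text \<open>Replaces factorization of ideals: the product of \<open>P\<close> and its conjugate lies
  in (2), and induction over products and sums, for each factor in turn, carries this to
  powers.\<close>

lemma Ppow_mult_cnj:
  assumes "z \<in> Ppow k" "w \<in> Ppow k"
  shows "\<exists>y\<in>qints. z * cnj w = 2 ^ k * y"
  using assms
proof (induction k arbitrary: z w)
  case 0
  then show ?case by (intro bexI[of _ "z * cnj w"]) (auto simp: Ppow_0)
next
  case (Suc k)
  have one: "\<exists>y\<in>qints. z * cnj (a' * b') = 2 ^ Suc k * y"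
    if z: "z \<in> ideal_prod (OK p) (Ppow k) P" and ab': "a' \<in> Ppow k" "b' \<in> P" for z a' b'
    using z
  proof (induction rule: ideal_prod.induct)
    case (prod a b)
    obtain y y' where y: "y \<in> qints" "a * cnj a' = 2 ^ k * y" "y' \<in> qints" "b * cnj b' = 2 * y'"
      using Suc.IH[OF prod(1) ab'(1)] P_mult_cnj[OF prod(2) ab'(2)] by blast
    have "(a * b) * cnj (a' * b') = (a * cnj a') * (b * cnj b')" by simp
    also have "\<dots> = 2 ^ Suc k * (y * y')" using y by simp
    finally show ?case using y by (intro bexI[of _ "y * y'"]) auto
  next
    case (sum s1 s2)
    then obtain y1 y2 where "y1 \<in> qints" "y2 \<in> qints"
      "s1 * cnj (a' * b') = 2 ^ Suc k * y1" "s2 * cnj (a' * b') = 2 ^ Suc k * y2" by blast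
    then show ?case by (intro bexI[of _ "y1 + y2"]) (auto simp: algebra_simps)
  qed
  have "w \<in> ideal_prod (OK p) (Ppow k) P" using Suc.prems(2) by (simp add: Ppow_Suc)
  then show ?case
  proof (induction rule: ideal_prod.induct)
    case (prod a b)
    then show ?case using one[of z a b] Suc.prems(1) by (simp add: Ppow_Suc)
  next
    case (sum s1 s2)
    then obtain y1 y2 where "y1 \<in> qints" "y2 \<in> qints"
      "z * cnj s1 = 2 ^ Suc k * y1" "z * cnj s2 = 2 ^ Suc k * y2" by blast
    then show ?case by (intro bexI[of _ "y1 + y2"]) (auto simp: algebra_simps)
  qed
qed

text \<open>The generator is \<alpha> = \<open>qint u v\<close>. Since \<beta> =
  \<open>1 - cnj \<alpha>\<close> lies in \<open>P\<close>, and \<open>1 - \<beta> ^ k\<close> is a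
  multiple of \<open>cnj \<alpha>\<close>, the product \<open>\<alpha> * (1 - \<beta> ^ k)\<close>
  is a multiple of \<open>2 ^ k\<close>, which puts \<alpha> into \<open>Ppow k\<close>. Conversely,
  for \<open>z\<close> in \<open>Ppow k\<close>, \<open>z * cnj \<alpha>\<close> is a multiple of
  \<open>2 ^ k = \<alpha> * cnj \<alpha>\<close>.\<close>

lemma principal_Ppow_of_even:
  assumes "qnorm c u v = 2 ^ k" "even u" "odd v"
  shows "principalideal (Ppow k) (OK p)"
proof -
  define \<alpha> where "\<alpha> = qint u v"
  have norm: "\<alpha> * cnj \<alpha> = 2 ^ k" by (simp add: \<alpha>_def qint_norm assms(1))
  have a0: "\<alpha> \<noteq> 0" using norm by auto
  define \<beta> where "\<beta> = 1 - cnj \<alpha>"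
  have \<beta>: "\<beta> = qint (1 - (u + v)) v"
    by (simp add: \<beta>_def \<alpha>_def cnj_qint) (simp add: qint_def)
  then have "\<beta> \<in> P" using assms by (simp add: mem_P_iff)
  then have bk: "\<beta> ^ k \<in> Ppow k" by (rule power_in_Ppow)
  have "1 - \<beta> ^ k = (1 - \<beta>) * (\<Sum>i<k. \<beta> ^ i)" by (rule one_diff_power_eq)
  also have "1 - \<beta> = cnj \<alpha>" by (simp add: \<beta>_def)
  finally have "\<alpha> * (1 - \<beta> ^ k) = (\<alpha> * cnj \<alpha>) * (\<Sum>i<k. \<beta> ^ i)"
    by simp
  then have "\<alpha> = 2 ^ k * (\<Sum>i<k. \<beta> ^ i) + \<beta> ^ k * \<alpha>"
    by (simp add: norm algebra_simps)
  also have "\<dots> \<in> Ppow k"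
    using power_in_Ppow[OF two_in_P, of k] bk \<beta>
      by (intro Ppow_add Ppow_mult) (auto simp: \<alpha>_def)
  finally have \<alpha>: "\<alpha> \<in> Ppow k" .
  have "Ppow k = cgenideal (OK p) \<alpha>"
  proof
    show "cgenideal (OK p) \<alpha> \<subseteq> Ppow k"
      using Ppow_mult[OF \<alpha>] by (auto simp: cgenideal_def carrier_OK mult.commute)
    show "Ppow k \<subseteq> cgenideal (OK p) \<alpha>"
    proof
      fix z assume "z \<in> Ppow k"
      then obtain y where y: "y \<in> qints" "z * cnj \<alpha> = 2 ^ k * y"
        using Ppow_mult_cnj[OF _ \<alpha>] by blast
      then have "z * cnj \<alpha> = y * \<alpha> * cnj \<alpha>" by (simp add: mult.assoc norm)
      then have "z = y * \<alpha>" using a0 by simp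
      then show "z \<in> cgenideal (OK p) \<alpha>"
        using y(1) by (auto simp: cgenideal_def carrier_OK)
    qed
  qed
  moreover have "\<alpha> \<in> carrier (OK p)" by (simp add: carrier_OK \<alpha>_def)
  ultimately show ?thesis using PI.cgenideal_is_principalideal by simp
qed

lemma principal_Ppow:
  assumes "qnorm c u v = 2 ^ k" "odd u \<or> odd v" "k > 0"
  shows "principalideal (Ppow k) (OK p)"
proof -
  have "even (qnorm c u v)" using assms by simp
  then have v: "odd v" using assms(2) c_props(1) by (auto simp: qnorm_def)
  show ?thesis
  proof (cases "even u")
    case True
    then show ?thesis using principal_Ppow_of_even assms v by blast
  next
    case False
    have "qnorm c (u + v) (- v) = 2 ^ k"
      using assms(1) by (simp add: qnorm_def power2_eq_square algebra_simps)
    then show ?thesis using principal_Ppow_of_even[of "u + v" "- v" k] False v by simp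
  qed
qed

text \<open>The parity of \<open>u + v\<close> is the residue at the conjugate prime, where \<theta>
  becomes 1, and so it is multiplicative.\<close>

lemma odd_coordinate_sum_power:
  assumes "odd (u + v)"
  shows "\<exists>a b. qint u v ^ k = qint a b \<and> odd (a + b)"
proof (induction k)
  case 0
  show ?case using qint_of_int[of 1] by (intro exI[of _ 1] exI[of _ 0]) simp
next
  case (Suc k)
  then obtain a b where ab: "qint u v ^ k = qint a b" "odd (a + b)" by blast
  have "(u * a - c * v * b) + (u * b + a * v + v * b) = (u + v) * (a + b) - c * (v * b)"
    by (simp add: algebra_simps)
  from this have "odd ((u * a - c * v * b) + (u * b + a * v + v * b))"
    by (simp only:) (use ab assms c_props(1) in simp)
  then show ?case unfolding power_Suc ab(1) qint_mult by blast
qed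

text \<open>The norm of a generator is a multiple of \<open>2 ^ k\<close> by
  \<open>Ppow_mult_cnj\<close> and divides the norm of every element of \<open>Ppow k\<close>.
  Testing on \<open>2 ^ k\<close> and on an element with norm exactly divisible by
  \<open>2 ^ k\<close> leaves only \<open>2 ^ k\<close>. The generator is primitive because it
  divides an element that is not a multiple of 2.\<close>

lemma principal_Ppow_imp_norm:
  assumes "principalideal (Ppow k) (OK p)"
  shows "\<exists>u v. qnorm c u v = 2 ^ k \<and> (odd u \<or> odd v)"
proof -
  obtain \<pi> where \<pi>: "\<pi> \<in> carrier (OK p)" "Ppow k = genideal (OK p) {\<pi>}"
    using principalideal.generate[OF assms] by blast
  then have gen: "Ppow k = cgenideal (OK p) \<pi>" using PI.cgenideal_eq_genideal by simp
  obtain u v where uv: "\<pi> = qint u v" using \<pi> carrier_OK by (metis qintsE)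
  have dvd: "\<exists>a b. z = qint a b * qint u v" if z: "z \<in> Ppow k" for z
  proof -
    obtain y where "y \<in> qints" "z = y * qint u v"
      using z by (auto simp: gen cgenideal_def carrier_OK uv)
    then show ?thesis by (metis qintsE)
  qed
  have norm_dvd: "qnorm c u v dvd N" if z: "z \<in> Ppow k" "z * cnj z = of_int N" for z N
  proof -
    obtain a b where ab: "z = qint a b * qint u v" using dvd z by blast
    then have "z * cnj z = (qint a b * cnj (qint a b)) * (qint u v * cnj (qint u v))" by simp
    then have "of_int N = complex_of_int (qnorm c a b * qnorm c u v)"
      using z by (simp add: qint_norm)
    then show ?thesis by (simp only: of_int_eq_iff) simp
  qed
  have "\<pi> \<in> Ppow k" using gen PI.cgenideal_self[OF \<pi>(1)] by simp
  then obtain y where y: "y \<in> qints" "\<pi> * cnj \<pi> = 2 ^ k * y"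
    using Ppow_mult_cnj by blast
  then obtain y1 y2 where "y = qint y1 y2" by (auto elim: qintsE)
  then have "qint (qnorm c u v) 0 = qint (2 ^ k * y1) (2 ^ k * y2)"
    using y(2) by (simp add: uv qint_norm) (simp add: qint_def algebra_simps)
  then have low: "2 ^ k dvd qnorm c u v" by (simp add: qint_inject)
  have "2 ^ k \<in> Ppow k" using power_in_Ppow[OF two_in_P] by simp
  then have "qnorm c u v dvd 2 ^ k * 2 ^ k" by (intro norm_dvd[of "2 ^ k"]) auto
  then have "qnorm c u v dvd 2 ^ (k + k)" by (simp add: power_add)
  then obtain m where "normalize (qnorm c u v) = normalize (2 ^ m)"
    using divides_primepow[of 2 "qnorm c u v"] by auto
  then have m: "qnorm c u v = 2 ^ m" using qnorm_nonneg[OF c_props(2), of u v] by simp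
  obtain d where d: "c = 2 * d" using c_props(1) by (auto elim: evenE)
  \<comment> \<open>\<open>w + \<theta>\<close> lies in \<open>P\<close> and has norm twice an odd
    number: the norms at \<open>w = 0\<close> and \<open>w = 2\<close> are \<open>2 * d\<close> and
    \<open>2 * (3 + d)\<close>.\<close>
  have "\<exists>w j. even w \<and> odd j \<and> qnorm c w 1 = 2 * j"
  proof (cases "even d")
    case True
    then show ?thesis by (intro exI[of _ 2] exI[of _ "3 + d"]) (simp add: qnorm_def d)
  next
    case False
    then show ?thesis by (intro exI[of _ 0] exI[of _ "d"]) (simp add: qnorm_def d)
  qed
  then obtain w j where w: "even w" "odd j" "qnorm c w 1 = 2 * j" by blast
  have wk: "qint w 1 ^ k \<in> Ppow k" using w by (intro power_in_Ppow) (simp add: mem_P_iff)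
  have "qint w 1 ^ k * cnj (qint w 1 ^ k) = of_int ((2 * j) ^ k)"
    by (simp only: complex_cnj_power power_mult_distrib[symmetric] qint_norm w(3) of_int_power)
  then have "2 ^ m dvd (2 * j) ^ k" using norm_dvd[OF wk] m by simp
  then have "2 ^ m dvd 2 ^ k * j ^ k" by (simp add: power_mult_distrib)
  moreover have "coprime (2 ^ m) (j ^ k)" using w(2) by simp
  ultimately have "(2::int) ^ m dvd 2 ^ k" by (simp add: coprime_dvd_mult_left_iff)
  with low have "qnorm c u v = 2 ^ k" unfolding m by (simp add: zdvd_antisym_nonneg)
  moreover have "odd u \<or> odd v"
  proof (rule ccontr)
    assume "\<not> ?thesis"
    then obtain a b where "u = 2 * a" "v = 2 * b" by (auto elim!: evenE)
    obtain x y where xy: "qint w 1 ^ k = qint x y * qint u v" using dvd[OF wk] by blast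
    obtain x' y' where "qint w 1 ^ k = qint x' y'" "odd (x' + y')"
      using odd_coordinate_sum_power[of w 1 k] w(1) by auto
    then have "x' = x * u - c * y * v" "y' = x * v + u * y + y * v"
      using xy by (simp_all add: qint_mult qint_inject)
    then have "even (x' + y')" using \<open>u = 2 * a\<close> \<open>v = 2 * b\<close> by simp
    then show False using \<open>odd (x' + y')\<close> by simp
  qed
  ultimately show ?thesis by blast
qed

lemma tP_altdef: "tP p P = (LEAST t. t > 0 \<and> principalideal (Ppow t) (OK p))"
  by (simp add: tP_def Ppow_def)

text \<open>Existence is what counts: \<open>LEAST\<close> has its defining property only if some
  positive power is principal.\<close>

lemma tP_properties: "tP p P > 0 \<and> principalideal (Ppow (tP p P)) (OK p)"
proof -
  obtain k u v where "k > 0" "qnorm c u v = 2 ^ k" "odd u \<or> odd v"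
    using exists_primitive_power_of_two_norm[OF c_props(1,2)] by blast
  then have "k > 0 \<and> principalideal (Ppow k) (OK p)" using principal_Ppow by blast
  then show ?thesis unfolding tP_altdef by (rule LeastI)
qed

lemma tP_least:
  assumes "k > 0" "qnorm c u v = 2 ^ k" "odd u \<or> odd v"
  shows "tP p P \<le> k"
  unfolding tP_altdef using principal_Ppow[OF assms(2,3,1)] assms(1) by (intro Least_le) simp

lemma odd_tP: "odd (tP p P)"
proof
  assume "even (tP p P)"
  then obtain s where s: "tP p P = 2 * s" by (auto elim: evenE)
  then have "s > 0" using tP_properties by simp
  obtain u v where "qnorm c u v = 2 ^ (2 * s)" "odd u \<or> odd v"
    using principal_Ppow_imp_norm tP_properties s by metis
  then obtain u v where "qnorm c u v = 2 ^ s" "odd u \<or> odd v"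
    using primitive_norm_sqrt[OF _ c_props(1) \<open>s > 0\<close>] c_props(3) prime_p
      by (metis prime_nat_int_transfer)
  then have "tP p P \<le> s" using tP_least \<open>s > 0\<close> by blast
  then show False using s \<open>s > 0\<close> by simp
qed

end

text \<open>No \<theta> is mentioned: the root adapted to \<open>P\<close> stays inside the proof,
  so the result combines with the \<theta> that the cyclotomic field supplies, whichever of the two
  it is.\<close>

theorem tP_odd_minimal:
  assumes "prime p" "p mod 8 = 7" "primeideal P (OK p)" "2 \<in> P" "4 * c = int p + 1"
  shows "odd (tP p P)"
    and "k > 0 \<Longrightarrow> qnorm c u v = 2 ^ k \<Longrightarrow> odd u \<or> odd v \<Longrightarrow> tP p P \<le> k"
proof -
  define \<omega> where "\<omega> = Complex (1/2) (sqrt p / 2)"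
  have c: "4 * real_of_int c = real p + 1"
    using assms(5) by (metis of_int_1 of_int_add of_int_mult of_int_numeral of_int_of_nat_eq)
  have "\<omega> + cnj \<omega> = 1" by (simp add: \<omega>_def complex_eq_iff)
  moreover have norm: "\<omega> * cnj \<omega> = of_int c"
    using c by (simp add: \<omega>_def complex_eq_iff field_simps)
  ultimately interpret w: quad p c \<omega> using assms by unfold_locales auto
  interpret w': quad p c "cnj \<omega>"
    using assms w.theta_add w.theta_mult by unfold_locales (auto simp: add.commute mult.commute)
  interpret primeideal P "OK p" by fact
  obtain d where d: "c = 2 * d" using w.c_props(1) by (auto elim: evenE)
  have "\<omega> * cnj \<omega> = of_int d * 2" using norm d by simp
  also have "\<dots> \<in> P"
    using I_l_closed[of 2 "of_int d"] assms(4) by (simp add: w.carrier_OK) (simp add: OK_def)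
  finally have "\<omega> \<otimes>\<^bsub>OK p\<^esub> cnj \<omega> \<in> P" by (simp add: OK_def)
  then have "\<omega> \<in> P \<or> cnj \<omega> \<in> P"
    using I_prime[of \<omega> "cnj \<omega>"] by (simp add: w.carrier_OK)
  then have "\<exists>\<theta>. quad_ideal p c \<theta> P"
  proof
    assume "\<omega> \<in> P"
    then have "quad_ideal p c \<omega> P" using assms by unfold_locales auto
    then show ?thesis by blast
  next
    assume "cnj \<omega> \<in> P"
    then have "quad_ideal p c (cnj \<omega>) P" using assms by unfold_locales auto
    then show ?thesis by blast
  qed
  then obtain \<theta> where "quad_ideal p c \<theta> P" by blast
  then interpret quad_ideal p c \<theta> P .
  show "odd (tP p P)" by (rule odd_tP)
  show "k > 0 \<Longrightarrow> qnorm c u v = 2 ^ k \<Longrightarrow> odd u \<or> odd v \<Longrightarrow> tP p P \<le> k"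
    by (rule tP_least)
qed

section \<open>Cyclotomic integers\<close>

lemma prime_dvd_add_power_diff:
  fixes x y :: "'a :: comm_ring_1"
  assumes "prime l"
  shows "of_nat l dvd (x + y) ^ l - x ^ l - y ^ l"
proof -
  have l: "l > 0" using assms by (rule prime_gt_0_nat)
  define f where "f k = of_nat (l choose k) * x ^ k * y ^ (l - k)" for k
  have "{..l} = insert 0 (insert l {1..<l})" using l by auto
  then have "(x + y) ^ l = f 0 + (f l + sum f {1..<l})"
    using l by (simp add: binomial_ring f_def)
  then have "(x + y) ^ l - x ^ l - y ^ l = sum f {1..<l}" by (simp add: f_def)
  also have "of_nat l dvd sum f {1..<l}"
  proof (rule dvd_sum)
    fix k assume "k \<in> {1..<l}"
    then have "l dvd (l choose k)" using assms by (intro dvd_choose_prime) auto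
    then have "of_nat l dvd (of_nat (l choose k) :: 'a)" by (metis dvd_def of_nat_mult)
    then show "of_nat l dvd f k" by (simp add: f_def mult.assoc)
  qed
  finally show ?thesis .
qed

lemma prime_dvd_int_power_diff:
  fixes a :: int
  assumes "prime l"
  shows "int l dvd a ^ l - a"
proof (induction a rule: int_induct[of _ 0])
  case base
  show ?case using prime_gt_0_nat[OF assms] by (simp add: zero_power)
next
  case (step1 i)
  have "(i + 1) ^ l - (i + 1) = ((i + 1) ^ l - i ^ l - 1 ^ l) + (i ^ l - i)" by simp
  then show ?case using prime_dvd_add_power_diff[OF assms, of i 1] step1 by (metis dvd_add)
next
  case (step2 i)
  have "(i - 1) ^ l - (i - 1) = (i ^ l - i) - ((i - 1 + 1) ^ l - (i - 1) ^ l - 1 ^ l)" by simp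
  then show ?case using prime_dvd_add_power_diff[OF assms, of "i - 1" 1] step2 by (metis dvd_diff)
qed

text \<open>Used, through its iterate, with \<open>l = p\<close> for the irreducibility of the
  cyclotomic polynomial and with \<open>l = 2\<close> to see that \<open>gal 2\<close> is squaring
  modulo 2.\<close>

lemma Frobenius_int_poly:
  fixes F :: "int poly"
  assumes "prime l"
  shows "of_nat l dvd F ^ l - F \<circ>\<^sub>p Polynomial.monom 1 l"
proof (induction F)
  case 0
  show ?case using prime_gt_0_nat[OF assms] by (simp add: zero_power)
next
  case (pCons a F)
  define X where "X = [:0, 1 :: int:]"
  have "pCons a F = [:a:] + X * F" by (simp add: X_def)
  moreover have "pCons a F \<circ>\<^sub>p Polynomial.monom 1 l = [:a:] + X ^ l * (F \<circ>\<^sub>p Polynomial.monom 1 l)"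
    by (simp add: pcompose_pCons X_def monom_altdef)
  ultimately have "pCons a F ^ l - pCons a F \<circ>\<^sub>p Polynomial.monom 1 l =
      (([:a:] + X * F) ^ l - [:a:] ^ l - (X * F) ^ l) + ([:a:] ^ l - [:a:])
      + X ^ l * (F ^ l - F \<circ>\<^sub>p Polynomial.monom 1 l)"
    by (simp add: power_mult_distrib algebra_simps)
  moreover have "of_nat l dvd [:a:] ^ l - [:a:]"
  proof -
    have "[:a:] ^ l - [:a:] = [:a ^ l - a:]" by (simp add: poly_const_pow)
    moreover have "of_nat l = [:int l:]" by (simp add: of_nat_poly)
    ultimately show ?thesis using prime_dvd_int_power_diff[OF assms, of a]
      by (metis const_poly_dvd_iff_dvd_content content_const dvd_normalize_iff)
  qed
  ultimately show ?case
    using prime_dvd_add_power_diff[OF assms, of "[:a:]" "X * F"] pCons.IH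
      by (metis dvd_add dvd_mult)
qed

lemma Frobenius_int_poly_power:
  fixes F :: "int poly"
  assumes "prime l"
  shows "of_nat l dvd F ^ (l ^ k) - F \<circ>\<^sub>p Polynomial.monom 1 (l ^ k)"
proof (induction k)
  case 0
  show ?case using pcompose_idR[of F] by (simp add: monom_altdef)
next
  case (Suc k)
  let ?G = "F \<circ>\<^sub>p Polynomial.monom 1 (l ^ k)"
  have "F ^ (l ^ k) - ?G dvd (F ^ (l ^ k)) ^ l - ?G ^ l"
    by (simp add: power_diff_sumr2)
  then have "of_nat l dvd (F ^ (l ^ k)) ^ l - ?G ^ l"
    using Suc by (rule dvd_trans[rotated])
  then have "of_nat l dvd F ^ (l ^ Suc k) - ?G ^ l"
    by (simp add: power_mult[symmetric] mult.commute)
  moreover have "of_nat l dvd ?G ^ l - ?G \<circ>\<^sub>p Polynomial.monom 1 l"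
    using assms by (rule Frobenius_int_poly)
  moreover have "?G \<circ>\<^sub>p Polynomial.monom 1 l = F \<circ>\<^sub>p Polynomial.monom 1 (l ^ Suc k)"
    by (intro poly_eq_poly_eq_iff[THEN iffD1])
      (simp add: fun_eq_iff poly_pcompose poly_monom power_mult[symmetric] mult.commute)
  ultimately have "of_nat l dvd (F ^ (l ^ Suc k) - ?G ^ l) + (?G ^ l - F \<circ>\<^sub>p Polynomial.monom 1 (l ^ Suc k))"
    by (intro dvd_add) simp_all
  then show ?case by simp
qed

lemma ipoly_pcompose: "ipoly (F \<circ>\<^sub>p G) z = ipoly F (ipoly G z)"
  by (induction F) (auto simp: pcompose_pCons)

lemma ipoly_of_nat [simp]: "ipoly (of_nat n) z = of_nat n"
  by (simp add: of_nat_poly)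

lemma ipoly_Frobenius:
  assumes "prime l"
  obtains G where "\<And>z. ipoly F z ^ (l ^ k) = ipoly F (z ^ (l ^ k)) + of_nat l * ipoly G z"
proof -
  obtain G where G: "F ^ (l ^ k) - F \<circ>\<^sub>p Polynomial.monom 1 (l ^ k) = of_nat l * G"
    using Frobenius_int_poly_power[OF assms, of F k] by (auto elim: dvdE)
  show ?thesis
  proof
    fix z
    have "ipoly (F ^ (l ^ k) - F \<circ>\<^sub>p Polynomial.monom 1 (l ^ k)) z = of_nat l * ipoly G z"
      unfolding G by simp
    then show "ipoly F z ^ (l ^ k) = ipoly F (z ^ (l ^ k)) + of_nat l * ipoly G z"
      by (simp add: ipoly_pcompose algebra_simps)
  qed
qed

section \<open>The ring generated by a primitive root of unity of order \<open>p ^ e\<close>\<close>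

locale cyclotomic =
  fixes p e :: nat
  assumes prime_p: "prime p" and e_pos: "e > 0"
begin

definition q where "q = p ^ e"
definition m where "m = p ^ (e - 1)"
definition \<zeta> where "\<zeta> = cis (2 * pi / real q)"

lemma p_pos: "p > 0" and p_gt_1: "p > 1"
  using prime_gt_0_nat[OF prime_p] prime_gt_1_nat[OF prime_p] by blast+
lemma q_eq: "q = p * m" using e_pos by (simp add: q_def m_def power_eq_if)
lemma q_pos: "q > 0" and m_pos: "m > 0" using p_pos by (auto simp: q_def m_def)

lemma zeta_power: "\<zeta> ^ a = cis (2 * pi * real a / real q)"
  by (simp add: \<zeta>_def Complex.DeMoivre field_simps)

lemma zeta_power_eq_1_iff: "\<zeta> ^ a = 1 \<longleftrightarrow> q dvd a"
proof -
  have "\<zeta> ^ a = exp (2 * of_real pi * \<i> * of_nat a / of_nat q)"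
    by (simp add: zeta_power cis_conv_exp field_simps)
  then show ?thesis using complex_root_unity_eq_1[of q a] q_pos by simp
qed

lemma zeta_power_q [simp]: "\<zeta> ^ q = 1" by (simp add: zeta_power_eq_1_iff)

lemma zeta_neq_0 [simp]: "\<zeta> \<noteq> 0" by (simp add: \<zeta>_def)

lemma zeta_power_mod: "\<zeta> ^ (a mod q) = \<zeta> ^ a"
proof -
  have "\<zeta> ^ a = \<zeta> ^ (q * (a div q) + a mod q)" by simp
  also have "\<dots> = \<zeta> ^ (a mod q)" unfolding power_add power_mult by simp
  finally show ?thesis by simp
qed

lemma zeta_power_cong: "[a = b] (mod q) \<Longrightarrow> \<zeta> ^ a = \<zeta> ^ b"
  by (metis cong_def zeta_power_mod)

lemma root_of_unity_eq_zeta_power: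
  assumes "z ^ q = 1"
  obtains a where "z = \<zeta> ^ a" "a < q"
proof -
  have "z \<in> {exp (2 * of_real pi * \<i> * of_nat j / of_nat q) | j. j < q}"
    using complex_roots_unity[of q] q_pos assms by auto
  then obtain j where "j < q" "z = exp (2 * of_real pi * \<i> * of_nat j / of_nat q)" by blast
  then show ?thesis using that[of j] by (simp add: zeta_power cis_conv_exp field_simps)
qed

lemma cnj_zeta: "cnj \<zeta> = \<zeta> ^ (q - 1)"
proof -
  have "\<zeta> * cnj \<zeta> = 1" by (simp add: \<zeta>_def cis_cnj cis_mult)
  moreover have "\<zeta> * \<zeta> ^ (q - 1) = 1" using q_pos by (simp flip: power_Suc)
  ultimately show ?thesis by (metis mult_cancel_left zeta_neq_0)
qed

definition Zz :: "complex set" where "Zz = range (\<lambda>F. ipoly F \<zeta>)"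

lemma ipoly_in_Zz [simp]: "ipoly F \<zeta> \<in> Zz" by (simp add: Zz_def)
lemma ZzE: assumes "x \<in> Zz" obtains F where "x = ipoly F \<zeta>"
  using assms by (auto simp: Zz_def)

lemma Zz_of_int [simp]: "of_int a \<in> Zz" using ipoly_in_Zz[of "[:a:]"] by simp
lemma Zz_0 [simp]: "0 \<in> Zz" and Zz_1 [simp]: "1 \<in> Zz" and Zz_numeral [simp]: "numeral k \<in> Zz"
  and Zz_of_nat [simp]: "of_nat i \<in> Zz"
  using Zz_of_int[of 0] Zz_of_int[of 1] Zz_of_int[of "numeral k"] Zz_of_int[of "int i"] by simp_all
lemma Zz_add [simp]: "x \<in> Zz \<Longrightarrow> y \<in> Zz \<Longrightarrow> x + y \<in> Zz"
  by (metis ZzE ipoly_add ipoly_in_Zz)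
lemma Zz_mult [simp]: "x \<in> Zz \<Longrightarrow> y \<in> Zz \<Longrightarrow> x * y \<in> Zz"
  by (metis ZzE ipoly_mult ipoly_in_Zz)
lemma Zz_diff [simp]: "x \<in> Zz \<Longrightarrow> y \<in> Zz \<Longrightarrow> x - y \<in> Zz"
  by (metis ZzE ipoly_diff ipoly_in_Zz)
lemma Zz_minus [simp]: "x \<in> Zz \<Longrightarrow> - x \<in> Zz"
  by (metis ZzE ipoly_minus ipoly_in_Zz)
lemma Zz_power [simp]: "x \<in> Zz \<Longrightarrow> x ^ n \<in> Zz"
  by (metis ZzE ipoly_power ipoly_in_Zz)
lemma Zz_sum [simp]: "(\<And>i. i \<in> A \<Longrightarrow> f i \<in> Zz) \<Longrightarrow> sum f A \<in> Zz"
  by (induction A rule: infinite_finite_induct) auto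
lemma zeta_in_Zz [simp]: "\<zeta> \<in> Zz" using ipoly_in_Zz[of "[:0, 1:]"] by simp
lemma ipoly_Zz [simp]: "x \<in> Zz \<Longrightarrow> ipoly F x \<in> Zz"
  by (induction F) auto
lemma Zz_cnj [simp]: "x \<in> Zz \<Longrightarrow> cnj x \<in> Zz"
  by (auto simp: cnj_ipoly cnj_zeta elim!: ZzE)

definition d where "d = (p - 1) * m"

lemma d_pos: "d > 0" using p_gt_1 m_pos by (simp add: d_def)
lemma d_add_m: "d + m = q" using p_pos by (simp add: d_def q_eq diff_mult_distrib)

text \<open>The cyclotomic polynomial of index \<open>q\<close>, that is
  \<open>(X^q - 1) / (X^m - 1)\<close>; its degree \<open>d = q - m\<close> is the totient of
  \<open>q\<close>.\<close>

definition \<Phi> :: "int poly" where "\<Phi> = (\<Sum>i<p. Polynomial.monom 1 (i * m))"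

lemma degree_Phi: "degree \<Phi> = d" and lead_coeff_Phi: "lead_coeff \<Phi> = 1"
proof -
  define S where "S = (\<Sum>i<p - 1. Polynomial.monom (1::int) (i * m))"
  have "{..<p} = insert (p - 1) {..<p - 1}" using p_pos by auto
  then have \<Phi>: "\<Phi> = S + Polynomial.monom 1 d"
    by (simp add: \<Phi>_def S_def d_def add.commute)
  have "degree S < d" unfolding S_def
  proof (rule degree_sum_less)
    fix i assume "i \<in> {..<p - 1}"
    then have "i * m < d" using m_pos by (simp add: d_def)
    then show "degree (Polynomial.monom (1::int) (i * m)) < d"
      using degree_monom_le[of "1::int" "i * m"] by linarith
  qed (rule d_pos)
  then have S: "degree S < degree (Polynomial.monom (1::int) d)" by (simp add: degree_monom_eq)
  show "degree \<Phi> = d" unfolding \<Phi> degree_add_eq_right[OF S] by (simp add: degree_monom_eq)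
  show "lead_coeff \<Phi> = 1" unfolding \<Phi> lead_coeff_add_le[OF S]
    by (simp add: degree_monom_eq)
qed

lemma Phi_neq_0: "\<Phi> \<noteq> 0" using lead_coeff_Phi by auto

lemma ipoly_Phi: "ipoly \<Phi> z = (\<Sum>i<p. (z ^ m) ^ i)"
  by (simp add: \<Phi>_def power_mult[symmetric] mult.commute)

lemma ipoly_Phi_mult: "(z ^ m - 1) * ipoly \<Phi> z = z ^ q - 1"
proof -
  have "z ^ q = (z ^ m) ^ p" by (simp add: q_eq mult.commute flip: power_mult)
  then show ?thesis unfolding ipoly_Phi by (simp only: power_diff_1_eq)
qed

lemma ipoly_Phi_eq_0_iff: "ipoly \<Phi> z = 0 \<longleftrightarrow> (\<exists>a. \<not> p dvd a \<and> z = \<zeta> ^ a)"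
proof
  assume z: "ipoly \<Phi> z = 0"
  then have "z ^ q = 1" using ipoly_Phi_mult[of z] by simp
  then obtain a where a: "z = \<zeta> ^ a" by (rule root_of_unity_eq_zeta_power)
  have "\<not> p dvd a"
  proof
    assume "p dvd a"
    then have "z ^ m = 1" by (auto simp: a q_eq zeta_power_eq_1_iff simp flip: power_mult)
    then show False using z p_pos by (simp add: ipoly_Phi)
  qed
  then show "\<exists>a. \<not> p dvd a \<and> z = \<zeta> ^ a" using a by blast
next
  assume "\<exists>a. \<not> p dvd a \<and> z = \<zeta> ^ a"
  then obtain a where a: "\<not> p dvd a" "z = \<zeta> ^ a" by blast
  have "z ^ m \<noteq> 1" using a m_pos by (simp add: zeta_power_eq_1_iff q_eq flip: power_mult)
  moreover have "z ^ q = 1" unfolding a by (simp add: power_mult[symmetric] zeta_power_eq_1_iff)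
  ultimately show "ipoly \<Phi> z = 0" using ipoly_Phi_mult[of z] by simp
qed

text \<open>Irreducibility of \<open>\<Phi>\<close>:
  by Frobenius, a factor \<open>E\<close> with root \<open>\<zeta> ^ a\<close> satisfies
  \<open>E 1 \<equiv> 0\<close> modulo \<open>p\<close>; two non-constant factors would give \<open>p\<^sup>2 dvd \<Phi> 1 = p\<close>.\<close>

lemma zeta_not_root_of_low_degree:
  assumes "ipoly F \<zeta> = 0" "degree F < d"
  shows "F = 0"
proof -
  obtain T0 where T0: "T0 \<noteq> 0 \<and> ipoly T0 \<zeta> = 0" and
    min0: "\<And>G. G \<noteq> 0 \<and> ipoly G \<zeta> = 0 \<Longrightarrow> degree T0 \<le> degree G"
    using ex_has_least_nat[of "\<lambda>G. G \<noteq> 0 \<and> ipoly G \<zeta> = 0" \<Phi> degree]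
      Phi_neq_0 ipoly_Phi_eq_0_iff[of \<zeta>] p_gt_1
        by (metis nat_dvd_1_iff_1 less_irrefl power_one_right)
  define T where "T = primitive_part T0"
  have cT: "content T = 1" using T0 by (simp add: T_def)
  have "of_int (content T0) * ipoly T \<zeta> = ipoly T0 \<zeta>"
    unfolding T_def by (metis content_times_primitive_part ipoly_smult)
  then have Tz: "ipoly T \<zeta> = 0" using T0 by auto
  have min: "G = 0" if "ipoly G \<zeta> = 0" "degree G < degree T" for G
    using min0[of G] that by (auto simp: T_def)
  have T_neq_0: "T \<noteq> 0" using cT by auto
  have degT: "degree T > 0"
  proof (rule ccontr)
    assume "\<not> degree T > 0"
    then obtain t where "T = [:t:]" by (metis degree_eq_zeroE neq0_conv)
    then show False using Tz T_neq_0 by simp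
  qed
  have "T dvd \<Phi>"
    using Tz ipoly_Phi_eq_0_iff[of \<zeta>] p_gt_1
    by (intro primitive_minimal_dvd[OF cT Tz min]) (metis nat_dvd_1_iff_1 less_irrefl power_one_right)+
  then obtain G where G: "\<Phi> = T * G" by (auto elim: dvdE)
  then have lead: "lead_coeff T * lead_coeff G = 1"
    using lead_coeff_Phi by (simp add: lead_coeff_mult)
  then have lT: "lead_coeff T = 1 \<or> lead_coeff T = -1" using pos_zmult_eq_1_iff_lemma by blast
  \<comment> \<open>\<open>T\<close> is monic up to sign, so dividing by it writes an element in the
    powers of \<zeta> with exponent below \<open>degree T\<close>, which are independent by
    minimality; then constant terms can be compared. This is argued for \<open>T\<close>, since
    \<open>d\<close> is not yet known to be the minimal degree.\<close>
  have int_dvd: "N dvd b" if bN: "of_int b = of_int N * ipoly E \<zeta>" for N b E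
  proof -
    obtain Q r where Qr: "pseudo_divmod E T = (Q, r)" by force
    define a where "a = lead_coeff T ^ (Suc (degree E) - degree T)"
    have a: "a * a = 1" using lT by (auto simp: a_def simp flip: power_mult_distrib)
    have eq: "Polynomial.smult a E = T * Q + r" and r: "r = 0 \<or> degree r < degree T"
      using pseudo_divmod[OF T_neq_0 Qr] by (simp_all add: a_def)
    have "degree r < degree T" using r degT by auto
    have "ipoly (Polynomial.smult a E) \<zeta> = ipoly r \<zeta>" unfolding eq using Tz by simp
    then have "of_int a * (of_int a * ipoly E \<zeta>) = of_int a * ipoly r \<zeta>" by simp
    then have "of_int (a * a) * ipoly E \<zeta> = of_int a * ipoly r \<zeta>"
      by (simp add: mult.assoc)
    then have "ipoly E \<zeta> = ipoly (Polynomial.smult a r) \<zeta>" by (simp add: a)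
    then have "ipoly (Polynomial.smult N (Polynomial.smult a r) - [:b:]) \<zeta> = 0"
      using bN by simp
    moreover have "degree (Polynomial.smult N (Polynomial.smult a r) - [:b:]) < degree T"
      using \<open>degree r < degree T\<close> degT
        by (intro degree_diff_less) (auto intro: le_less_trans[OF degree_smult_le])
    ultimately have "Polynomial.smult N (Polynomial.smult a r) - [:b:] = 0" by (rule min)
    then have "Polynomial.coeff (Polynomial.smult N (Polynomial.smult a r) - [:b:]) 0 = 0" by simp
    then have "b = N * (a * Polynomial.coeff r 0)" by simp
    then show ?thesis by simp
  qed
  have p_dvd: "int p dvd poly E 1" if E: "ipoly E (\<zeta> ^ a) = 0" for E a
  proof -
    obtain H where H: "\<And>z. ipoly E z ^ (p ^ e) = ipoly E (z ^ (p ^ e)) + of_nat p * ipoly H z"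
      using ipoly_Frobenius[OF prime_p] by blast
    have "(\<zeta> ^ a) ^ q = 1" by (simp add: power_mult[symmetric] zeta_power_eq_1_iff)
    then have "0 = ipoly E 1 + of_nat p * ipoly H (\<zeta> ^ a)"
      using H[of "\<zeta> ^ a"] E q_pos unfolding q_def by (simp add: zero_power)
    moreover obtain H' where "ipoly H (\<zeta> ^ a) = ipoly H' \<zeta>"
      using ipoly_Zz[of "\<zeta> ^ a" H] by (metis ZzE Zz_power zeta_in_Zz)
    ultimately have "of_int (poly E 1) = of_int (int p) * ipoly (- H') \<zeta>"
      using ipoly_of_int[of E 1] by (simp add: eq_neg_iff_add_eq_0)
    then show ?thesis by (rule int_dvd)
  qed
  have "degree G = 0"
  proof (rule ccontr)
    assume "degree G \<noteq> 0"
    then have "\<not> constant (poly (map_poly complex_of_int G))"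
      by (simp add: constant_degree degree_map_poly)
    then obtain z where "ipoly G z = 0" unfolding ipoly_def
      using fundamental_theorem_of_algebra by blast
    moreover from this have "ipoly \<Phi> z = 0" by (simp add: G)
    ultimately obtain a where "ipoly G (\<zeta> ^ a) = 0" by (metis ipoly_Phi_eq_0_iff)
    then have "int p dvd poly G 1" by (rule p_dvd)
    moreover have "int p dvd poly T 1" using p_dvd[of T 1] Tz by simp
    ultimately have "int p * int p dvd poly \<Phi> 1"
      unfolding G poly_mult by (rule mult_dvd_mono[rotated])
    also have "poly \<Phi> 1 = int p" by (simp add: \<Phi>_def poly_sum poly_monom)
    finally show False
      using p_gt_1 by (metis dvd_imp_le int_dvd_int_iff linorder_not_le mult.right_neutral nat_mult_less_cancel1 of_nat_mult p_pos)
  qed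
  then have "degree T = d"
    using degree_Phi T_neq_0 Phi_neq_0 unfolding G by (subst (asm) degree_mult_eq) auto
  then show ?thesis using min assms by simp
qed

lemma Zz_reduced:
  assumes "x \<in> Zz"
  obtains F where "x = ipoly F \<zeta>" "degree F < d"
proof -
  obtain F where F: "x = ipoly F \<zeta>" using assms by (rule ZzE)
  obtain Q r where Qr: "pseudo_divmod F \<Phi> = (Q, r)" by force
  have "F = \<Phi> * Q + r" "degree r < d"
    using pseudo_divmod[OF Phi_neq_0 Qr] lead_coeff_Phi degree_Phi d_pos by auto
  moreover have "ipoly \<Phi> \<zeta> = 0"
    using ipoly_Phi_eq_0_iff[of \<zeta>] p_gt_1
      by (metis nat_dvd_1_iff_1 less_irrefl power_one_right)
  ultimately show ?thesis using that[of r] F by simp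
qed

section \<open>Galois automorphisms of the cyclotomic ring\<close>

lemma ipoly_zeta_power_eq:
  assumes "ipoly F \<zeta> = ipoly G \<zeta>" "\<not> p dvd a"
  shows "ipoly F (\<zeta> ^ a) = ipoly G (\<zeta> ^ a)"
proof -
  obtain Q r where Qr: "pseudo_divmod (F - G) \<Phi> = (Q, r)" by force
  have eq: "F - G = \<Phi> * Q + r" "degree r < d"
    using pseudo_divmod[OF Phi_neq_0 Qr] lead_coeff_Phi degree_Phi d_pos by auto
  have "ipoly \<Phi> \<zeta> = 0"
    using ipoly_Phi_eq_0_iff[of \<zeta>] p_gt_1
      by (metis nat_dvd_1_iff_1 less_irrefl power_one_right)
  then have "ipoly r \<zeta> = ipoly (F - G) \<zeta>" unfolding eq by simp
  then have "r = 0" using assms(1) eq(2) by (intro zeta_not_root_of_low_degree) auto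
  then have "ipoly (F - G) (\<zeta> ^ a) = ipoly \<Phi> (\<zeta> ^ a) * ipoly Q (\<zeta> ^ a)"
    unfolding eq by simp
  also have "\<dots> = 0" using assms(2) ipoly_Phi_eq_0_iff by auto
  finally show ?thesis by simp
qed

text \<open>Any polynomial representing \<open>x\<close> may be chosen: if \<open>p\<close> does not
  divide \<open>a\<close>, \<open>ipoly_zeta_power_eq\<close> makes the value independent of it. The
  index is a natural number, so conjugation appears as \<open>gal (q - 1)\<close>.\<close>

definition gal :: "nat \<Rightarrow> complex \<Rightarrow> complex" where
  "gal a x = ipoly (SOME F. x = ipoly F \<zeta>) (\<zeta> ^ a)"

lemma gal_ipoly:
  assumes "\<not> p dvd a"
  shows "gal a (ipoly F \<zeta>) = ipoly F (\<zeta> ^ a)"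
proof -
  have "ipoly F \<zeta> = ipoly (SOME G. ipoly F \<zeta> = ipoly G \<zeta>) \<zeta>"
    by (rule someI) (rule refl)
  then show ?thesis unfolding gal_def using ipoly_zeta_power_eq assms by metis
qed

context
  fixes a :: nat
  assumes a: "\<not> p dvd a"
begin

lemma gal_in_Zz [simp]: "x \<in> Zz \<Longrightarrow> gal a x \<in> Zz"
  by (auto simp: gal_ipoly[OF a] elim!: ZzE)

lemma gal_of_int [simp]: "gal a (of_int k) = of_int k"
  using gal_ipoly[OF a, of "[:k:]"] by simp

lemma gal_1 [simp]: "gal a 1 = 1" and gal_numeral [simp]: "gal a (numeral k) = numeral k"
  using gal_of_int[of 1] gal_of_int[of "numeral k"] by simp_all

lemma gal_zeta_power [simp]: "gal a (\<zeta> ^ i) = \<zeta> ^ (a * i)"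
  using gal_ipoly[OF a, of "Polynomial.monom 1 i"] by (simp add: power_mult)

lemma gal_add: "x \<in> Zz \<Longrightarrow> y \<in> Zz \<Longrightarrow> gal a (x + y) = gal a x + gal a y"
  by (elim ZzE) (simp add: gal_ipoly[OF a] flip: ipoly_add)

lemma gal_mult: "x \<in> Zz \<Longrightarrow> y \<in> Zz \<Longrightarrow> gal a (x * y) = gal a x * gal a y"
  by (elim ZzE) (simp add: gal_ipoly[OF a] flip: ipoly_mult)

lemma gal_diff: "x \<in> Zz \<Longrightarrow> y \<in> Zz \<Longrightarrow> gal a (x - y) = gal a x - gal a y"
  by (elim ZzE) (simp add: gal_ipoly[OF a] flip: ipoly_diff)

lemma gal_minus: "x \<in> Zz \<Longrightarrow> gal a (- x) = - gal a x"
  by (elim ZzE) (simp add: gal_ipoly[OF a] flip: ipoly_minus)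

lemma gal_power: "x \<in> Zz \<Longrightarrow> gal a (x ^ n) = gal a x ^ n"
  by (elim ZzE) (simp add: gal_ipoly[OF a] flip: ipoly_power)

lemma gal_0 [simp]: "gal a 0 = 0" using gal_of_int[of 0] by simp

lemma gal_sum: "(\<And>i. i \<in> A \<Longrightarrow> f i \<in> Zz) \<Longrightarrow> gal a (sum f A) = (\<Sum>i\<in>A. gal a (f i))"
  by (induction A rule: infinite_finite_induct) (auto simp: gal_add)

lemma gal_cnj: "x \<in> Zz \<Longrightarrow> gal a (cnj x) = cnj (gal a x)"
proof (elim ZzE)
  fix F assume x: "x = ipoly F \<zeta>"
  have "cnj x = ipoly (F \<circ>\<^sub>p Polynomial.monom 1 (q - 1)) \<zeta>"
    by (simp add: x cnj_ipoly cnj_zeta ipoly_pcompose)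
  then have "gal a (cnj x) = ipoly (F \<circ>\<^sub>p Polynomial.monom 1 (q - 1)) (\<zeta> ^ a)"
    by (simp only: gal_ipoly[OF a])
  then show ?thesis
    by (simp add: x gal_ipoly[OF a] cnj_ipoly cnj_zeta ipoly_pcompose power_mult[symmetric] mult.commute)
qed

end

lemma gal_gal:
  assumes "\<not> p dvd a" "\<not> p dvd b" "x \<in> Zz"
  shows "gal a (gal b x) = gal (a * b) x"
proof -
  obtain F where F: "x = ipoly F \<zeta>" using assms(3) by (rule ZzE)
  have "\<not> p dvd a * b" using assms prime_p by (simp add: prime_dvd_mult_iff)
  then have "gal (a * b) x = ipoly F (\<zeta> ^ (a * b))" by (simp add: F gal_ipoly)
  moreover have "gal b x = ipoly (F \<circ>\<^sub>p Polynomial.monom 1 b) \<zeta>"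
    using assms by (simp add: F gal_ipoly ipoly_pcompose)
  then have "gal a (gal b x) = ipoly (F \<circ>\<^sub>p Polynomial.monom 1 b) (\<zeta> ^ a)"
    by (simp only: gal_ipoly[OF assms(1)])
  ultimately show ?thesis by (simp add: ipoly_pcompose power_mult)
qed

lemma gal_cong:
  assumes "\<not> p dvd a" "[a = b] (mod q)" "x \<in> Zz"
  shows "gal a x = gal b x"
proof -
  have "[a = b] (mod p)" using assms(2) by (rule cong_dvd_modulus_nat) (simp add: q_eq)
  then have "\<not> p dvd b" using assms(1) by (simp add: cong_dvd_iff)
  then show ?thesis using assms zeta_power_cong[OF assms(2)] by (auto simp: gal_ipoly elim!: ZzE)
qed

lemma gal_Suc_0: "x \<in> Zz \<Longrightarrow> gal (Suc 0) x = x"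
  using p_gt_1 by (auto simp: gal_ipoly elim!: ZzE)

lemma not_p_dvd_q_minus_1: "\<not> p dvd q - 1"
proof
  assume "p dvd q - 1"
  moreover have "p dvd q" by (simp add: q_eq)
  ultimately have "p dvd 1" using q_pos by (metis dvd_diffD1 Suc_leI One_nat_def)
  then show False using p_gt_1 by simp
qed

lemma gal_cnj_eq:
  assumes "x \<in> Zz"
  shows "gal (q - 1) x = cnj x"
  using assms gal_ipoly[OF not_p_dvd_q_minus_1] by (auto simp: cnj_ipoly cnj_zeta elim!: ZzE)

lemma gal_2_Frobenius:
  assumes "odd p" "x \<in> Zz"
  obtains y where "y \<in> Zz" "x\<^sup>2 = gal 2 x + 2 * y"
proof -
  obtain F where F: "x = ipoly F \<zeta>" using assms(2) by (rule ZzE)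
  obtain G where "\<And>z. ipoly F z ^ (2 ^ 1) = ipoly F (z ^ (2 ^ 1)) + of_nat 2 * ipoly G z"
    using ipoly_Frobenius[OF two_is_prime_nat] by blast
  moreover have "\<not> p dvd 2"
    using assms(1) p_gt_1 by (metis dvd_imp_le le_antisym even_numeral not_less_eq_eq numeral_2_eq_2 pos2 Suc_leI One_nat_def)
  ultimately show ?thesis using that[of "ipoly G \<zeta>"] by (simp add: F gal_ipoly)
qed

text \<open>A rational number in the ring is an integer: the powers of \<zeta> with exponent below
  \<open>d\<close> are independent, so constant coefficients can be compared.\<close>

lemma Zz_rational_multiple:
  assumes "x \<in> Zz" "of_int b = of_int N * x"
  shows "N dvd b"
proof -
  obtain F where F: "x = ipoly F \<zeta>" "degree F < d" using assms(1) by (rule Zz_reduced)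
  have "ipoly (Polynomial.smult N F - [:b:]) \<zeta> = 0" using assms(2) F by simp
  moreover have "degree (Polynomial.smult N F - [:b:]) < d"
    using F d_pos by (intro degree_diff_less) (auto intro: le_less_trans[OF degree_smult_le])
  ultimately have "Polynomial.smult N F - [:b:] = 0" by (rule zeta_not_root_of_low_degree)
  then have "Polynomial.coeff (Polynomial.smult N F - [:b:]) 0 = 0" by simp
  then have "b = N * Polynomial.coeff F 0" by simp
  then show ?thesis by simp
qed

definition units_q :: "nat set" where "units_q = {a. a < q \<and> \<not> p dvd a}"

lemma card_units_q: "card units_q = d"
proof -
  have "{a. a < q \<and> p dvd a} = (\<lambda>b. p * b) ` {..<m}"
    using p_pos by (auto simp: q_eq image_iff elim!: dvdE)
  then have "card {a. a < q \<and> p dvd a} = m"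
    using p_pos by (simp add: card_image inj_on_def)
  moreover have "units_q = {..<q} - {a. a < q \<and> p dvd a}" by (auto simp: units_q_def)
  ultimately have "card units_q = q - m" by (simp add: card_Diff_subset subset_iff)
  then show ?thesis using d_add_m by simp
qed

lemma inj_on_zeta_power: "inj_on (\<lambda>a. \<zeta> ^ a) {..<q}"
proof -
  have False if ab: "\<zeta> ^ a = \<zeta> ^ b" "a < b" "b < q" for a b
  proof -
    have "\<zeta> ^ b = \<zeta> ^ a * \<zeta> ^ (b - a)" unfolding power_add[symmetric]
      using ab(2) by simp
    then have "\<zeta> ^ (b - a) = 1" using ab(1) by simp
    then have "q dvd b - a" by (simp add: zeta_power_eq_1_iff)
    then show False using ab by (auto dest: dvd_imp_le)
  qed
  then show ?thesis unfolding inj_on_def by (metis lessThan_iff linorder_neqE_nat)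
qed

text \<open>Writing \<open>x\<close> as \<open>F\<close> at \<zeta> with degree below
  \<open>d\<close>, the polynomial \<open>F - x\<close> vanishes at all \<open>d\<close> conjugates
  of \<zeta>, so it is zero and \<open>x\<close> is the constant coefficient.\<close>

lemma gal_fixed_imp_int:
  assumes "x \<in> Zz" "\<And>a. \<not> p dvd a \<Longrightarrow> gal a x = x"
  shows "x \<in> \<int>"
proof -
  obtain F where F: "x = ipoly F \<zeta>" "degree F < d" using assms(1) by (rule Zz_reduced)
  define G where "G = map_poly complex_of_int F - [:x:]"
  have "poly G (\<zeta> ^ a) = 0" if "a \<in> units_q" for a
    using that assms(2)[of a] gal_ipoly[of a F] F by (simp add: G_def units_q_def flip: ipoly_def)
  then have sub: "(\<lambda>a. \<zeta> ^ a) ` units_q \<subseteq> {z. poly G z = 0}" by auto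
  have "G = 0"
  proof (rule ccontr)
    assume "G \<noteq> 0"
    have "d = card ((\<lambda>a. \<zeta> ^ a) ` units_q)"
      using card_units_q
        by (subst card_image) (auto intro: inj_on_subset[OF inj_on_zeta_power] simp: units_q_def)
    also have "\<dots> \<le> card {z. poly G z = 0}"
      using sub poly_roots_finite[OF \<open>G \<noteq> 0\<close>] by (rule card_mono[rotated])
    also have "\<dots> \<le> degree G"
      using \<open>G \<noteq> 0\<close> by (rule card_poly_roots_bound)
    also have "\<dots> < d" unfolding G_def using F d_pos
      by (intro degree_diff_less) (auto simp: degree_map_poly)
    finally show False by simp
  qed
  then have "Polynomial.coeff G 0 = 0" by simp
  then have "x = of_int (Polynomial.coeff F 0)" by (simp add: G_def coeff_map_poly)
  then show ?thesis by simp
qed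

end

section \<open>Cyclotomic integers of absolute value one\<close>

lemma sum_powers_root_of_unity:
  fixes u :: complex
  assumes "u ^ M = 1"
  shows "(\<Sum>b<M. u ^ b) = (if u = 1 then of_nat M else 0)"
proof (cases "u = 1")
  case False
  have "(u - 1) * (\<Sum>b<M. u ^ b) = u ^ M - 1" by (rule power_diff_1_eq[symmetric])
  then show ?thesis using False assms by simp
qed simp

lemma Parseval_roots_of_unity:
  fixes w :: complex and c :: "nat \<Rightarrow> int"
  assumes "w ^ M = 1" "inj_on (\<lambda>j. w ^ j) {..<M}" "cmod w = 1"
  shows "(\<Sum>b<M. (cmod (\<Sum>j<M. of_int (c j) * (w ^ b) ^ j))\<^sup>2) = real M * (\<Sum>j<M. (real_of_int (c j))\<^sup>2)"
proof -
  have wc: "w * cnj w = 1" using assms(3) by (simp add: complex_norm_square[symmetric])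
  have orth: "(\<Sum>b<M. (w ^ b) ^ j * cnj ((w ^ b) ^ k)) = (if j = k then of_nat M else 0)"
    if jk: "j < M" "k < M" for j k
  proof -
    define u where "u = w ^ j * cnj (w ^ k)"
    have "u ^ M = (w ^ M) ^ j * cnj ((w ^ M) ^ k)"
      by (simp add: u_def power_mult_distrib power_mult[symmetric] mult.commute)
    then have uM: "u ^ M = 1" by (simp add: assms(1))
    have "u * w ^ k = w ^ j * (w * cnj w) ^ k" by (simp add: u_def power_mult_distrib)
    then have "u * w ^ k = w ^ j" by (simp add: wc)
    moreover have "w ^ k \<noteq> 0" using assms(3) by auto
    ultimately have "u = 1 \<longleftrightarrow> w ^ j = w ^ k" by (metis mult_cancel_right1 mult_1)
    also have "\<dots> \<longleftrightarrow> j = k" using assms(2) jk by (auto simp: inj_on_def)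
    finally have u1: "u = 1 \<longleftrightarrow> j = k" .
    have "(w ^ b) ^ j * cnj ((w ^ b) ^ k) = u ^ b" for b
      by (simp add: u_def power_mult_distrib power_mult[symmetric] mult.commute)
    then show ?thesis using sum_powers_root_of_unity[OF uM] u1 by simp
  qed
  have "complex_of_real (\<Sum>b<M. (cmod (\<Sum>j<M. of_int (c j) * (w ^ b) ^ j))\<^sup>2)
      = (\<Sum>b<M. (\<Sum>j<M. of_int (c j) * (w ^ b) ^ j) * cnj (\<Sum>k<M. of_int (c k) * (w ^ b) ^ k))"
    by (simp only: of_real_sum complex_norm_square)
  also have "\<dots> = (\<Sum>b<M. \<Sum>j<M. \<Sum>k<M. of_int (c j * c k) * ((w ^ b) ^ j * cnj ((w ^ b) ^ k)))"
    by (simp add: cnj_sum sum_product algebra_simps)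
  also have "\<dots> = (\<Sum>j<M. \<Sum>b<M. \<Sum>k<M. of_int (c j * c k) * ((w ^ b) ^ j * cnj ((w ^ b) ^ k)))"
    by (rule sum.swap)
  also have "\<dots> = (\<Sum>j<M. \<Sum>k<M. \<Sum>b<M. of_int (c j * c k) * ((w ^ b) ^ j * cnj ((w ^ b) ^ k)))"
    by (intro sum.cong refl sum.swap)
  also have "\<dots> = (\<Sum>j<M. \<Sum>k<M. of_int (c j * c k) * (if j = k then of_nat M else 0))"
    unfolding sum_distrib_left[symmetric]
      by (intro sum.cong refl arg_cong2[of _ _ _ _ "(*)"] orth) auto
  also have "\<dots> = (\<Sum>j<M. of_int (c j * c j) * of_nat M)"
    by (intro sum.cong refl) (simp add: if_distrib sum.delta cong: if_cong)
  also have "\<dots> = complex_of_real (real M * (\<Sum>j<M. (real_of_int (c j))\<^sup>2))"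
    by (simp add: sum_distrib_left power2_eq_square algebra_simps)
  finally show ?thesis by (simp only: of_real_eq_iff)
qed

lemma sum_lessThan_mult:
  fixes f :: "nat \<Rightarrow> 'a :: comm_monoid_add"
  shows "(\<Sum>j<p * m. f j) = (\<Sum>B<m. \<Sum>i<p. f (B + i * m))"
proof -
  have "(\<Sum>j<p * m. f j) = (\<Sum>i<p. sum f {i * m ..< i * m + m})"
    by (rule sum.nat_group[symmetric])
  also have "\<dots> = (\<Sum>i<p. \<Sum>B<m. f (B + i * m))"
  proof (rule sum.cong)
    fix i
    show "sum f {i * m ..< i * m + m} = (\<Sum>B<m. f (B + i * m))"
      using sum.shift_bounds_nat_ivl[of f 0 "i * m" m] by (simp add: atLeast0LessThan add.commute)
  qed simp
  also have "\<dots> = (\<Sum>B<m. \<Sum>i<p. f (B + i * m))" by (rule sum.swap)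
  finally show ?thesis .
qed

lemma int_abs_le_square: "\<bar>x :: int\<bar> \<le> x\<^sup>2"
proof (cases "x = 0")
  case False
  then have "1 * \<bar>x\<bar> \<le> \<bar>x\<bar> * \<bar>x\<bar>" by (intro mult_right_mono) auto
  then show ?thesis by (simp add: power2_eq_square)
qed simp

text \<open>Equal to the sum of \<open>(x i - x j)\<^sup>2\<close> over pairs \<open>i < j\<close>.
  It vanishes exactly on constant families, which are the integral relations among the
  \<open>p\<close>-th roots of unity.\<close>

definition spread :: "nat \<Rightarrow> (nat \<Rightarrow> int) \<Rightarrow> int" where
  "spread p x = int p * (\<Sum>i<p. (x i)\<^sup>2) - (\<Sum>i<p. x i)\<^sup>2"

text \<open>\<open>spread\<close> is invariant under adding a constant, so the sum of the \<open>x i\<close> may be taken of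
  absolute value at most \<open>p / 2\<close>.\<close>

lemma spread_cases:
  assumes "p \<ge> 2"
  obtains k where "\<And>i. i < p \<Longrightarrow> x i = k" "spread p x = 0"
  | k i0 s where "i0 < p" "s = 1 \<or> s = -1" "\<And>i. i < p \<Longrightarrow> x i = k + (if i = i0 then s else 0)"
      "spread p x = int p - 1"
  | "spread p x > int p - 1"
proof -
  define S where "S = (\<Sum>i<p. x i)"
  \<comment> \<open>An integer nearest to \<open>S / p\<close>: adding \<open>p div 2\<close> turns
    the floor into rounding.\<close>
  define k where "k = (S + int p div 2) div int p"
  define y where "y i = x i - k" for i
  define s where "s = (\<Sum>i<p. y i)"
  define A where "A = (\<Sum>i<p. (y i)\<^sup>2)"
  have sS: "s = S - int p * k" by (simp add: s_def y_def S_def sum_subtractf)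
  have "S + int p div 2 = int p * k + (S + int p div 2) mod int p" by (simp add: k_def)
  moreover have "0 \<le> (S + int p div 2) mod int p" "(S + int p div 2) mod int p < int p"
    using assms by simp_all
  ultimately have s_bound: "2 * \<bar>s\<bar> \<le> int p" using sS by linarith
  have A_eq: "A = (\<Sum>i<p. (x i)\<^sup>2) - 2 * k * S + int p * k\<^sup>2"
    by (simp add: A_def y_def S_def power2_diff sum.distrib sum_subtractf sum_distrib_left algebra_simps)
  have spread: "spread p x = int p * A - s\<^sup>2"
    by (simp add: spread_def A_eq sS flip: S_def) (simp add: algebra_simps power2_eq_square)
  have "\<bar>s\<bar> \<le> (\<Sum>i<p. \<bar>y i\<bar>)" unfolding s_def by (rule sum_abs)
  also have "\<dots> \<le> A" unfolding A_def by (intro sum_mono int_abs_le_square)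
  finally have sA: "\<bar>s\<bar> \<le> A" .
  have A0: "A \<ge> 0" unfolding A_def by (intro sum_nonneg) simp
  consider "A = 0" | "A = 1" "\<bar>s\<bar> = 1" | "A \<ge> 1" "s = 0" | "A \<ge> 2" "\<bar>s\<bar> = 1" | "A \<ge> 1" "\<bar>s\<bar> \<ge> 2"
    using A0 sA by linarith
  then show thesis
  proof cases
    case 1
    then have "\<forall>i\<in>{..<p}. (y i)\<^sup>2 = 0"
      unfolding A_def by (subst (asm) sum_nonneg_eq_0_iff) auto
    then show thesis using that(1)[of k] 1 sA by (auto simp: y_def spread)
  next
    case 2
    have "\<exists>i0<p. y i0 \<noteq> 0" by (rule ccontr) (use 2 in \<open>simp add: A_def\<close>)
    then obtain i0 where i0: "i0 < p" "y i0 \<noteq> 0" by blast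
    have "A = (y i0)\<^sup>2 + (\<Sum>i\<in>{..<p} - {i0}. (y i)\<^sup>2)"
      unfolding A_def using i0 by (subst sum.remove[of _ i0]) auto
    moreover have "(\<Sum>i\<in>{..<p} - {i0}. (y i)\<^sup>2) \<ge> 0" by (intro sum_nonneg) simp
    moreover have "(y i0)\<^sup>2 \<ge> 1" using i0 by (simp add: int_one_le_iff_zero_less)
    ultimately have "(y i0)\<^sup>2 = 1" "(\<Sum>i\<in>{..<p} - {i0}. (y i)\<^sup>2) = 0"
      using 2 by linarith+
    then have y: "y i0 = 1 \<or> y i0 = -1" "\<forall>i\<in>{..<p} - {i0}. (y i)\<^sup>2 = 0"
      by (simp_all add: power2_eq_1_iff sum_nonneg_eq_0_iff)
    have x: "x i = k + (if i = i0 then y i0 else 0)" if "i < p" for i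
      using y(2) that by (auto simp: y_def)
    have "s\<^sup>2 = 1" using 2 by (metis power2_abs power_one)
    then have "spread p x = int p - 1" using 2 spread by simp
    then show thesis using that(2)[of i0 "y i0" k] i0(1) y(1) x by blast
  next
    case 3
    have "int p * 1 \<le> int p * A" using 3 by (intro mult_left_mono) auto
    then show thesis using that(3) 3 spread by simp
  next
    case 4
    have "int p * 2 \<le> int p * A" using 4 by (intro mult_left_mono) auto
    moreover have "s\<^sup>2 = 1" using 4 by (metis power2_abs power_one)
    ultimately show thesis using that(3) spread assms by simp
  next
    case 5
    have "int p * \<bar>s\<bar> \<le> int p * A" using sA by (intro mult_left_mono) auto
    \<comment> \<open>As \<open>\<bar>s\<bar> \<le> A\<close>, the spread is at least
      \<open>p * \<bar>s\<bar> - s\<^sup>2\<close>. This product is the excess of that expression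
      over its value \<open>p - 1\<close> at 1.\<close>
    moreover have "(\<bar>s\<bar> - 1) * (int p - 1 - \<bar>s\<bar>) > 0"
      using 5 s_bound by (intro mult_pos_pos) linarith+
    moreover have "(\<bar>s\<bar> - 1) * (int p - 1 - \<bar>s\<bar>) = int p * \<bar>s\<bar> - s\<^sup>2 - int p + 1"
      by (simp add: algebra_simps power2_eq_square flip: abs_mult)
    ultimately show thesis using that(3) spread by linarith
  qed
qed

context cyclotomic
begin

lemma cmod_zeta: "cmod \<zeta> = 1" by (simp add: \<zeta>_def)

lemma sum_zeta_m_powers: "(\<Sum>i<p. (\<zeta> ^ m) ^ i) = 0"
  using ipoly_Phi_eq_0_iff[of \<zeta>] p_gt_1 ipoly_Phi[of \<zeta>]
    by (metis nat_dvd_1_iff_1 less_irrefl power_one_right)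

text \<open>Kronecker's theorem for this ring,
  by Parseval: for \<open>x = \<Sum>j. c j * \<zeta>^j\<close>, the sum of
  \<open>|\<sigma> x|\<^sup>2\<close> over all Galois conjugates is \<open>m\<close> times the sum of the spreads of the coefficients
  over the residue classes modulo \<open>m\<close>.\<close>

theorem unit_modulus_imp_root_of_unity:
  assumes "v \<in> Zz" "cmod v = 1"
  obtains j s where "v = of_int s * \<zeta> ^ j" "s = 1 \<or> s = -1"
proof -
  obtain F where F: "v = ipoly F \<zeta>" "degree F < d" using assms(1) by (rule Zz_reduced)
  define c where "c j = Polynomial.coeff F j" for j
  define g where "g a = (cmod (ipoly F (\<zeta> ^ a)))\<^sup>2" for a
  define S where "S B = (\<Sum>i<p. c (B + i * m))" for B
  have Fz: "ipoly F z = (\<Sum>j<q. of_int (c j) * z ^ j)" for z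
    unfolding c_def using F(2) d_add_m by (intro ipoly_altdef) simp
  have conj: "g a = 1" if "\<not> p dvd a" for a
  proof -
    have "gal a v * cnj (gal a v) = gal a (v * cnj v)"
      using that assms(1) by (simp add: gal_mult gal_cnj)
    also have "v * cnj v = 1" using assms(2) by (simp flip: complex_norm_square)
    finally have "complex_of_real (g a) = 1"
      using that by (simp add: F gal_ipoly g_def complex_norm_square del: of_real_power)
    then show ?thesis by simp
  qed
  have all: "(\<Sum>a<q. g a) = real q * (\<Sum>j<q. (real_of_int (c j))\<^sup>2)"
    unfolding g_def Fz by (intro Parseval_roots_of_unity inj_on_zeta_power cmod_zeta) simp
  \<comment> \<open>At exponents divisible by \<open>p\<close> the values are taken at
    \<open>m\<close>-th roots of unity, which see only the block sums \<open>S B\<close>. Removing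
    them from the sum over all \<open>q\<close> exponents leaves the \<open>d\<close> conjugates of
    \<open>v\<close>.\<close>
  have multiples: "(\<Sum>b<m. g (p * b)) = real m * (\<Sum>B<m. (real_of_int (S B))\<^sup>2)"
  proof -
    have "ipoly F (\<zeta> ^ (p * b)) = (\<Sum>B<m. of_int (S B) * ((\<zeta> ^ p) ^ b) ^ B)" for b
    proof -
      have "((\<zeta> ^ (p * b)) ^ m) = 1" by (simp add: zeta_power_eq_1_iff q_eq flip: power_mult)
      then have "(\<zeta> ^ (p * b)) ^ (B + i * m) = ((\<zeta> ^ p) ^ b) ^ B" for B i
        by (simp add: power_add mult.commute[of i m] power_mult)
      then show ?thesis unfolding Fz q_eq sum_lessThan_mult S_def
        by (simp add: sum_distrib_right)
    qed
    moreover have "inj_on (\<lambda>j. (\<zeta> ^ p) ^ j) {..<m}"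
    proof (rule inj_onI)
      fix i j assume ij: "i \<in> {..<m}" "j \<in> {..<m}" "(\<zeta> ^ p) ^ i = (\<zeta> ^ p) ^ j"
      then have "\<zeta> ^ (p * i) = \<zeta> ^ (p * j)" by (simp add: power_mult)
      moreover have "p * i < q" "p * j < q" using ij p_pos by (auto simp: q_eq)
      ultimately have "p * i = p * j" using inj_onD[OF inj_on_zeta_power] by blast
      then show "i = j" using p_pos by simp
    qed
    moreover have "(\<zeta> ^ p) ^ m = 1" by (simp add: q_eq[symmetric] flip: power_mult)
    ultimately show ?thesis unfolding g_def
      using Parseval_roots_of_unity[of "\<zeta> ^ p" m S] by (simp add: norm_power cmod_zeta)
  qed
  have "(\<Sum>a<q. g a) = (\<Sum>a\<in>units_q. g a) + (\<Sum>a\<in>{a. a < q \<and> p dvd a}. g a)"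
    by (subst sum.union_disjoint[symmetric]) (auto simp: units_q_def intro!: sum.cong)
  also have "(\<Sum>a\<in>units_q. g a) = real d"
    using card_units_q by (simp add: conj units_q_def)
  also have "(\<Sum>a\<in>{a. a < q \<and> p dvd a}. g a) = (\<Sum>b<m. g (p * b))"
    using p_pos by (intro sum.reindex_bij_witness[of _ "\<lambda>b. p * b" "\<lambda>a. a div p"]) (auto simp: q_eq)
  finally have "real q * (\<Sum>j<q. (real_of_int (c j))\<^sup>2) = real d + real m * (\<Sum>B<m. (real_of_int (S B))\<^sup>2)"
    unfolding all multiples .
  then have "real m * (real p * (\<Sum>j<q. (real_of_int (c j))\<^sup>2)) = real m * (real (p - 1) + (\<Sum>B<m. (real_of_int (S B))\<^sup>2))"
    unfolding d_def q_eq of_nat_mult by (simp add: ring_distribs mult_ac)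
  then have "real p * (\<Sum>j<q. (real_of_int (c j))\<^sup>2) = real (p - 1) + (\<Sum>B<m. (real_of_int (S B))\<^sup>2)"
    using m_pos by simp
  then have "real_of_int (int p * (\<Sum>j<q. (c j)\<^sup>2)) = real_of_int (int (p - 1) + (\<Sum>B<m. (S B)\<^sup>2))"
    by simp
  then have "int p * (\<Sum>j<q. (c j)\<^sup>2) = int (p - 1) + (\<Sum>B<m. (S B)\<^sup>2)"
    by (simp only: of_int_eq_iff)
  \<comment> \<open>Spreads are nonnegative and each nonzero one is at least \<open>p - 1\<close>,
    so exactly one block is nonconstant, and it differs from a constant at one index by 1 or -1.
    Constant blocks contribute 0 to \<open>v\<close>.\<close>
  then have total: "(\<Sum>B<m. spread p (\<lambda>i. c (B + i * m))) = int p - 1"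
    using p_pos by (simp add: spread_def sum_subtractf q_eq sum_lessThan_mult S_def sum_distrib_left of_nat_diff)
  have p2: "p \<ge> 2" using p_gt_1 by simp
  have nonneg: "spread p x \<ge> 0" for x
    by (rule spread_cases[OF p2, of x]) (use p_gt_1 in auto)
  have block: "v = (\<Sum>B<m. \<zeta> ^ B * (\<Sum>i<p. of_int (c (B + i * m)) * (\<zeta> ^ m) ^ i))"
  proof -
    have "\<zeta> ^ (B + i * m) = \<zeta> ^ B * (\<zeta> ^ m) ^ i" for B i
      unfolding power_add by (simp add: mult.commute flip: power_mult)
    then show ?thesis unfolding F(1) Fz q_eq sum_lessThan_mult
      by (simp add: sum_distrib_left mult_ac)
  qed
  have "\<exists>B0<m. spread p (\<lambda>i. c (B0 + i * m)) \<noteq> 0"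
    using total p_gt_1
      by (metis (no_types, lifting) diff_gt_0_iff_gt lessThan_iff less_irrefl of_nat_1 of_nat_less_iff sum.neutral)
  then obtain B0 where B0: "B0 < m" "spread p (\<lambda>i. c (B0 + i * m)) \<noteq> 0" by blast
  have split: "spread p (\<lambda>i. c (B0 + i * m)) + (\<Sum>B\<in>{..<m} - {B0}. spread p (\<lambda>i. c (B + i * m))) = int p - 1"
    using total B0(1) by (simp add: sum.remove)
  have rest: "(\<Sum>B\<in>{..<m} - {B0}. spread p (\<lambda>i. c (B + i * m))) \<ge> 0"
    by (intro sum_nonneg nonneg)
  from spread_cases[OF p2, of "\<lambda>i. c (B0 + i * m)"]
  obtain k i0 s where ks: "i0 < p" "s = 1 \<or> s = -1"
    "\<And>i. i < p \<Longrightarrow> c (B0 + i * m) = k + (if i = i0 then s else 0)"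
    "spread p (\<lambda>i. c (B0 + i * m)) = int p - 1"
  proof cases
    case 1
    then show ?thesis using B0(2) by simp
  next
    case 2
    then show ?thesis using that by blast
  next
    case 3
    then show ?thesis using split rest by linarith
  qed
  have "\<forall>B\<in>{..<m} - {B0}. spread p (\<lambda>i. c (B + i * m)) = 0"
    using split ks(4) nonneg by (simp add: sum_nonneg_eq_0_iff)
  then have zero: "(\<Sum>i<p. of_int (c (B + i * m)) * (\<zeta> ^ m) ^ i) = 0" if "B \<in> {..<m} - {B0}" for B
  proof -
    have "spread p (\<lambda>i. c (B + i * m)) = 0"
      using that \<open>\<forall>B\<in>_. _\<close> by blast
    with spread_cases[OF p2, of "\<lambda>i. c (B + i * m)"] p_gt_1
    obtain k where "\<And>i. i < p \<Longrightarrow> c (B + i * m) = k"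
      by (metis diff_gt_0_iff_gt less_irrefl of_nat_1 of_nat_less_iff not_less_iff_gr_or_eq)
    then have "(\<Sum>i<p. of_int (c (B + i * m)) * (\<zeta> ^ m) ^ i) = of_int k * (\<Sum>i<p. (\<zeta> ^ m) ^ i)"
      by (simp add: sum_distrib_left)
    then show ?thesis by (simp add: sum_zeta_m_powers)
  qed
  have "v = \<zeta> ^ B0 * (\<Sum>i<p. of_int (c (B0 + i * m)) * (\<zeta> ^ m) ^ i)"
    unfolding block using B0(1) by (subst sum.remove[of _ B0]) (auto simp: zero)
  also have "(\<Sum>i<p. of_int (c (B0 + i * m)) * (\<zeta> ^ m) ^ i) = (\<Sum>i<p. of_int k * (\<zeta> ^ m) ^ i + (if i = i0 then of_int s * (\<zeta> ^ m) ^ i0 else 0))"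
    by (intro sum.cong refl) (auto simp: ks(3) algebra_simps)
  also have "\<dots> = of_int k * (\<Sum>i<p. (\<zeta> ^ m) ^ i) + of_int s * (\<zeta> ^ m) ^ i0"
    using ks(1) by (simp add: sum.distrib sum_distrib_left)
  also have "\<dots> = of_int s * (\<zeta> ^ m) ^ i0" by (simp add: sum_zeta_m_powers)
  finally have "v = of_int s * \<zeta> ^ (B0 + m * i0)" by (simp add: power_add power_mult)
  then show ?thesis using that ks(2) by blast
qed

end

section \<open>The quadratic subfield\<close>

lemma power_prime_power_cong_1:
  fixes x p :: nat
  assumes "[x = 1] (mod p)"
  shows "[x ^ (p ^ k) = 1] (mod p ^ Suc k)"
proof (induction k)
  case 0
  then show ?case using assms by simp
next
  case (Suc k)
  have "int p ^ Suc k dvd int x ^ (p ^ k) - 1"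
    using Suc by (simp add: cong_iff_dvd_diff flip: cong_int_iff)
  then obtain s where "int x ^ (p ^ k) - 1 = int p ^ Suc k * s" by (auto elim: dvdE)
  then have s: "int x ^ (p ^ k) = 1 + int p ^ Suc k * s" by simp
  let ?y = "int x ^ (p ^ k)"
  have "?y ^ p - 1 = (?y - 1) * (\<Sum>i<p. ?y ^ i)" by (rule power_diff_1_eq)
  moreover have "int p ^ Suc k dvd ?y - 1" by (simp add: s)
  moreover have "int p dvd (\<Sum>i<p. ?y ^ i)"
  proof -
    have "[?y = 1] (mod int p)" by (simp add: s cong_iff_dvd_diff)
    then have "[(\<Sum>i<p. ?y ^ i) = (\<Sum>i<p. 1 ^ i)] (mod int p)" by (intro cong_sum cong_pow)
    then show ?thesis by (simp add: cong_dvd_iff)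
  qed
  ultimately have "int p ^ Suc k * int p dvd ?y ^ p - 1" by (simp add: mult_dvd_mono)
  then have "int (p ^ Suc (Suc k)) dvd int (x ^ (p ^ Suc k)) - int 1"
    by (simp add: power_mult[symmetric] mult.commute)
  then show ?case by (simp only: cong_iff_dvd_diff[symmetric] cong_int_iff)
qed

text \<open>Since 2 has odd order \<open>(p - 1) / 2\<close> modulo \<open>p\<close>, the residue \<open>-2\<close> is a primitive root
  modulo \<open>p\<close>, which lifts to \<open>p ^ e\<close> unless \<open>2 ^ (p - 1) = 1\<close> modulo \<open>p\<^sup>2\<close>.\<close>

lemma unit_cong_plus_minus_power_of_two:
  fixes p e a :: nat
  assumes p: "prime p" "p mod 4 = 3" and ord: "ord p 2 = (p - 1) div 2" and e: "e > 0"
    and wief: "e = 1 \<or> \<not> [2 ^ (p - 1) = 1] (mod p\<^sup>2)" and a: "\<not> p dvd a"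
  shows "\<exists>i. [int a = 2 ^ i] (mod int (p ^ e)) \<or> [int a = - (2 ^ i)] (mod int (p ^ e))"
proof -
  have p3: "p \<ge> 3" using p by (metis mod_less_eq_dividend)
  have "odd p" using p(2) by presburger
  have "odd ((p - 1) div 2)" using p(2) by presburger
  have cop2: "coprime p 2" using \<open>odd p\<close> by simp
  \<comment> \<open>A natural number congruent to -2 modulo \<open>p ^ k\<close> for all
    \<open>k \<le> Suc e\<close>; that exponent is at least 2, so \<open>p\<^sup>2\<close> is always
    covered.\<close>
  define g where "g = p ^ Suc e - 2"
  have "p ^ 1 \<le> p ^ Suc e" using p3 by (intro power_increasing) auto
  moreover have "2 \<le> p ^ 1" using p3 by simp
  ultimately have "p ^ Suc e \<ge> 2" by (rule order_trans[rotated])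
  then have g: "int g = int p ^ Suc e - 2" by (simp add: g_def of_nat_diff)
  have g_cong: "[int g = - 2] (mod int p ^ k)" if "k \<le> Suc e" for k
    using le_imp_power_dvd[OF that, of "int p"] by (simp add: g cong_iff_dvd_diff)
  have g_pow: "[int (g ^ n) = (- 2) ^ n] (mod int p ^ k)" if "k \<le> Suc e" for k n
    using cong_pow[OF g_cong[OF that], of n] by simp
  have "coprime p g"
  proof -
    have "[- 2 = int g] (mod int p)" using cong_sym[OF g_cong[of 1]] by simp
    moreover have "coprime (- 2) (int p)" using \<open>odd p\<close> by simp
    ultimately have "coprime (int g) (int p)" by (rule cong_imp_coprime)
    then have "coprime (int p) (int g)" by (simp add: coprime_commute)
    then show ?thesis by simp
  qed
  have ordg: "ord p g = p - 1"
  proof -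
    have iff: "[g ^ n = 1] (mod p) \<longleftrightarrow> p - 1 dvd n" for n
    proof -
      have "[g ^ n = 1] (mod p) \<longleftrightarrow> [(- 2) ^ n = 1] (mod int p)"
        using g_pow[of 1 n]
          by (metis cong_int_iff cong_sym cong_trans le_add1 of_nat_1 plus_1_eq_Suc power_one_right)
      also have "\<dots> \<longleftrightarrow> p - 1 dvd n"
      proof (cases "even n")
        case True
        then have "[(- 2) ^ n = 1] (mod int p) \<longleftrightarrow> [2 ^ n = 1] (mod p)"
          by (simp flip: cong_int_iff)
        also have "\<dots> \<longleftrightarrow> (p - 1) div 2 dvd n"
          by (simp only: ord_divides ord)
        also have "\<dots> \<longleftrightarrow> p - 1 dvd n"
        proof -
          have "p - 1 = 2 * ((p - 1) div 2)" using \<open>odd p\<close> by simp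
          moreover have "coprime 2 ((p - 1) div 2)" using \<open>odd ((p - 1) div 2)\<close> by simp
          ultimately show ?thesis using True by (metis divides_mult dvd_mult_right)
        qed
        finally show ?thesis .
      next
        case False
        \<comment> \<open>For odd \<open>n\<close>, raising to the odd power
          \<open>(p - 1) div 2\<close>, the order of 2, would turn the congruence into -1 = 1 modulo
          \<open>p\<close>.\<close>
        have "\<not> [(- 2) ^ n = 1] (mod int p)"
        proof
          assume "[(- 2) ^ n = 1] (mod int p)"
          then have "[(- 2) ^ (n * ((p - 1) div 2)) = 1] (mod int p)"
            using cong_pow[of "(-2) ^ n" 1 "int p" "(p - 1) div 2"] by (simp add: power_mult)
          moreover have "(- 2) ^ (n * ((p - 1) div 2)) = - (2 ^ (n * ((p - 1) div 2)) :: int)"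
            using False \<open>odd ((p - 1) div 2)\<close> by simp
          moreover have "[2 ^ (n * ((p - 1) div 2)) = 1] (mod p)" unfolding ord_divides ord by simp
          then have "[2 ^ (n * ((p - 1) div 2)) = 1] (mod int p)" by (simp flip: cong_int_iff)
          ultimately have "[- 1 = 1] (mod int p)"
            by (metis cong_minus_minus_iff cong_sym cong_trans)
          then have "int p dvd 2" by (simp add: cong_iff_dvd_diff)
          then have "p dvd 2" by (metis int_dvd_int_iff of_nat_numeral)
          then show False using p3 by (auto dest: dvd_imp_le)
        qed
        moreover have "\<not> p - 1 dvd n"
          using False \<open>odd p\<close> dvd_trans[of 2 "p - 1" n] by auto
        ultimately show ?thesis by blast
      qed
      finally show ?thesis .
    qed
    have "ord p g dvd p - 1" using iff[of "p - 1"] unfolding ord_divides by simp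
    moreover have "p - 1 dvd ord p g" using iff[of "ord p g"] unfolding ord_divides by simp
    ultimately show ?thesis by (rule dvd_antisym)
  qed
  have pe: "p ^ e > 1" using p3 e by (intro one_less_power) auto
  have prim: "residue_primroot p g"
    using p3 \<open>coprime p g\<close> ordg p(1) by (simp add: residue_primroot_def totient_prime)
  have "residue_primroot (p ^ e) g"
  proof (cases "e = 1")
    case False
    then have "\<not> [2 ^ (p - 1) = 1] (mod p\<^sup>2)" "2 \<le> Suc e" using wief e by auto
    moreover have "[int (g ^ (p - 1)) = 2 ^ (p - 1)] (mod int p ^ 2)"
      using g_pow[of 2 "p - 1"] \<open>2 \<le> Suc e\<close> \<open>odd p\<close> by simp
    then have "[int (g ^ (p - 1)) = int (2 ^ (p - 1))] (mod int (p\<^sup>2))" by simp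
    then have "[g ^ (p - 1) = 2 ^ (p - 1)] (mod p\<^sup>2)" by (simp only: cong_int_iff)
    ultimately have "\<not> [g ^ (p - 1) = 1] (mod p\<^sup>2)" by (metis cong_sym cong_trans)
    then show ?thesis
      using residue_primroot_prime_lift_iff[OF p(1) \<open>odd p\<close> prim] e by simp
  qed (use prim in simp)
  then have "bij_betw (\<lambda>i. g ^ i mod p ^ e) {..<totient (p ^ e)} (totatives (p ^ e))"
    using pe by (rule residue_primroot_is_generator[rotated])
  moreover have "a mod p ^ e \<in> totatives (p ^ e)"
  proof -
    have "coprime p a" using a p(1) by (simp add: prime_imp_coprime)
    then have "coprime (p ^ e) a" by simp
    moreover have "[a = a mod p ^ e] (mod p ^ e)" by (simp add: cong_def)
    ultimately have "coprime (a mod p ^ e) (p ^ e)"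
      by (metis cong_imp_coprime coprime_commute)
    moreover from this have "a mod p ^ e \<noteq> 0"
      using pe by (metis coprime_0_left_iff nat_dvd_1_iff_1 less_irrefl)
    moreover have "a mod p ^ e < p ^ e" using p3 by (intro mod_less_divisor) simp
    ultimately show ?thesis by (simp add: totatives_def)
  qed
  ultimately obtain i where "a mod p ^ e = g ^ i mod p ^ e"
    by (metis (no_types, lifting) bij_betw_imp_surj_on imageE)
  then have "[int a = int (g ^ i)] (mod int (p ^ e))"
    by (simp only: cong_int_iff) (simp add: cong_def)
  then have "[int a = (- 2) ^ i] (mod int (p ^ e))" using g_pow[of e i] cong_trans by fastforce
  then show ?thesis by (cases "even i") auto
qed

text \<open>The disjunction about \<open>e\<close> makes both assertions of the theorem instances of
  one argument.\<close>

locale cyclotomic_7 = cyclotomic +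
  fixes c :: int
  assumes p_mod_8: "p mod 8 = 7" and ord_2: "ord p 2 = (p - 1) div 2"
    and not_Wieferich: "e = 1 \<or> \<not> [2 ^ (p - 1) = 1] (mod p\<^sup>2)"
    and c: "4 * c = int p + 1"
begin

text \<open>\<open>h\<close> is the order of 2 modulo \<open>p\<close>, and \<open>f\<close> is half
  the totient of \<open>q\<close>, the degree over the quadratic field. Oddness of \<open>f\<close>
  lets the trace act as the identity on idempotents modulo 2, and excludes \<open>s = -1\<close> in
  \<open>s ^ f = 1\<close>.\<close>

definition h where "h = (p - 1) div 2"
definition f where "f = h * m"

lemma odd_p: "odd p" and odd_h: "odd h" and p_eq: "p = 2 * h + 1"
  using p_mod_8 by (auto simp: h_def) presburger+

lemma real_p: "real p = 2 * real h + 1" and real_p': "real (p - Suc 0) = 2 * real h"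
proof -
  have "real p = real (2 * h + 1)" by (simp only: p_eq[symmetric])
  then show "real p = 2 * real h + 1" by simp
  then show "real (p - Suc 0) = 2 * real h" using p_gt_1 by (simp add: of_nat_diff)
qed

lemma odd_q: "odd q" and odd_f: "odd f"
  using odd_p odd_h by (auto simp: q_def m_def f_def)

lemma h_pos: "h > 0" using odd_h by (rule odd_pos)
lemma f_pos: "f > 0" using odd_f by (rule odd_pos)

lemma not_p_dvd_2_power: "\<not> p dvd 2 ^ i"
proof
  assume "p dvd 2 ^ i"
  then have "p dvd 2" using prime_p prime_dvd_power by blast
  then show False using p_mod_8 by (auto dest: dvd_imp_le)
qed

lemma not_p_dvd_2 [simp]: "\<not> p dvd 2" using not_p_dvd_2_power[of 1] by simp

lemma two_power_h: "[2 ^ h = 1] (mod p)"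
  using ord_divides[of 2 h p] by (simp add: ord_2 h_def)

lemma two_power_f: "[2 ^ f = 1] (mod q)"
  using power_prime_power_cong_1[OF two_power_h, of "e - 1"] e_pos
  by (simp add: f_def m_def q_def power_mult)

lemma unit_cases:
  assumes "\<not> p dvd a"
  obtains i where "[a = 2 ^ i] (mod q)" | i where "[a = (q - 1) * 2 ^ i] (mod q)"
proof -
  have "p mod 4 = 3" using p_mod_8 by presburger
  then obtain i where i: "[int a = 2 ^ i] (mod int q) \<or> [int a = - (2 ^ i)] (mod int q)"
    using unit_cong_plus_minus_power_of_two[OF prime_p _ ord_2 e_pos not_Wieferich assms]
    unfolding q_def by blast
  then show ?thesis
  proof
    assume "[int a = 2 ^ i] (mod int q)"
    then have "[int a = int (2 ^ i)] (mod int q)" by simp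
    then show ?thesis using that(1) cong_int_iff by blast
  next
    assume *: "[int a = - (2 ^ i)] (mod int q)"
    have "[- (2 ^ i) = int ((q - 1) * 2 ^ i)] (mod int q)"
      using q_pos by (simp add: cong_iff_dvd_diff of_nat_diff algebra_simps)
    then have "[int a = int ((q - 1) * 2 ^ i)] (mod int q)" using * cong_trans by blast
    then show ?thesis using that(2) cong_int_iff by blast
  qed
qed

lemma gal_power_fixed:
  assumes "x \<in> Zz" "gal 2 x = x"
  shows "gal (2 ^ i) x = x"
proof (induction i)
  case 0
  then show ?case using assms by (simp add: gal_Suc_0)
next
  case (Suc i)
  have "gal (2 * 2 ^ i) x = gal 2 (gal (2 ^ i) x)"
    using assms(1) by (subst gal_gal) (auto simp: not_p_dvd_2_power)
  then show ?case using Suc assms by simp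
qed

lemma real_fixed_imp_int:
  assumes "x \<in> Zz" "gal 2 x = x" "cnj x = x"
  shows "x \<in> \<int>"
proof (rule gal_fixed_imp_int[OF assms(1)])
  fix a assume a: "\<not> p dvd a"
  then show "gal a x = x"
  proof (cases rule: unit_cases)
    case (1 i)
    then show ?thesis using gal_cong[OF a _ assms(1)] gal_power_fixed[OF assms(1,2)] by metis
  next
    case (2 i)
    have "gal a x = gal (q - 1) (gal (2 ^ i) x)"
      using gal_cong[OF a 2 assms(1)] gal_gal[OF not_p_dvd_q_minus_1 not_p_dvd_2_power assms(1)]
        by simp
    then show ?thesis using gal_power_fixed[OF assms(1,2)] gal_cnj_eq[OF assms(1)] assms(3) by simp
  qed
qed

text \<open>Gaussian periods of the \<open>p\<close>-th root of unity \<open>\<zeta> ^ m\<close> for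
  the subgroup generated by 2, which has index 2 in the units modulo \<open>p\<close>.\<close>

definition period :: "nat \<Rightarrow> complex" where
  "period a = (\<Sum>i<h. (\<zeta> ^ m) ^ (a * 2 ^ i))"

lemma zeta_m_cong: "[a = b] (mod p) \<Longrightarrow> (\<zeta> ^ m) ^ a = (\<zeta> ^ m) ^ b"
  unfolding power_mult[symmetric]
    by (rule zeta_power_cong) (simp add: q_eq cong_def mult.commute mult_mod_right flip: mult_mod_right)

lemma period_cong:
  assumes "[a = b] (mod p)"
  shows "period a = period b"
  unfolding period_def using assms by (intro sum.cong refl zeta_m_cong cong_mult) auto

lemma period_double: "period (2 * a) = period a"
proof -
  define g where "g i = (\<zeta> ^ m) ^ (a * 2 ^ i)" for i
  have "g h = g 0" unfolding g_def
    using two_power_h by (intro zeta_m_cong) (metis cong_scalar_left power_0)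
  have "period (2 * a) = (\<Sum>i<h. g (Suc i))" by (simp add: period_def g_def mult_ac)
  also have "\<dots> = (\<Sum>i<h. g i)"
    using sum.lessThan_Suc_shift[of g h] sum.lessThan_Suc[of g h] \<open>g h = g 0\<close> by simp
  finally show ?thesis by (simp add: period_def g_def)
qed

lemma period_power: "period (2 ^ i * a) = period a"
  by (induction i) (auto simp: mult.assoc period_double)

lemma period_cnj: "period ((q - 1) * a) = cnj (period a)"
proof -
  have "(\<zeta> ^ m) ^ ((q - 1) * a * 2 ^ i) = cnj ((\<zeta> ^ m) ^ (a * 2 ^ i))" for i
    by (simp add: cnj_zeta power_mult[symmetric] mult_ac)
  then show ?thesis by (simp add: period_def)
qed

lemma period_unit:
  assumes "\<not> p dvd a"
  shows "period a = period (Suc 0) \<or> period a = cnj (period (Suc 0))"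
  using assms
proof (cases rule: unit_cases)
  case (1 i)
  then have "[a = 2 ^ i * Suc 0] (mod p)" using cong_dvd_modulus_nat[OF 1, of p] by (simp add: q_eq)
  then show ?thesis using period_cong period_power by metis
next
  case (2 i)
  then have "[a = (q - 1) * (2 ^ i * Suc 0)] (mod p)"
    using cong_dvd_modulus_nat[OF 2, of p] by (simp add: q_eq)
  then show ?thesis using period_cong period_power period_cnj by metis
qed

lemma inj_on_zeta_m_power: "inj_on (\<lambda>j. (\<zeta> ^ m) ^ j) {..<p}"
proof (rule inj_onI)
  fix i j assume ij: "i \<in> {..<p}" "j \<in> {..<p}" "(\<zeta> ^ m) ^ i = (\<zeta> ^ m) ^ j"
  then have "\<zeta> ^ (m * i) = \<zeta> ^ (m * j)" by (simp add: power_mult)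
  moreover have "m * i < q" "m * j < q" using ij m_pos by (auto simp: q_eq)
  ultimately have "m * i = m * j" using inj_onD[OF inj_on_zeta_power] by blast
  then show "i = j" using m_pos by simp
qed

lemma zeta_m_power_p: "(\<zeta> ^ m) ^ p = 1"
  by (simp add: q_eq[symmetric] mult.commute flip: power_mult)

lemma inj_on_powers_of_two: "inj_on (\<lambda>i. 2 ^ i mod p) {..<h}"
proof -
  have False if ij: "i < j" "j < h" "2 ^ i mod p = 2 ^ j mod p" for i j
  proof -
    have "[2 ^ i * 1 = 2 ^ i * 2 ^ (j - i)] (mod p)"
      using ij by (simp add: cong_def flip: power_add)
    moreover have "coprime (2 ^ i) p" using odd_p by simp
    ultimately have "[2 ^ (j - i) = 1] (mod p)" by (metis cong_mult_lcancel_nat cong_sym)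
    then have "h dvd j - i" unfolding ord_divides ord_2 h_def .
    then show False using ij by (auto dest: dvd_imp_le)
  qed
  then show ?thesis unfolding inj_on_def by (metis lessThan_iff linorder_neqE_nat)
qed

lemma period_as_sum:
  "period a = (\<Sum>j<p. of_int (of_bool (j \<in> (\<lambda>i. 2 ^ i mod p) ` {..<h})) * ((\<zeta> ^ m) ^ a) ^ j)"
proof -
  let ?H = "(\<lambda>i. 2 ^ i mod p) ` {..<h}"
  have "(\<Sum>j<p. of_int (of_bool (j \<in> ?H)) * ((\<zeta> ^ m) ^ a) ^ j) = (\<Sum>j\<in>?H. ((\<zeta> ^ m) ^ a) ^ j)"
    using p_pos by (intro sum.mono_neutral_cong_right) auto
  also have "\<dots> = (\<Sum>i<h. ((\<zeta> ^ m) ^ a) ^ (2 ^ i mod p))"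
    using inj_on_powers_of_two by (simp add: sum.reindex)
  also have "\<dots> = period a" unfolding period_def
  proof (intro sum.cong refl)
    fix i
    show "((\<zeta> ^ m) ^ a) ^ (2 ^ i mod p) = (\<zeta> ^ m) ^ (a * 2 ^ i)"
      unfolding power_mult[symmetric, of "\<zeta> ^ m"]
        by (rule zeta_m_cong) (simp add: cong_def mod_mult_right_eq)
  qed
  finally show ?thesis by simp
qed

text \<open>Parseval for the indicator of the powers of 2 avoids evaluating a Gauss sum: the period
  at 0 is \<open>h\<close> and the other \<open>2 * h\<close> periods have equal modulus, so its
  square y satisfies h^2 + 2 h y = p h, that is y = (h + 1) / 2 = c.\<close>

lemma period_norm: "(cmod (period (Suc 0)))\<^sup>2 = real_of_int c"
proof -
  let ?H = "(\<lambda>i. 2 ^ i mod p) ` {..<h}"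
  have "(\<Sum>a<p. (cmod (period a))\<^sup>2) = real p * (\<Sum>j<p. (real_of_int (of_bool (j \<in> ?H)))\<^sup>2)"
    unfolding period_as_sum
    by (intro Parseval_roots_of_unity inj_on_zeta_m_power zeta_m_power_p) (simp add: norm_power cmod_zeta)
  also have "(\<Sum>j<p. (real_of_int (of_bool (j \<in> ?H)))\<^sup>2) = (\<Sum>j\<in>?H. 1)"
    using p_pos by (intro sum.mono_neutral_cong_right) auto
  also have "\<dots> = real h" using card_image[OF inj_on_powers_of_two] by simp
  also have "(\<Sum>a<p. (cmod (period a))\<^sup>2) = (cmod (period 0))\<^sup>2 + (\<Sum>a\<in>{..<p} - {0}. (cmod (period a))\<^sup>2)"
    using p_pos by (subst sum.remove[of _ 0]) auto
  also have "(\<Sum>a\<in>{..<p} - {0}. (cmod (period a))\<^sup>2) = (\<Sum>a\<in>{..<p} - {0}. (cmod (period (Suc 0)))\<^sup>2)"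
  proof (intro sum.cong refl)
    fix a assume "a \<in> {..<p} - {0}"
    then have "\<not> p dvd a" by (auto dest: dvd_imp_le)
    then show "(cmod (period a))\<^sup>2 = (cmod (period (Suc 0)))\<^sup>2"
      using period_unit by (metis complex_mod_cnj)
  qed
  finally have "(real h)\<^sup>2 + real (p - 1) * (cmod (period (Suc 0)))\<^sup>2 = real p * real h"
    using p_pos by (simp add: period_def)
  then have "real h * (real h + 2 * (cmod (period (Suc 0)))\<^sup>2) = real h * (2 * real h + 1)"
    by (simp add: real_p real_p' algebra_simps power2_eq_square)
  then have "2 * (cmod (period (Suc 0)))\<^sup>2 = real h + 1" using h_pos by simp
  moreover have "4 * real_of_int c = real p + 1"
    using c by (metis of_int_1 of_int_add of_int_mult of_int_numeral of_int_of_nat_eq)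
  ultimately show ?thesis by (simp add: real_p)
qed

text \<open>The periods over all residues add up to 0; the one at 0 is \<open>h\<close>, and the
  other \<open>2 * h\<close>, equal up to conjugation, share their real part.\<close>

lemma period_Re: "Re (period (Suc 0)) = - 1 / 2"
proof -
  have "(\<Sum>a<p. period a) = (\<Sum>i<h. \<Sum>a<p. ((\<zeta> ^ m) ^ (2 ^ i)) ^ a)"
    unfolding period_def by (subst sum.swap) (simp add: mult_ac flip: power_mult)
  also have "\<dots> = (\<Sum>i<h. 0)"
  proof (intro sum.cong refl)
    fix i
    have "((\<zeta> ^ m) ^ 2 ^ i) ^ p = ((\<zeta> ^ m) ^ p) ^ 2 ^ i"
      by (simp add: mult_ac flip: power_mult)
    then have "((\<zeta> ^ m) ^ 2 ^ i) ^ p = 1" by (simp add: zeta_m_power_p)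
    moreover have "(\<zeta> ^ m) ^ 2 ^ i \<noteq> 1"
      using not_p_dvd_2_power[of i] m_pos by (simp add: zeta_power_eq_1_iff q_eq flip: power_mult)
    ultimately show "(\<Sum>a<p. ((\<zeta> ^ m) ^ 2 ^ i) ^ a) = 0"
      by (simp add: sum_powers_root_of_unity)
  qed
  finally have "0 = (\<Sum>a<p. Re (period a))" by (simp flip: Re_sum)
  also have "\<dots> = Re (period 0) + (\<Sum>a\<in>{..<p} - {0}. Re (period a))"
    using p_pos by (subst sum.remove[of _ 0]) auto
  also have "(\<Sum>a\<in>{..<p} - {0}. Re (period a)) = (\<Sum>a\<in>{..<p} - {0}. Re (period (Suc 0)))"
  proof (intro sum.cong refl)
    fix a assume "a \<in> {..<p} - {0}"
    then have "\<not> p dvd a" by (auto dest: dvd_imp_le)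
    then show "Re (period a) = Re (period (Suc 0))"
      using period_unit by (metis complex_cnj(1) cnj.simps(1))
  qed
  finally have "real h * (1 + 2 * Re (period (Suc 0))) = 0"
    using p_pos by (simp add: period_def[of 0] real_p' algebra_simps)
  then show ?thesis using h_pos by simp
qed

definition \<theta> where "\<theta> = - period (Suc 0)"

lemma theta_in_Zz [simp]: "\<theta> \<in> Zz"
  by (simp add: \<theta>_def period_def)

lemma gal_theta: "gal 2 \<theta> = \<theta>"
proof -
  have "gal 2 ((\<zeta> ^ m) ^ (Suc 0 * 2 ^ i)) = (\<zeta> ^ m) ^ (2 * 2 ^ i)" for i
    using gal_zeta_power[OF not_p_dvd_2, of "m * 2 ^ i"] by (simp add: mult_ac flip: power_mult)
  then have "gal 2 (period (Suc 0)) = period (2 * Suc 0)"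
    unfolding period_def by (subst gal_sum) simp_all
  then show ?thesis
    unfolding \<theta>_def period_double by (subst gal_minus) (simp_all add: period_def)
qed

sublocale quad p c \<theta>
proof
  show "prime p" "p mod 8 = 7" "4 * c = int p + 1" by (fact prime_p p_mod_8 c)+
  show "\<theta> + cnj \<theta> = 1"
    by (simp add: complex_eq_iff \<theta>_def period_Re del: One_nat_def)
  have "\<theta> * cnj \<theta> = of_real ((cmod \<theta>)\<^sup>2)"
    by (simp only: complex_norm_square)
  also have "(cmod \<theta>)\<^sup>2 = real_of_int c" by (simp add: \<theta>_def period_norm)
  finally show "\<theta> * cnj \<theta> = of_int c" by simp
qed

text \<open>Trace, norm and \<open>(x - cnj x) * (\<theta> - cnj \<theta>)\<close> are invariant
  under \<open>gal 2\<close> and conjugation, hence integers. The square of the last is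
  \<open>p * (4 * N - A\<^sup>2)\<close>, so it is divisible by \<open>p\<close>, which removes the
  denominator from the imaginary part.\<close>

lemma fixed_imp_qints:
  assumes "x \<in> Zz" "gal 2 x = x"
  shows "x \<in> qints"
proof -
  note G = gal_add[OF not_p_dvd_2] gal_mult[OF not_p_dvd_2] gal_diff[OF not_p_dvd_2] gal_cnj[OF not_p_dvd_2]
  have "x + cnj x \<in> \<int>"
    using assms by (intro real_fixed_imp_int) (simp_all add: G add.commute)
  then obtain A where A: "x + cnj x = of_int A" by (auto elim: Ints_cases)
  have "x * cnj x \<in> \<int>"
    using assms by (intro real_fixed_imp_int) (simp_all add: G mult.commute)
  then obtain N where N: "x * cnj x = of_int N" by (auto elim: Ints_cases)
  have "(x - cnj x) * (\<theta> - cnj \<theta>) \<in> \<int>"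
    using assms by (intro real_fixed_imp_int) (simp_all add: G gal_theta algebra_simps)
  then obtain B where B: "(x - cnj x) * (\<theta> - cnj \<theta>) = of_int B"
    by (auto elim: Ints_cases)
  have ReA: "Re x = real_of_int A / 2" using arg_cong[OF A, of Re] by simp
  have "complex_of_real ((cmod x)\<^sup>2) = complex_of_real (of_int N)"
    using N by (simp only: complex_norm_square) simp
  then have normN: "(cmod x)\<^sup>2 = real_of_int N" by (simp only: of_real_eq_iff)
  have ImB: "- 4 * Im x * Im \<theta> = real_of_int B" using arg_cong[OF B, of Re] by simp
  then have "(real_of_int B)\<^sup>2 = 16 * (Im x)\<^sup>2 * (Im \<theta>)\<^sup>2"
    by (simp add: power_mult_distrib flip: ImB)
  also have "\<dots> = real p * (4 * (cmod x)\<^sup>2 - 4 * (Re x)\<^sup>2)"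
    by (simp add: Im_theta_sq cmod_power2)
  also have "\<dots> = real p * (4 * real_of_int N - (real_of_int A)\<^sup>2)"
    by (simp add: normN ReA power_divide)
  finally have "real_of_int (B\<^sup>2) = real_of_int (int p * (4 * N - A\<^sup>2))" by simp
  then have "B\<^sup>2 = int p * (4 * N - A\<^sup>2)" by (simp only: of_int_eq_iff)
  then have "int p dvd B"
    using prime_p by (metis dvd_triv_left prime_dvd_power prime_nat_int_transfer)
  then obtain b where b: "B = int p * b" by (auto elim: dvdE)
  have "- 4 * Im x * (Im \<theta>)\<^sup>2 = real p * real_of_int b * Im \<theta>"
    using arg_cong[OF ImB, of "\<lambda>y. y * Im \<theta>"]
      by (simp add: b power2_eq_square mult_ac)
  then have "real p * Im x = real p * (- real_of_int b * Im \<theta>)"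
    by (simp add: Im_theta_sq algebra_simps)
  then have Im: "Im x = - real_of_int b * Im \<theta>" using p_pos by (simp only: mult_left_cancel)
  from Im_theta show ?thesis
  proof
    assume "Im \<theta> = sqrt p / 2"
    then show ?thesis using ReA normN Im by (intro qintsI_half_trace[of x A "- b" N]) simp_all
  next
    assume "Im \<theta> = - sqrt p / 2"
    then show ?thesis using ReA normN Im by (intro qintsI_half_trace[of x A b N]) simp_all
  qed
qed

end

section \<open>Generalized bent functions\<close>

lemma finite_cube: "finite (cube n)" and card_cube: "card (cube n) = 2 ^ n"
proof -
  have eq: "cube n = (\<lambda>A i. i \<in> A) ` Pow {..<n}"
  proof
    show "cube n \<subseteq> (\<lambda>A i. i \<in> A) ` Pow {..<n}"
    proof
      fix x assume "x \<in> cube n"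
      then have "x = (\<lambda>i. i \<in> {i. x i})" "{i. x i} \<in> Pow {..<n}"
        by (auto simp: cube_def not_le[symmetric])
      then show "x \<in> (\<lambda>A i. i \<in> A) ` Pow {..<n}" by blast
    qed
  qed (auto simp: cube_def)
  have "inj_on (\<lambda>A i. i \<in> A) (Pow {..<n})" by (auto simp: inj_on_def fun_eq_iff)
  then show "finite (cube n)" "card (cube n) = 2 ^ n"
    by (auto simp: eq card_image card_Pow)
qed

lemma dotp_flip:
  assumes "i < n" "x i"
  shows "(-1 :: 'a :: ring_1) ^ dotp n x (l(i := \<not> l i)) = - ((-1) ^ dotp n x l)"
proof -
  define A where "A = {j. j < n \<and> j \<noteq> i \<and> x j \<and> l j}"
  have fin: "finite A" "i \<notin> A" by (auto simp: A_def)
  have "{j. j < n \<and> x j \<and> l j} = (if l i then insert i A else A)"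
    "{j. j < n \<and> x j \<and> (l(i := \<not> l i)) j} = (if l i then A else insert i A)"
    using assms by (auto simp: A_def)
  then show ?thesis using fin by (simp add: dotp_def)
qed

lemma sum_cube_character:
  assumes "x \<in> cube n"
  shows "(\<Sum>l\<in>cube n. (-1 :: complex) ^ dotp n x l) = (if x = (\<lambda>_. False) then 2 ^ n else 0)"
proof (cases "x = (\<lambda>_. False)")
  case True
  then show ?thesis by (simp add: dotp_def card_cube)
next
  case False
  then obtain i where "x i" by auto
  then have i: "i < n" "x i" using assms by (auto simp: cube_def not_le[symmetric])
  define \<phi> where "\<phi> l = l(i := \<not> l i)" for l :: "nat \<Rightarrow> bool"
  have "(\<Sum>l\<in>cube n. (-1 :: complex) ^ dotp n x l) = (\<Sum>l\<in>cube n. (-1) ^ dotp n x (\<phi> l))"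
    using i by (intro sum.reindex_bij_witness[of _ \<phi> \<phi>]) (auto simp: \<phi>_def cube_def)
  also have "\<dots> = - (\<Sum>l\<in>cube n. (-1) ^ dotp n x l)"
    using dotp_flip[of i n x, OF i, where 'a = complex] by (simp add: \<phi>_def sum_negf)
  finally show ?thesis using False by (simp add: eq_neg_iff_add_eq_0)
qed

section \<open>Congruences modulo powers of 2, written as membership of a difference in
  \<open>D k\<close>\<close>

context cyclotomic_7
begin

definition D :: "nat \<Rightarrow> complex set" where "D k = (\<lambda>z. 2 ^ k * z) ` Zz"

lemma DI: "z \<in> Zz \<Longrightarrow> 2 ^ k * z \<in> D k" by (simp add: D_def)
lemma D_0: "0 \<in> D k" using DI[of 0 k] by simp
lemma D_add: "x \<in> D k \<Longrightarrow> y \<in> D k \<Longrightarrow> x + y \<in> D k"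
  by (auto simp: D_def distrib_left[symmetric])
lemma D_mult: "x \<in> D k \<Longrightarrow> y \<in> Zz \<Longrightarrow> x * y \<in> D k"
  by (auto simp: D_def mult.assoc)
lemma D_mult_left: "x \<in> D k \<Longrightarrow> y \<in> Zz \<Longrightarrow> y * x \<in> D k"
  using D_mult[of x k y] by (simp add: mult.commute)
lemma D_minus: "x \<in> D k \<Longrightarrow> - x \<in> D k"
  using D_mult[of x k "-1"] by simp
lemma D_diff: "x \<in> D k \<Longrightarrow> y \<in> D k \<Longrightarrow> x - y \<in> D k"
  using D_add[of x k "- y"] D_minus[of y k] by simp
lemma D_trans: "x - y \<in> D k \<Longrightarrow> y - z \<in> D k \<Longrightarrow> x - z \<in> D k"
  using D_add[of "x - y" k "y - z"] by simp
lemma D_sym: "x - y \<in> D k \<Longrightarrow> y - x \<in> D k"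
  using D_minus[of "x - y" k] by simp
lemma D_sum: "(\<And>i. i \<in> A \<Longrightarrow> g i \<in> D k) \<Longrightarrow> sum g A \<in> D k"
  by (induction A rule: infinite_finite_induct) (auto simp: D_0 D_add)
lemma D_mono: "x \<in> D k \<Longrightarrow> j \<le> k \<Longrightarrow> x \<in> D j"
proof -
  assume "x \<in> D k" "j \<le> k"
  then obtain z where "z \<in> Zz" "x = 2 ^ j * (2 ^ (k - j) * z)"
    by (auto simp: D_def mult.assoc[symmetric] simp flip: power_add)
  then show "x \<in> D j" using DI[of "2 ^ (k - j) * z" j] by simp
qed
lemma D_cnj: "x \<in> D k \<Longrightarrow> cnj x \<in> D k"
  using DI[of "cnj _" k] by (auto simp: D_def)
lemma D_gal: "x \<in> D k \<Longrightarrow> gal 2 x \<in> D k"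
  by (auto simp: D_def gal_mult[OF not_p_dvd_2] gal_power[OF not_p_dvd_2] gal_numeral[OF not_p_dvd_2] intro!: gal_in_Zz[OF not_p_dvd_2])
lemma D_power_diff:
  assumes "x - y \<in> D k" "x \<in> Zz" "y \<in> Zz"
  shows "x ^ n - y ^ n \<in> D k"
proof (induction n)
  case (Suc n)
  have "x ^ Suc n - y ^ Suc n = x * (x ^ n - y ^ n) + (x - y) * y ^ n" by (simp add: algebra_simps)
  also have "\<dots> \<in> D k"
    using Suc assms by (intro D_add D_mult_left[of "x ^ n - y ^ n"] D_mult[of "x - y"]) auto
  finally show ?case .
qed (simp add: D_0)

lemma int_in_D_iff: "of_int b \<in> D k \<Longrightarrow> 2 ^ k dvd b"
  using Zz_rational_multiple[of _ b "2 ^ k"] by (auto simp: D_def)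

lemma one_notin_D: "1 \<notin> D 1"
  using int_in_D_iff[of 1 1] by auto

lemma gal_in [simp]: "x \<in> Zz \<Longrightarrow> gal 2 x \<in> Zz"
  by (rule gal_in_Zz[OF not_p_dvd_2])

lemma gal_power_Suc: "x \<in> Zz \<Longrightarrow> gal (2 ^ Suc i) x = gal 2 (gal (2 ^ i) x)"
  by (subst gal_gal) (auto simp: not_p_dvd_2_power)

lemma gal_power_in [simp]: "x \<in> Zz \<Longrightarrow> gal (2 ^ i) x \<in> Zz"
  by (rule gal_in_Zz[OF not_p_dvd_2_power])

lemma gal_2_cong_square: "x \<in> Zz \<Longrightarrow> gal 2 x - x\<^sup>2 \<in> D 1"
proof -
  assume x: "x \<in> Zz"
  then obtain y where "y \<in> Zz" "x\<^sup>2 = gal 2 x + 2 * y" by (rule gal_2_Frobenius[OF odd_p])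
  then show ?thesis using DI[of "- y" 1] by simp
qed

lemma gal_cong_power: "x \<in> Zz \<Longrightarrow> gal (2 ^ i) x - x ^ (2 ^ i) \<in> D 1"
proof (induction i)
  case 0
  then show ?case by (simp add: gal_Suc_0 D_0)
next
  case (Suc i)
  have "gal 2 (gal (2 ^ i) x) - (gal (2 ^ i) x)\<^sup>2 \<in> D 1"
    using Suc.prems by (intro gal_2_cong_square) simp
  moreover have "(gal (2 ^ i) x)\<^sup>2 - (x ^ (2 ^ i))\<^sup>2 \<in> D 1"
    using Suc by (intro D_power_diff) auto
  ultimately have "gal 2 (gal (2 ^ i) x) - (x ^ (2 ^ i))\<^sup>2 \<in> D 1" by (rule D_trans)
  moreover have "(x ^ (2 ^ i))\<^sup>2 = x ^ (2 ^ Suc i)"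
    by (simp add: mult.commute flip: power_mult)
  ultimately show ?case using gal_power_Suc[OF Suc.prems, of i] by simp
qed

lemma gal_power_f: "x \<in> Zz \<Longrightarrow> gal (2 ^ f) x = x"
  using gal_cong[OF not_p_dvd_2_power two_power_f] gal_Suc_0 by simp

lemma power_f_cong: "x \<in> Zz \<Longrightarrow> x ^ (2 ^ f) - x \<in> D 1"
  using gal_cong_power[of x f] gal_power_f[of x] D_sym by metis

text \<open>The order of the unit group of the residue field at each prime above 2.\<close>

definition M :: nat where "M = 2 ^ f - 1"

lemma M_pos: "M > 0" and Suc_M: "Suc M = 2 ^ f"
proof -
  have "(2::nat) ^ 1 \<le> 2 ^ f" using f_pos by (intro power_increasing) auto
  then show "M > 0" "Suc M = 2 ^ f" by (auto simp: M_def)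
qed

definition tr :: "complex \<Rightarrow> complex" where "tr x = (\<Sum>i<f. gal (2 ^ i) x)"

lemma tr_in_qints:
  assumes "x \<in> Zz"
  shows "tr x \<in> qints"
proof (rule fixed_imp_qints)
  show "tr x \<in> Zz" using assms by (simp add: tr_def)
  have "gal 2 (tr x) = (\<Sum>i<f. gal (2 ^ Suc i) x)"
    unfolding tr_def
      using assms by (subst gal_sum[OF not_p_dvd_2]) (simp_all only: gal_power_in gal_power_Suc)
  also have "\<dots> = tr x"
    using sum.lessThan_Suc_shift[of "\<lambda>i. gal (2 ^ i) x" f] sum.lessThan_Suc[of "\<lambda>i. gal (2 ^ i) x" f]
      gal_power_f[OF assms] gal_Suc_0[OF assms] by (simp add: tr_def)
  finally show "gal 2 (tr x) = tr x" .
qed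

text \<open>The trace to the quadratic field has odd degree \<open>f\<close>, so modulo 2 it is the identity on
  idempotents; hence \<open>x ^ M\<close> is one of the four idempotents 0, 1, \<open>\<theta>\<close>, \<open>cnj \<theta>\<close> modulo 2.\<close>

lemma power_M_cong:
  assumes x: "x \<in> Zz"
  obtains y where "y \<in> {0, 1, \<theta>, cnj \<theta>}" "x ^ M - y \<in> D 1"
proof -
  define i where "i = x ^ M"
  have i: "i \<in> Zz" using x by (simp add: i_def)
  have M: "x ^ M = x * x ^ (M - 1)" using M_pos by (cases M) auto
  have "i\<^sup>2 - i = (x ^ (2 ^ f) - x) * x ^ (M - 1)"
    by (simp add: i_def power2_eq_square algebra_simps M flip: Suc_M)
  then have idem: "i\<^sup>2 - i \<in> D 1" using power_f_cong[OF x] x by (simp add: D_mult)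
  have pow: "i ^ (2 ^ j) - i \<in> D 1" for j
  proof (induction j)
    case (Suc j)
    have "(i ^ (2 ^ j))\<^sup>2 - i\<^sup>2 \<in> D 1" using Suc i by (intro D_power_diff) auto
    then have "(i ^ (2 ^ j))\<^sup>2 - i \<in> D 1" using idem by (rule D_trans)
    then show ?case by (simp add: mult.commute flip: power_mult)
  qed (simp add: D_0)
  \<comment> \<open>Each \<open>gal (2 ^ j) i\<close> is congruent to \<open>i ^ (2 ^ j)\<close>,
    hence to the idempotent \<open>i\<close>; so the trace is congruent to \<open>f * i\<close>, and
    \<open>f\<close> is odd.\<close>
  have "gal (2 ^ j) i - i \<in> D 1" for j using gal_cong_power[OF i] pow by (rule D_trans)
  then have "(\<Sum>j<f. gal (2 ^ j) i - i) \<in> D 1" by (intro D_sum)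
  then have "tr i - of_nat f * i \<in> D 1" by (simp add: tr_def sum_subtractf)
  moreover have "of_nat f * i - i \<in> D 1"
  proof -
    obtain g where "f = 2 * g + 1" using odd_f by (auto elim: oddE)
    then have "of_nat f * i - i = 2 ^ 1 * (of_nat g * i)" by (simp add: algebra_simps)
    then show ?thesis using i by (simp only: DI Zz_mult Zz_of_nat)
  qed
  ultimately have tr: "tr i - i \<in> D 1" by (rule D_trans)
  obtain u v where uv: "tr i = qint u v" using tr_in_qints[OF i] by (rule qintsE)
  have red: "qint u v - qint (u mod 2) (v mod 2) \<in> D 1"
  proof -
    have "u = 2 * (u div 2) + u mod 2" "v = 2 * (v div 2) + v mod 2" by simp_all
    then have "complex_of_int u = 2 * of_int (u div 2) + of_int (u mod 2)"
      "complex_of_int v = 2 * of_int (v div 2) + of_int (v mod 2)"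
        by (metis of_int_add of_int_mult of_int_numeral)+
    then have "qint u v - qint (u mod 2) (v mod 2) = 2 ^ 1 * (of_int (u div 2) + of_int (v div 2) * \<theta>)"
      unfolding qint_def by (simp add: algebra_simps)
    then show ?thesis by (simp only: DI Zz_add Zz_mult Zz_of_int theta_in_Zz)
  qed
  then have *: "i - qint (u mod 2) (v mod 2) \<in> D 1" using D_trans[OF D_sym[OF tr]] uv by simp
  have cases: "u mod 2 = 0 \<or> u mod 2 = 1" "v mod 2 = 0 \<or> v mod 2 = 1" by presburger+
  then consider "qint (u mod 2) (v mod 2) = 0" | "qint (u mod 2) (v mod 2) = 1"
    | "qint (u mod 2) (v mod 2) = \<theta>" | "qint (u mod 2) (v mod 2) = 1 + \<theta>"
    by (auto simp: qint_def)
  then show thesis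
  proof cases
    case 4
    have "(1 + \<theta>) - cnj \<theta> = 2 ^ 1 * \<theta>" by (simp add: cnj_theta)
    then have "(1 + \<theta>) - cnj \<theta> \<in> D 1" by (simp only: DI theta_in_Zz)
    then have "i - cnj \<theta> \<in> D 1" using * 4 D_trans by metis
    then show thesis using that[of "cnj \<theta>"] by (simp add: i_def)
  qed (use * that[of 0] that[of 1] that[of \<theta>] in \<open>auto simp: i_def\<close>)
qed

text \<open>The value 0 would make \<open>W\<close> divisible by 2, and the value 1 would make
  \<open>W\<close> and its conjugate invertible modulo 2 although their product is
  \<open>2 ^ k\<close>. The remaining \<tau> records which prime above 2 divides
  \<open>W\<close>.\<close>

lemma primitive_power_M_cong:
  assumes W: "W \<in> Zz" "W \<notin> D 1" "W * cnj W = 2 ^ k" "k > 0"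
  obtains \<tau> where "\<tau> \<in> {\<theta>, cnj \<theta>}" "W ^ M - \<tau> \<in> D 1"
proof -
  obtain y where y: "y \<in> {0, 1, \<theta>, cnj \<theta>}" "W ^ M - y \<in> D 1"
    using power_M_cong[OF W(1)] .
  have "y \<noteq> 0"
  proof
    assume "y = 0"
    then have "W ^ M * W \<in> D 1" using y W(1) by (simp add: D_mult)
    then have "W ^ (2 ^ f) \<in> D 1" by (simp add: mult.commute flip: Suc_M)
    then have "W \<in> D 1" using D_diff[OF _ power_f_cong[OF W(1)]] by fastforce
    then show False using W(2) by simp
  qed
  moreover have "y \<noteq> 1"
  proof
    assume "y = 1"
    then have 1: "W ^ M - 1 \<in> D 1" using y by simp
    then have 2: "cnj W ^ M - 1 \<in> D 1" using D_cnj[OF 1] by simp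
    have "(W * cnj W) ^ M - 1 = (W ^ M - 1) * cnj W ^ M + (cnj W ^ M - 1)"
      by (simp add: power_mult_distrib algebra_simps)
    also have "\<dots> \<in> D 1" using 1 2 W(1) by (intro D_add D_mult) auto
    finally have "(W * cnj W) ^ M - 1 \<in> D 1" .
    then have "2 ^ (k * M) - 1 \<in> D 1" by (simp add: W(3) power_mult)
    moreover have "2 ^ (k * M) \<in> D 1"
      using D_mono[OF DI[OF Zz_1, of "k * M"], of 1] W(4) M_pos by simp
    ultimately have "2 ^ (k * M) - (2 ^ (k * M) - 1) \<in> D 1" by (rule D_diff[rotated])
    then show False using one_notin_D by simp
  qed
  ultimately show thesis using that y by blast
qed

lemma power_two_power_cong_1:
  assumes "y - 1 \<in> D 1"
  shows "y ^ (2 ^ j) - 1 \<in> D (Suc j)"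
proof (induction j)
  case 0
  then show ?case using assms by simp
next
  case (Suc j)
  then obtain z where z: "z \<in> Zz" "y ^ (2 ^ j) - 1 = 2 ^ Suc j * z" by (auto simp: D_def)
  have "y ^ (2 ^ Suc j) - 1 = (y ^ (2 ^ j) - 1) * (y ^ (2 ^ j) - 1 + 2)"
    by (simp add: algebra_simps power2_eq_square flip: power_add mult_2)
  also have "\<dots> = 2 ^ Suc (Suc j) * (z * (2 ^ j * z + 1))"
    unfolding z(2) by (simp add: algebra_simps)
  finally show ?case using z(1) by (simp only: DI Zz_mult Zz_add Zz_power Zz_numeral Zz_1)
qed

lemma tau_simps:
  assumes "\<tau> \<in> {\<theta>, cnj \<theta>}"
  shows "\<tau> \<in> Zz" "\<tau> + cnj \<tau> = 1" "\<tau> * cnj \<tau> = of_int c" "gal 2 \<tau> = \<tau>"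
  using assms theta_add theta_mult gal_theta gal_cnj[OF not_p_dvd_2 theta_in_Zz]
  by (auto simp: add.commute mult.commute)

text \<open>In terms of ideals: \<open>W\<close> is divisible by the \<open>k\<close>-th power of
  the prime containing \<tau>. The element \<open>y = cnj W ^ M + \<tau>\<close> is 1 modulo 2, as
  \<open>cnj \<tau> = 1 - \<tau>\<close>, so \<open>y ^ (2 ^ k)\<close> is 1 modulo
  \<open>2 ^ k\<close>; it is also \<open>\<tau> ^ (2 ^ k)\<close> modulo \<open>cnj W\<close>.
  Multiplication by \<open>W\<close> turns the second modulus into \<open>2 ^ k\<close>.\<close>

lemma primitive_cong_tau_power:
  assumes W: "W \<in> Zz" "W * cnj W = 2 ^ k" and \<tau>: "\<tau> \<in> {\<theta>, cnj \<theta>}" "W ^ M - \<tau> \<in> D 1"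
  shows "W - \<tau> ^ (2 ^ k) * W \<in> D k"
proof -
  note t = tau_simps[OF \<tau>(1)]
  define y where "y = cnj W ^ M + \<tau>"
  have "cnj (W ^ M - \<tau>) \<in> D 1" using \<tau>(2) by (rule D_cnj)
  moreover have "cnj (W ^ M - \<tau>) = y - 1" using t(2) by (simp add: y_def algebra_simps)
  ultimately have "y - 1 \<in> D 1" by simp
  then have "y ^ (2 ^ k) - 1 \<in> D (Suc k)" by (rule power_two_power_cong_1)
  then have y1: "1 - y ^ (2 ^ k) \<in> D k" using D_sym D_mono by (meson le_SucI order_refl)
  define A where "A = (\<Sum>i<2 ^ k. \<tau> ^ (2 ^ k - Suc i) * y ^ i)"
  have yZ: "y \<in> Zz" using W t by (simp add: y_def)
  have A: "A \<in> Zz" using yZ t by (simp add: A_def)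
  have "y ^ (2 ^ k) - \<tau> ^ (2 ^ k) = (y - \<tau>) * A"
    unfolding A_def by (rule power_diff_sumr2)
  also have "y - \<tau> = cnj W * cnj W ^ (M - 1)" using M_pos by (cases M) (auto simp: y_def)
  finally have eq: "y ^ (2 ^ k) = \<tau> ^ (2 ^ k) + cnj W * (cnj W ^ (M - 1) * A)"
    by (simp add: algebra_simps)
  have "W - \<tau> ^ (2 ^ k) * W = (1 - y ^ (2 ^ k)) * W + (W * cnj W) * (cnj W ^ (M - 1) * A)"
    unfolding eq by (simp add: algebra_simps)
  also have "\<dots> = (1 - y ^ (2 ^ k)) * W + 2 ^ k * (cnj W ^ (M - 1) * A)" unfolding W(2) ..
  also have "\<dots> \<in> D k" using y1 W(1) A by (intro D_add D_mult DI) auto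
  finally show ?thesis .
qed

text \<open>The congruences for \<open>W1\<close> and for the conjugate of \<open>W2\<close> reduce
  \<open>W1 * cnj W2\<close> modulo \<open>2 ^ k\<close> to a multiple of
  \<open>c ^ (2 ^ k)\<close>, which vanishes as \<open>c\<close> is even. So \<open>W1 / W2\<close>
  is an element of the ring with absolute value 1, and Kronecker's theorem applies.\<close>

lemma associated_up_to_root_of_unity:
  assumes W1: "W1 \<in> Zz" "W1 * cnj W1 = 2 ^ k" "W1 ^ M - \<tau> \<in> D 1"
    and W2: "W2 \<in> Zz" "W2 * cnj W2 = 2 ^ k" "W2 ^ M - \<tau> \<in> D 1" and \<tau>: "\<tau> \<in> {\<theta>, cnj \<theta>}"
  obtains s j where "s = 1 \<or> s = -1" "W1 = of_int s * \<zeta> ^ j * W2"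
proof -
  note t = tau_simps[OF \<tau>]
  let ?N = "2 ^ k :: nat"
  have 1: "W1 - \<tau> ^ ?N * W1 \<in> D k"
    using primitive_cong_tau_power[OF W1(1,2) \<tau> W1(3)] .
  have "cnj (W2 - \<tau> ^ ?N * W2) \<in> D k"
    using D_cnj[OF primitive_cong_tau_power[OF W2(1,2) \<tau> W2(3)]] .
  then have 2: "cnj W2 - cnj \<tau> ^ ?N * cnj W2 \<in> D k" by simp
  have eq: "W1 * cnj W2 = (W1 - \<tau> ^ ?N * W1) * cnj W2 + \<tau> ^ ?N * W1 * (cnj W2 - cnj \<tau> ^ ?N * cnj W2)
      + (\<tau> * cnj \<tau>) ^ ?N * (W1 * cnj W2)"
    by (simp add: algebra_simps power_mult_distrib)
  have cN: "(\<tau> * cnj \<tau>) ^ ?N \<in> D k"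
  proof -
    obtain g where "c = 2 * g" using c_props(1) by (auto elim: evenE)
    then have "(\<tau> * cnj \<tau>) ^ ?N = 2 ^ ?N * of_int (g ^ ?N)"
      by (simp add: t(3) power_mult_distrib)
    also have "\<dots> \<in> D ?N" by (intro DI Zz_of_int)
    finally show ?thesis by (rule D_mono) (simp add: less_imp_le less_exp)
  qed
  have "(W1 - \<tau> ^ ?N * W1) * cnj W2 \<in> D k" using 1 W2(1) by (intro D_mult) auto
  moreover have "\<tau> ^ ?N * W1 * (cnj W2 - cnj \<tau> ^ ?N * cnj W2) \<in> D k"
    using 2 W1(1) t(1) by (intro D_mult_left) auto
  moreover have "(\<tau> * cnj \<tau>) ^ ?N * (W1 * cnj W2) \<in> D k"
    using cN W1(1) W2(1) by (intro D_mult) auto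
  ultimately have "W1 * cnj W2 \<in> D k" by (subst eq) (intro D_add)
  then obtain v where v: "v \<in> Zz" "W1 * cnj W2 = 2 ^ k * v" by (auto simp: D_def)
  have "2 ^ k * W1 = W1 * cnj W2 * W2" using W2(2) by (simp add: mult_ac)
  also have "\<dots> = 2 ^ k * (v * W2)" by (simp add: v(2))
  finally have W1_eq: "W1 = v * W2" by simp
  have "complex_of_real ((cmod W1)\<^sup>2) = complex_of_real ((cmod W2)\<^sup>2)"
    by (simp only: complex_norm_square W1(2) W2(2))
  then have "cmod W1 = cmod W2" by (simp only: of_real_eq_iff) (simp add: power2_eq_iff_nonneg)
  moreover have "W2 \<noteq> 0" using W2(2) by auto
  ultimately have "cmod v = 1" using W1_eq by (simp add: norm_mult)
  then obtain j s where "v = of_int s * \<zeta> ^ j" "s = 1 \<or> s = -1"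
    using unit_modulus_imp_root_of_unity[OF v(1)] by blast
  then show thesis using that W1_eq by blast
qed

lemma primitive_element_gives_primitive_norm:
  assumes W: "W \<in> Zz" "W \<notin> D 1" "W * cnj W = 2 ^ k" "k > 0"
  shows "\<exists>u v. qnorm c u v = 2 ^ k \<and> (odd u \<or> odd v)"
proof -
  note G = gal_mult[OF not_p_dvd_2] gal_diff[OF not_p_dvd_2] gal_cnj[OF not_p_dvd_2]
    gal_power[OF not_p_dvd_2] gal_numeral[OF not_p_dvd_2] gal_zeta_power[OF not_p_dvd_2] gal_of_int[OF not_p_dvd_2]
  obtain \<tau> where \<tau>: "\<tau> \<in> {\<theta>, cnj \<theta>}" "W ^ M - \<tau> \<in> D 1"
    using primitive_power_M_cong[OF W] .
  note t = tau_simps[OF \<tau>(1)]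
  have "gal 2 (W * cnj W) = 2 ^ k" by (simp add: W(3) G)
  then have sW: "gal 2 W * cnj (gal 2 W) = 2 ^ k" using W(1) by (simp add: G)
  have "gal 2 (W ^ M - \<tau>) \<in> D 1" using \<tau>(2) by (rule D_gal)
  then have sWM: "gal 2 W ^ M - \<tau> \<in> D 1" using W(1) t by (simp add: G)
  obtain s j where s: "s = 1 \<or> s = -1" "gal 2 W = of_int s * \<zeta> ^ j * W"
    using associated_up_to_root_of_unity[OF _ sW sWM W(1,3) \<tau>(2,1)] W(1) by auto
  \<comment> \<open>\<open>\<zeta> ^ i\<close> is the inverse of \<open>\<zeta> ^ j\<close>. As
    \<open>gal 2\<close> squares it, the surplus factor \<open>\<zeta> ^ i\<close> cancels
    \<open>\<zeta> ^ j\<close> and only the sign survives.\<close>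
  define i where "i = (q - 1) * j"
  have ij: "i + j = q * j" using q_pos by (simp add: i_def algebra_simps)
  define V where "V = \<zeta> ^ i * W"
  have V: "V \<in> Zz" using W(1) by (simp add: V_def)
  have V0: "V \<noteq> 0" using W(3) by (auto simp: V_def)
  have "gal 2 V = \<zeta> ^ (2 * i) * (of_int s * \<zeta> ^ j * W)"
    using W(1) s(2) by (simp add: V_def G)
  also have "\<dots> = of_int s * \<zeta> ^ (i + j) * V" unfolding V_def mult_2 power_add
    by (simp only: mult_ac)
  also have "\<zeta> ^ (i + j) = 1" by (simp add: ij zeta_power_eq_1_iff)
  finally have gV: "gal 2 V = of_int s * V" by simp
  have "gal (2 ^ n) V = of_int (s ^ n) * V" for n
  proof (induction n)
    case 0
    then show ?case using V by (simp add: gal_Suc_0)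
  next
    case (Suc n)
    have "gal (2 ^ Suc n) V = gal 2 (of_int (s ^ n) * V)" using gal_power_Suc[OF V] Suc by simp
    also have "\<dots> = of_int (s ^ n) * (of_int s * V)" using V gV by (simp only: G Zz_of_int)
    finally show ?case by (simp add: mult_ac)
  qed
  from this[of f] have "of_int (s ^ f) * V = V" using gal_power_f[OF V] by simp
  then have "complex_of_int (s ^ f) = of_int 1" using V0 by simp
  then have "s ^ f = 1" by (simp only: of_int_eq_iff)
  then have "s = 1" using s(1) odd_f by auto
  then have "V \<in> qints" using fixed_imp_qints[OF V] gV by simp
  then obtain u v where uv: "V = qint u v" by (rule qintsE)
  have zz: "\<zeta> ^ i * cnj (\<zeta> ^ i) = 1"
    unfolding complex_norm_square[symmetric] by (simp add: norm_power cmod_zeta)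
  have "of_int (qnorm c u v) = V * cnj V" by (simp add: uv qint_norm)
  also have "\<dots> = (\<zeta> ^ i * cnj (\<zeta> ^ i)) * (W * cnj W)" by (simp add: V_def mult_ac)
  also have "\<dots> = of_int (2 ^ k)" unfolding zz W(3) by simp
  finally have "qnorm c u v = 2 ^ k" by (simp only: of_int_eq_iff)
  moreover have "odd u \<or> odd v"
  proof (rule ccontr)
    assume "\<not> ?thesis"
    then obtain a b where "u = 2 * a" "v = 2 * b" by (auto elim!: evenE)
    then have "V = 2 ^ 1 * (of_int a + of_int b * \<theta>)"
      by (simp add: uv qint_def algebra_simps)
    then have "V \<in> D 1" by (simp only: DI Zz_add Zz_mult Zz_of_int theta_in_Zz)
    then have "cnj (\<zeta> ^ i) * V \<in> D 1"
      by (rule D_mult_left) (intro Zz_cnj Zz_power zeta_in_Zz)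
    moreover have "cnj (\<zeta> ^ i) * V = W" using zz by (simp add: V_def mult_ac)
    ultimately show False using W(2) by simp
  qed
  ultimately show ?thesis by blast
qed

text \<open>Dividing by 2 lowers the exponent of the norm by 2 and keeps it odd, so the process
  cannot end at a unit.\<close>

lemma extract_two:
  assumes "W \<in> Zz" "W * cnj W = 2 ^ n" "odd n"
  shows "\<exists>V k. V \<in> Zz \<and> V \<notin> D 1 \<and> V * cnj V = 2 ^ k \<and> odd k \<and> k \<le> n \<and> (W \<in> D 1 \<longrightarrow> k < n)"
  using assms
proof (induction n arbitrary: W rule: less_induct)
  case (less n)
  show ?case
  proof (cases "W \<in> D 1")
    case False
    then show ?thesis using less.prems by (intro exI[of _ W] exI[of _ n]) auto
  next
    case True
    then obtain z where z: "z \<in> Zz" "W = 2 * z" by (auto simp: D_def)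
    have eq: "4 * (z * cnj z) = 2 ^ n" using less.prems(2) z(2) by simp
    have "n \<noteq> 1"
    proof
      assume "n = 1"
      then have "of_int 2 = of_int 4 * (z * cnj z)" using eq by simp
      then have "(4::int) dvd 2" using z(1) by (intro Zz_rational_multiple[of "z * cnj z"]) auto
      then show False by (auto dest: zdvd_imp_le)
    qed
    then have n: "n \<ge> 2" using less.prems(3) by (cases n) auto
    have "(2::complex) ^ Suc (Suc (n - 2)) = 4 * 2 ^ (n - 2)" by simp
    moreover have "Suc (Suc (n - 2)) = n" using n by simp
    ultimately have "(2::complex) ^ n = 4 * 2 ^ (n - 2)" by (simp only:)
    then have "z * cnj z = 2 ^ (n - 2)" using eq by simp
    moreover have "odd (n - 2)" using less.prems(3) n by simp
    ultimately obtain V k where "V \<in> Zz" "V \<notin> D 1" "V * cnj V = 2 ^ k" "odd k" "k \<le> n - 2"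
      using less.IH[of "n - 2" z] z(1) n by auto
    then show ?thesis using n by (intro exI[of _ V] exI[of _ k]) auto
  qed
qed

lemma even_difference_imp_plus_minus:
  assumes n: "odd n" and min: "\<And>k u v. k > 0 \<Longrightarrow> qnorm c u v = 2 ^ k \<Longrightarrow> odd u \<or> odd v \<Longrightarrow> n \<le> k"
    and W1: "W1 \<in> Zz" "W1 * cnj W1 = 2 ^ n" and W2: "W2 \<in> Zz" "W2 * cnj W2 = 2 ^ n"
    and diff: "W1 - W2 \<in> D 1"
  shows "\<exists>s\<in>{1, -1}. W1 = of_int s * W2"
proof -
  have prim: "W \<notin> D 1" if W: "W \<in> Zz" "W * cnj W = 2 ^ n" for W
  proof
    assume "W \<in> D 1"
    then obtain V k where V: "V \<in> Zz" "V \<notin> D 1" "V * cnj V = 2 ^ k" "odd k" "k < n"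
      using extract_two[OF W n] by blast
    have "k > 0" using V(4) by (rule odd_pos)
    then have "n \<le> k" using primitive_element_gives_primitive_norm[OF V(1-3)] min by blast
    then show False using V(5) by simp
  qed
  have "n > 0" using n by (rule odd_pos)
  obtain \<tau> where \<tau>: "\<tau> \<in> {\<theta>, cnj \<theta>}" "W2 ^ M - \<tau> \<in> D 1"
    using primitive_power_M_cong[OF W2(1) prim[OF W2] W2(2) \<open>n > 0\<close>] .
  have "W1 ^ M - W2 ^ M \<in> D 1" using diff W1(1) W2(1) by (rule D_power_diff)
  then have "W1 ^ M - \<tau> \<in> D 1" using \<tau>(2) by (rule D_trans)
  then obtain s j where s: "s = 1 \<or> s = -1" "W1 = of_int s * \<zeta> ^ j * W2"
    using associated_up_to_root_of_unity[OF W1 _ W2 \<tau>(2,1)] by blast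
  define \<xi> where "\<xi> = \<zeta> ^ j"
  have xi: "\<xi> \<in> Zz" "\<xi> ^ q = 1"
    by (simp_all add: \<xi>_def zeta_power_eq_1_iff flip: power_mult)
  have "(1 - \<xi>) * W2 \<in> D 1"
    using s(1)
  proof
    assume "s = 1"
    then have "(1 - \<xi>) * W2 = - (W1 - W2)" using s(2) by (simp add: \<xi>_def algebra_simps)
    then show ?thesis using D_minus[OF diff] by (simp only:)
  next
    assume "s = -1"
    then have "(1 - \<xi>) * W2 = (W1 - W2) + 2 ^ 1 * W2"
      using s(2) by (simp add: \<xi>_def algebra_simps)
    then show ?thesis using D_add[OF diff DI[OF W2(1)]] by (simp only:)
  qed
  \<comment> \<open>Otherwise \<open>1 - \<xi>\<close> would divide the odd number \<open>q\<close>,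
    since the powers of \<xi> sum to 0, and then \<open>W2\<close> itself would be divisible by
    2.\<close>
  have "\<xi> = 1"
  proof (rule ccontr)
    assume "\<xi> \<noteq> 1"
    then have "(\<Sum>b<q. \<xi> ^ b) = 0" using sum_powers_root_of_unity[OF xi(2)] by simp
    then have "of_nat q = (\<Sum>b<q. 1 - \<xi> ^ b)" by (simp add: sum_subtractf)
    also have "\<dots> = (\<Sum>b<q. (1 - \<xi>) * (\<Sum>a<b. \<xi> ^ a))"
      by (simp only: one_diff_power_eq)
    also have "\<dots> = (1 - \<xi>) * (\<Sum>b<q. \<Sum>a<b. \<xi> ^ a)"
      by (simp only: sum_distrib_left)
    finally have "of_nat q * W2 = (1 - \<xi>) * W2 * (\<Sum>b<q. \<Sum>a<b. \<xi> ^ a)"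
      by (simp add: mult_ac)
    also have "\<dots> \<in> D 1"
      using \<open>(1 - \<xi>) * W2 \<in> D 1\<close> xi(1) by (intro D_mult[of "(1 - \<xi>) * W2"]) auto
    finally have qW: "of_nat q * W2 \<in> D 1" .
    obtain g where "q = 2 * g + 1" using odd_q by (auto elim: oddE)
    then have "W2 = of_nat q * W2 - 2 ^ 1 * (of_nat g * W2)" by (simp add: algebra_simps)
    also have "\<dots> \<in> D 1" using qW W2(1) by (intro D_diff DI) auto
    finally show False using prim[OF W2] by simp
  qed
  then show ?thesis using s by (auto simp: \<xi>_def)
qed

lemma no_gbent:
  assumes n: "odd n" and min: "\<And>k u v. k > 0 \<Longrightarrow> qnorm c u v = 2 ^ k \<Longrightarrow> odd u \<or> odd v \<Longrightarrow> n \<le> k"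
  shows "\<not> gbent n (2 * q) F"
proof
  assume g: "gbent n (2 * q) F"
  define \<xi> where "\<xi> = cis (2 * pi / real (2 * q))"
  \<comment> \<open>As \<open>q\<close> is odd, a \<open>2 * q\<close>-th root of unity is a
    \<open>q\<close>-th root of unity up to sign, so the transform takes values in
    \<open>Zz\<close>.\<close>
  have "\<xi> = - (\<zeta> ^ ((q + 1) div 2))"
  proof -
    have "2 * pi * real ((q + 1) div 2) / real q = pi + 2 * pi / real (2 * q)"
      using odd_q q_pos by (auto elim!: oddE simp: field_simps)
    then show ?thesis by (simp add: \<xi>_def zeta_power flip: cis_mult)
  qed
  then have xiZ: "\<xi> \<in> Zz" by simp
  define W where "W l = (\<Sum>x\<in>cube n. \<xi> ^ F x * (-1) ^ dotp n x l)" for l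
  have WZ: "W l \<in> Zz" for l using xiZ by (simp add: W_def)
  have W: "W l * cnj (W l) = 2 ^ n" if "l \<in> cube n" for l
  proof -
    have "cmod (W l) = 2 powr (real n / 2)" using g that by (simp add: gbent_def W_def \<xi>_def)
    then have "(cmod (W l))\<^sup>2 = 2 powr real n" by (simp add: power2_eq_square flip: powr_add)
    then have "(cmod (W l))\<^sup>2 = 2 ^ n" by (simp add: powr_realpow)
    then show ?thesis unfolding complex_norm_square[symmetric] by simp
  qed
  have diff: "W l - W l' \<in> D 1" for l l'
  proof -
    have "W l - W l' = (\<Sum>x\<in>cube n. \<xi> ^ F x * ((-1) ^ dotp n x l - (-1) ^ dotp n x l'))"
      by (simp add: W_def sum_subtractf algebra_simps)
    also have "\<dots> \<in> D 1"
    proof (intro D_sum D_mult_left Zz_power xiZ)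
      fix x
      show "(-1) ^ dotp n x l - (-1) ^ dotp n x l' \<in> D 1"
        using D_0[of 1] DI[of 1 1] DI[of "-1" 1]
          by (cases "even (dotp n x l)"; cases "even (dotp n x l')") auto
    qed
    finally show ?thesis .
  qed
  define z where "z = (\<lambda>_::nat. False)"
  have z: "z \<in> cube n" by (simp add: z_def cube_def)
  have "\<exists>s. W l = of_int s * W z" if l: "l \<in> cube n" for l
  proof -
    have "\<exists>s\<in>{1, -1}. W l = of_int s * W z"
      by (rule even_difference_imp_plus_minus[OF n _ WZ W[OF l] WZ W[OF z] diff]) (rule min)
    then show ?thesis by blast
  qed
  then obtain s where s: "\<And>l. l \<in> cube n \<Longrightarrow> W l = of_int (s l) * W z"
    by metis
  define C where "C = (\<Sum>l\<in>cube n. s l)"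
  \<comment> \<open>Fourier inversion at the origin: summing over all characters isolates the term
    of \<open>x = z\<close>.\<close>
  have "of_int C * W z = (\<Sum>l\<in>cube n. W l)" by (simp add: C_def sum_distrib_right s)
  also have "\<dots> = (\<Sum>x\<in>cube n. \<xi> ^ F x * (\<Sum>l\<in>cube n. (-1) ^ dotp n x l))"
    unfolding W_def by (subst sum.swap) (simp add: sum_distrib_left)
  also have "\<dots> = (\<Sum>x\<in>cube n. if x = z then \<xi> ^ F z * 2 ^ n else 0)"
    by (intro sum.cong refl) (auto simp: sum_cube_character z_def)
  also have "\<dots> = \<xi> ^ F z * 2 ^ n" using finite_cube z by simp
  finally have total: "of_int C * W z = \<xi> ^ F z * 2 ^ n" .
  have "cmod \<xi> = 1" by (simp add: \<xi>_def)
  have normW: "(cmod (W z))\<^sup>2 = 2 ^ n"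
  proof -
    have "complex_of_real ((cmod (W z))\<^sup>2) = complex_of_real (2 ^ n)"
      using W[OF z] by (simp only: complex_norm_square) simp
    then show ?thesis by (simp only: of_real_eq_iff)
  qed
  have "(real_of_int C)\<^sup>2 * 2 ^ n = (cmod (of_int C * W z))\<^sup>2"
    by (simp add: norm_mult power_mult_distrib normW)
  also have "\<dots> = 2 ^ n * 2 ^ n"
    unfolding total using \<open>cmod \<xi> = 1\<close>
      by (simp add: norm_mult norm_power power_mult_distrib power2_eq_square)
  finally have "(real_of_int C)\<^sup>2 = 2 ^ n" by simp
  then have "real_of_int (C\<^sup>2) = real_of_int (2 ^ n)" by simp
  then have C2: "C\<^sup>2 = 2 ^ n" by (simp only: of_int_eq_iff)
  then have "C dvd 2 ^ n" by (metis dvd_triv_left power2_eq_square)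
  then obtain k where "normalize C = normalize (2 ^ k)" using divides_primepow[of 2 C n] by auto
  then have "\<bar>C\<bar> = 2 ^ k" by simp
  then have "(2::int) ^ (2 * k) = 2 ^ n" using C2 by (metis power2_abs power_mult mult.commute)
  then have "2 * k = n" by (simp add: power_inject_exp)
  then show False using n by auto
qed

end

theorem theorem2:
  fixes p :: nat and P :: "complex set"
  assumes "prime p" and "p mod 8 = 7"
    and "ord p 2 = (p - 1) div 2"
    and "primeideal P (OK p)" and "2 \<in> P"
  shows "(\<not> (\<exists>f. gbent (tP p P) (2 * p) f))
       \<and> (\<not> [2 ^ (p - 1) = 1] (mod p^2) \<longrightarrow>
            (\<forall>e::nat \<ge> 1. \<not> (\<exists>f. gbent (tP p P) (2 * p ^ e) f)))"
proof -
  have "4 dvd int p + 1" using assms(2) by presburger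
  then obtain c where c: "4 * c = int p + 1" by (auto elim: dvdE)
  note t = tP_odd_minimal[OF assms(1,2,4,5) c]
  have main: "\<not> gbent (tP p P) (2 * p ^ e) f"
    if "e > 0" "e = 1 \<or> \<not> [2 ^ (p - 1) = 1] (mod p\<^sup>2)" for e f
  proof -
    interpret cyclotomic_7 p e c using assms that c by unfold_locales auto
    show ?thesis using no_gbent[of "tP p P" f, OF t] unfolding q_def by simp
  qed
  show ?thesis using main[of 1] main by auto
qed

end
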